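(* Let $T>0$, $d_1=d\ge1$, $x\in\mathbb{R}^{d_1}$, and let $$b:[0,T]\times\mathbb{R}^{d_1}\to\mathbb{R}^{d_1},\quad \sigma:[0,T]\times\mathbb{R}^{d_1}\to\mathbb{R}^{d_1\times d},\quad f:[0,T]\times\mathbb{R}^{d_1}\times\mathbb{R}\times\mathbb{R}^{1\times d}\to\mathbb{R},\quad g:\mathbb{R}^{d_1}\to\mathbb{R}$$ be deterministic functions such that: 1. $b(\cdot,0)$, $\sigma(\cdot,0)$, $f(\cdot,0,0,0)$ and $g(0)$ are bounded; 2. $b,\sigma,f,g$ are uniformly Lipschitz continuous in $(x,y,z)$ and $\frac12$-Hölder continuous in $t$, with constant $K$; 3. $\sigma\sigma^{\mathrm T}\ge\delta I_{d_1}$ on $[0,T]\times\mathbb{R}^{d_1}$ for some constant $\delta>0$; 4. $|f(t,x,y_1,z)-f(t,x,y_2,z)|^2\le K_y|y_1-y_2|^2$ for all $t,x,y_1,y_2,z$, where $6T^2K_y<1$; 5. the PDE $$\partial_t u+b\cdot\nabla_x u+\tfrac12\operatorname{Tr}\left(\mathrm{Hess}_x u\,(\sigma\sigma^{\mathrm T})\right)+f(t,x,u,\nabla_x u\,\sigma)=0,\qquad u(T,x)=g(x),$$ has a classical solution $u\in C^{1,2}([0,T]\times\mathbb{R}^{d_1},\mathbb{R})$; 6. the function $(t,x)\mapsto\nabla_x u(t,x)\sigma(t,x)$ is Lipschitz with respect to $x$ with a Lipschitz constant $L$ (uniformly in $t\in[0,T]$). Then there are constants $C>0$ and $h_0>0$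 such that for every integer $n\ge1$ with $h=T/n\le h_0$ and $t_i=ih$, and every choice of $\mathcal{F}_{t_i}$-measurable $\mathbb{R}^{1\times d}$-valued random variables $Z^\pi_{t_i}$, $0\le i\le n-1$, if $\{X^\pi_{t_i},Y^\pi_{t_i}\}_{i=0}^n$ is defined by $$X^\pi_{t_{i+1}}=X^\pi_{t_i}+b(t_i,X^\pi_{t_i})h+\sigma(t_i,X^\pi_{t_i})\Delta W_i,\qquad X^\pi_0=x,$$ $$Y^\pi_{t_i}=Y^\pi_{t_{i+1}}+f(t_i,X^\pi_{t_i},Y^\pi_{t_{i+1}},Z^\pi_{t_i})h-Z^\pi_{t_i}\Delta W_i,\qquad Y^\pi_T=g(X^\pi_T),$$ then $$\operatorname{Var}(Y^\pi_0)\le C\left[h+\sum_{i=0}^{n-1}\mathbb{E}\left|f_i(X^\pi_{t_i})-Z^\pi_{t_i}\right|^2h\right],\qquad\text{where } f_i(x)=\nabla_x u(t_i,x)\sigma(t_i,x).$$ The constants $C$ and $h_0$ do not depend on $n$ nor on the choice of the $Z^\pi_{t_i}$.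
   Context: $(\Omega,\mathcal{F},\{\mathcal{F}_t\}_{0\le t\le T},\mathbb{P})$ is a filtered probability space supporting a $d$-dimensional Brownian motion $W$, and $\{\mathcal{F}_t\}$ is the natural filtration of $W$ augmented by all $\mathbb{P}$-null sets. The scheme is a time discretization of the decoupled forward-backward system $$X_t=x+\int_0^t b(s,X_s)\,ds+\int_0^t\sigma(s,X_s)\,dW_s,\qquad Y_t=g(X_T)+\int_t^T f(s,X_s,Y_s,Z_s)\,ds-\int_t^T Z_s\,dW_s,$$ whose solution $(X,Y,Z)$ is $\{\mathcal{F}_t\}$-adapted and square-integrable in the usual sense; by the nonlinear Feynman-Kac formula, $Y_t=u(t,X_t)$ and $Z_t=\nabla_x u(t,X_t)\sigma(t,X_t)$. Here $\nabla_x u$, when multiplied by $\sigma$, is regarded as a row vector. For the partition $t_i=ih$, $h=T/n$, set $\Delta W_i=W_{t_{i+1}}-W_{t_i}$. The subscripts $0$ and $T$ are used for the time indices $t_0$ and $t_n$. Note that $Y^\pi_{t_i}$ is computed backward in time and is in general not $\mathcal{F}_{t_i}$-measurable; in particular $Y_0^\pi$ is in general random. Expectations of nonnegative random variables may be $+\infty$, and $\operatorname{Var}(Y_0^\pi)$ is understood as $+\infty$ if $Y_0^\pi$ is not square-integrable. *)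

theory Defs
  imports "HOL-Probability.Probability"
begin

text \<open>The state space and the range of the Brownian motion have the same dimension \<open>CARD('d)\<close>.
  Row vectors in $\mathbb{R}^{1\times d}$ are elements \<open>z\<close> of \<open>real^'d\<close>: \<open>z v* A\<close> is the
  product of a row vector and a matrix, and the product of \<open>z\<close> with a column vector \<open>w\<close> is
  \<open>z \<bullet> w\<close>. The norm of \<open>real^'d^'d\<close> is the Frobenius norm.
  Functions of time are total; only their values on \<open>{0..T}\<close> are used.\<close>

section \<open>Brownian motion and its augmented filtration\<close>

locale brownian_motion = prob_space M
  for M :: "'a measure" and T :: real and W :: "real \<Rightarrow> 'a \<Rightarrow> real^'d::finite" +
  assumes measurable_W: "\<And>t. t \<in> {0..T} \<Longrightarrow> W t \<in> borel_measurable M"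
    and start_W: "AE \<omega> in M. W 0 \<omega> = 0"
    and continuous_W: "AE \<omega> in M. continuous_on {0..T} (\<lambda>t. W t \<omega>)"
    and indep_increments_W:
      "\<And>(k::nat) \<tau>. 0 \<le> \<tau> 0 \<Longrightarrow> (\<And>i. i < k \<Longrightarrow> \<tau> i \<le> \<tau> (Suc i)) \<Longrightarrow> \<tau> k \<le> T \<Longrightarrow>
         indep_vars (\<lambda>_. borel) (\<lambda>i \<omega>. W (\<tau> (Suc i)) \<omega> - W (\<tau> i) \<omega>) {..<k}"
    and normal_increments_W:
      "\<And>s t. 0 \<le> s \<Longrightarrow> s < t \<Longrightarrow> t \<le> T \<Longrightarrow>
         distributed M lborel (\<lambda>\<omega>. W t \<omega> - W s \<omega>)
           (\<lambda>x. ennreal (\<Prod>i\<in>UNIV. normal_density 0 (sqrt (t - s)) (x $ i)))"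

text \<open>\<open>M\<close> need not be complete: \<open>null_sets M\<close> consists of the measurable sets of measure zero,
  which are all null sets if \<open>M\<close> is complete.\<close>

definition augmented_filtration ::
    "'a measure \<Rightarrow> (real \<Rightarrow> 'a \<Rightarrow> 'b::topological_space) \<Rightarrow> real \<Rightarrow> 'a measure" where
  "augmented_filtration M W t =
     sigma (space M)
       ({W s -` A \<inter> space M | s A. s \<in> {0..t} \<and> A \<in> sets borel} \<union> null_sets M)"

text \<open>The variance with values in $[0,\infty]$; it is $\infty$ if \<open>Y\<close> is not square-integrable.\<close>

definition extended_variance :: "'a measure \<Rightarrow> ('a \<Rightarrow> real) \<Rightarrow> ennreal" where
  "extended_variance M Y =
     (if Y \<in> borel_measurable M \<and> integrable M (\<lambda>\<omega>. (Y \<omega>)\<^sup>2)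
      then ennreal (prob_space.variance M Y) else \<infinity>)"

section \<open>Coefficients\<close>

definition half_hoelder_on :: "real \<Rightarrow> real set \<Rightarrow> (real \<Rightarrow> 'b::metric_space) \<Rightarrow> bool" where
  "half_hoelder_on K S \<phi> \<longleftrightarrow> (\<forall>s\<in>S. \<forall>t\<in>S. dist (\<phi> s) (\<phi> t) \<le> K * sqrt \<bar>s - t\<bar>)"

definition loewner_le :: "real^'d^'d \<Rightarrow> real^'d^'d \<Rightarrow> bool" where
  "loewner_le A B \<longleftrightarrow> (\<forall>v. v \<bullet> (A *v v) \<le> v \<bullet> (B *v v))"

section \<open>Classical solutions\<close>

text \<open>At the end points of \<open>{0..T}\<close> the time derivative is one-sided.\<close>

definition time_deriv :: "real \<Rightarrow> (real \<Rightarrow> real^'d \<Rightarrow> real) \<Rightarrow> real \<Rightarrow> real^'d \<Rightarrow> real" where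
  "time_deriv T u t x = vector_derivative (\<lambda>s. u s x) (at t within {0..T})"

definition grad_x :: "(real \<Rightarrow> real^'d \<Rightarrow> real) \<Rightarrow> real \<Rightarrow> real^'d \<Rightarrow> real^'d" where
  "grad_x u t x = (\<chi> i. frechet_derivative (u t) (at x) (axis i 1))"

definition hess_x :: "(real \<Rightarrow> real^'d \<Rightarrow> real) \<Rightarrow> real \<Rightarrow> real^'d \<Rightarrow> real^'d^'d" where
  "hess_x u t x = jacobian (grad_x u t) (at x)"

definition C12 :: "real \<Rightarrow> (real \<Rightarrow> real^'d \<Rightarrow> real) \<Rightarrow> bool" where
  "C12 T u \<longleftrightarrow>
     (\<forall>t\<in>{0..T}. \<forall>x. (\<lambda>s. u s x) differentiable (at t within {0..T}) \<and>
        u t differentiable (at x) \<and> grad_x u t differentiable (at x)) \<and>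
     continuous_on ({0..T} \<times> UNIV) (\<lambda>(t, x). u t x) \<and>
     continuous_on ({0..T} \<times> UNIV) (\<lambda>(t, x). time_deriv T u t x) \<and>
     continuous_on ({0..T} \<times> UNIV) (\<lambda>(t, x). grad_x u t x) \<and>
     continuous_on ({0..T} \<times> UNIV) (\<lambda>(t, x). hess_x u t x)"

definition classical_solution ::
    "real \<Rightarrow> (real \<Rightarrow> real^'d \<Rightarrow> real^'d) \<Rightarrow> (real \<Rightarrow> real^'d \<Rightarrow> real^'d^'d) \<Rightarrow>
     (real \<Rightarrow> real^'d \<Rightarrow> real \<Rightarrow> real^'d \<Rightarrow> real) \<Rightarrow> (real^'d \<Rightarrow> real) \<Rightarrow>
     (real \<Rightarrow> real^'d \<Rightarrow> real) \<Rightarrow> bool" where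
  "classical_solution T b \<sigma> f g u \<longleftrightarrow>
     C12 T u \<and>
     (\<forall>t\<in>{0..<T}. \<forall>x.
        time_deriv T u t x + b t x \<bullet> grad_x u t x
        + 1/2 * trace (hess_x u t x ** (\<sigma> t x ** transpose (\<sigma> t x)))
        + f t x (u t x) (grad_x u t x v* \<sigma> t x) = 0) \<and>
     (\<forall>x. u T x = g x)"

section \<open>The discretization scheme\<close>

definition euler_scheme ::
    "'a measure \<Rightarrow> (real \<Rightarrow> 'a \<Rightarrow> real^'d) \<Rightarrow> (real \<Rightarrow> real^'d \<Rightarrow> real^'d) \<Rightarrow>
     (real \<Rightarrow> real^'d \<Rightarrow> real^'d^'d) \<Rightarrow> real^'d \<Rightarrow> nat \<Rightarrow> real \<Rightarrow> (nat \<Rightarrow> 'a \<Rightarrow> real^'d) \<Rightarrow> bool" where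
  "euler_scheme M W b \<sigma> x n h X \<longleftrightarrow>
     (\<forall>\<omega>\<in>space M. X 0 \<omega> = x \<and>
        (\<forall>i<n. X (Suc i) \<omega> =
           X i \<omega> + h *\<^sub>R b (real i * h) (X i \<omega>)
           + \<sigma> (real i * h) (X i \<omega>) *v (W (real (Suc i) * h) \<omega> - W (real i * h) \<omega>)))"

definition backward_scheme ::
    "'a measure \<Rightarrow> (real \<Rightarrow> 'a \<Rightarrow> real^'d) \<Rightarrow> (real \<Rightarrow> real^'d \<Rightarrow> real \<Rightarrow> real^'d \<Rightarrow> real) \<Rightarrow>
     (real^'d \<Rightarrow> real) \<Rightarrow> nat \<Rightarrow> real \<Rightarrow> (nat \<Rightarrow> 'a \<Rightarrow> real^'d) \<Rightarrow> (nat \<Rightarrow> 'a \<Rightarrow> real^'d) \<Rightarrow>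
     (nat \<Rightarrow> 'a \<Rightarrow> real) \<Rightarrow> bool" where
  "backward_scheme M W f g n h X Z Y \<longleftrightarrow>
     (\<forall>\<omega>\<in>space M. Y n \<omega> = g (X n \<omega>) \<and>
        (\<forall>i<n. Y i \<omega> =
           Y (Suc i) \<omega> + f (real i * h) (X i \<omega>) (Y (Suc i) \<omega>) (Z i \<omega>) * h
           - Z i \<omega> \<bullet> (W (real (Suc i) * h) \<omega> - W (real i * h) \<omega>)))"

end

theory Submission
  imports Defs
begin

text \<open>No stochastic calculus is needed. Since \<open>grad_x u v* \<sigma>\<close> is Lipschitz in \<open>x\<close> and \<open>\<sigma>\<close> is
  uniformly elliptic, the gradient of \<open>u\<close> is locally Lipschitz and the Hessian grows linearly; the PDE
  then bounds the time derivative polynomially, and interpolation makes the gradient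
  \<open>1/2\<close>-Hoelder in time. For one Euler step with \<open>h = \<tau>\<^sup>2\<close> and a standard Gaussian \<open>\<xi>\<close>, a Taylor
  expansion shows that the increment of \<open>u\<close> is \<open>\<tau> (w \<bullet> \<xi>)\<close> up to \<open>O(h)\<close>, and Gaussian
  integration by parts together with the PDE shows that its mean is \<open>- h f\<close> up to \<open>O(h powr (3/2))\<close>.
  Hence \<open>Y i - u (t i) (X i)\<close> satisfies a backward recursion whose increments are a martingale difference
  of variance \<open>O(h\<^sup>2 + h E\<bar>w - Z\<bar>\<^sup>2)\<close> and a term controlled by the Lipschitz constant of \<open>f\<close>.
  Orthogonality of the former and a discrete Gronwall inequality bound the second moment at time \<open>0\<close>,
  which dominates the variance of \<open>Y 0\<close>, as \<open>u 0 x\<^sub>0\<close> is deterministic.\<close>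

section \<open>The standard Gaussian measure\<close>

text \<open>Instead, the Gaussian mean of \<open>u\<close> along the step is differentiated in
  \<tau>. Integration by parts produces the Hessian at the very point where the other derivatives
  are taken, and the PDE at that same point removes it. What is left is the Hessian times a
  difference of diffusion matrices, for which its size suffices. A second obstacle is that
  \<open>Y i\<close> looks into the future. Only the fluctuations \<open>N i\<close> are adapted.
  The terms \<open>P i\<close> are not, and Cauchy-Schwarz costs a factor \<open>n\<close> on their
  sum; this is affordable because their second moments are of order \<open>h ^ 3\<close> plus
  \<open>h\<^sup>2\<close> times the errors in \<open>Y\<close> and \<open>Z\<close>. The growth
  bounds on the derivatives are polynomial, hence moments of the Euler chain of degree six and eight
  enter the constants.\<close>

definition gauss_density :: "real^'d::finite \<Rightarrow> real" where
  "gauss_density x = (\<Prod>i\<in>UNIV. normal_density 0 1 (x $ i))"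

definition gaussian :: "(real^'d::finite) measure" where
  "gaussian = density lborel (\<lambda>x. ennreal (gauss_density x))"

lemma sets_gaussian [measurable_cong, simp]: "sets gaussian = sets borel"
  by (simp add: gaussian_def)

lemma space_gaussian [simp]: "space gaussian = UNIV"
  by (simp add: gaussian_def)

lemma norm_power2_vec: "(norm (x::real^'d::finite))\<^sup>2 = (\<Sum>i\<in>UNIV. (x $ i)\<^sup>2)"
  by (simp add: norm_vec_def L2_set_def sum_nonneg)

text \<open>Reindexing along the bijection \<open>axis i 1\<close> between the index type and
  \<open>Basis\<close>; it carries the product formula for Lebesgue integrals over
  \<open>Basis\<close> to coordinates \<open>x $ i\<close>.\<close>

lemma prod_Basis_vec:
  fixes F :: "real^'d::finite \<Rightarrow> real \<Rightarrow> 'b::comm_monoid_mult"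
  shows "(\<Prod>b\<in>Basis. F b (x \<bullet> b)) = (\<Prod>i\<in>UNIV. F (axis i 1) (x $ i))"
proof -
  have B: "(Basis :: (real^'d) set) = (\<lambda>i. axis i 1) ` UNIV"
    by (auto simp: Basis_vec_def)
  have inj: "inj (\<lambda>i. axis i (1::real) :: real^'d)"
    by (auto simp: inj_on_def axis_eq_axis)
  show ?thesis unfolding B by (subst prod.reindex[OF inj]) (simp add: inner_axis)
qed

lemma nn_integral_lborel_vec_prod:
  fixes F :: "real \<Rightarrow> ennreal"
  assumes [measurable]: "F \<in> borel_measurable borel"
  shows "(\<integral>\<^sup>+x. (\<Prod>i\<in>UNIV. F (x $ i)) \<partial>(lborel :: (real^'d::finite) measure))
     = (\<integral>\<^sup>+x. F x \<partial>lborel) ^ CARD('d)"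
proof -
  have "(\<integral>\<^sup>+x. (\<Prod>i\<in>UNIV. F (x $ i)) \<partial>(lborel :: (real^'d) measure))
      = (\<integral>\<^sup>+x. (\<Prod>b\<in>Basis. F (x \<bullet> b)) \<partial>(lborel :: (real^'d) measure))"
    by (subst prod_Basis_vec) simp
  also have "\<dots> = (\<Prod>b\<in>(Basis :: (real^'d) set). (\<integral>\<^sup>+x. F x \<partial>lborel))"
    by (rule nn_integral_lborel_prod) auto
  finally show ?thesis by simp
qed

lemma gauss_density_nonneg: "0 \<le> gauss_density x"
  by (simp add: gauss_density_def prod_nonneg)

lemma gauss_density_eq:
  fixes x :: "real^'d::finite"
  shows "gauss_density x = (1 / sqrt (2 * pi)) ^ CARD('d) * exp (- (norm x)\<^sup>2 / 2)"
  by (simp add: gauss_density_def normal_density_def norm_power2_vec prod_dividef power_divide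
      sum_negf sum_divide_distrib flip: exp_sum)

lemma continuous_gauss_density: "continuous_on UNIV (gauss_density :: real^'d::finite \<Rightarrow> real)"
  unfolding gauss_density_eq[abs_def] by (intro continuous_intros) auto

lemma borel_measurable_gauss_density [measurable]:
  "(gauss_density :: real^'d::finite \<Rightarrow> real) \<in> borel_measurable borel"
  by (rule borel_measurable_continuous_onI[OF continuous_gauss_density])

lemma nn_integral_normal_density: "s > 0 \<Longrightarrow> (\<integral>\<^sup>+x. ennreal (normal_density m s x) \<partial>lborel) = 1"
  by (subst nn_integral_eq_integral) (auto simp: integral_normal_density)

lemma prob_space_gaussian: "prob_space (gaussian :: (real^'d::finite) measure)"
proof
  have "emeasure (gaussian :: (real^'d) measure) (space gaussian)
      = (\<integral>\<^sup>+x. (\<Prod>i\<in>UNIV. ennreal (normal_density 0 1 (x $ i))) \<partial>(lborel :: (real^'d) measure))"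
    by (simp add: gaussian_def emeasure_density gauss_density_def prod_ennreal)
  also have "\<dots> = 1"
    by (subst nn_integral_lborel_vec_prod) (simp_all add: nn_integral_normal_density)
  finally show "emeasure (gaussian :: (real^'d) measure) (space gaussian) = 1" .
qed

lemma integrable_gaussian_iff:
  fixes F :: "real^'d::finite \<Rightarrow> real"
  assumes "F \<in> borel_measurable borel"
  shows "integrable gaussian F \<longleftrightarrow> integrable lborel (\<lambda>x. gauss_density x * F x)"
  using assms unfolding gaussian_def
  by (subst integrable_density) (auto simp: gauss_density_nonneg)

lemma integral_gaussian_eq:
  fixes F :: "real^'d::finite \<Rightarrow> real"
  assumes "F \<in> borel_measurable borel"
  shows "integral\<^sup>L gaussian F = (\<integral>x. gauss_density x * F x \<partial>lborel)"
  using assms unfolding gaussian_def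
  by (subst integral_density) (auto simp: gauss_density_nonneg)

section \<open>Polynomial moments of the Gaussian measure\<close>

text \<open>A single term of the exponential series gives
  \<open>(1 + r) ^ q / fact q \<le> exp (1 + r)\<close>, and
  \<open>r \<le> 1 + r\<^sup>2 / 4\<close> is the square of \<open>r / 2 - 1\<close>. The rate 1/4
  uses up only half of the Gaussian decay.\<close>

lemma power_le_exp_square:
  fixes r :: real
  assumes "r \<ge> 0"
  shows "(1 + r) ^ q \<le> fact q * exp 2 * exp (r\<^sup>2 / 4)"
proof -
  have "(1 + r) ^ q / fact q \<le> (\<Sum>n. (1 + r) ^ n / fact n)"
    using sum_le_suminf[of "\<lambda>n. (1 + r) ^ n / fact n" "{q}"] summable_exp[of "1 + r"] assms
    by (simp add: divide_inverse mult.commute)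
  also have "\<dots> = exp (1 + r)"
    by (simp add: exp_def divide_inverse mult.commute)
  also have "\<dots> \<le> exp (2 + r\<^sup>2 / 4)"
    using sum_squares_bound[of "r/2" 1] by (simp add: power_divide)
  finally have "(1 + r) ^ q / fact q \<le> exp 2 * exp (r\<^sup>2 / 4)"
    by (simp only: exp_add)
  then show ?thesis by (simp add: pos_divide_le_eq mult_ac)
qed

text \<open>Half of the exponent absorbs the polynomial; the other half is, up to normalisation, the
  density \<open>?F\<close> of independent normals of variance 2.\<close>

lemma integrable_gauss_density_power:
  "integrable (lborel :: (real^'d::finite) measure) (\<lambda>x. gauss_density x * (1 + norm x) ^ q)"
proof -
  let ?F = "\<lambda>x::real^'d. \<Prod>i\<in>UNIV. normal_density 0 (sqrt 2) (x $ i)"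
  let ?c = "(1 / sqrt (4 * pi)) ^ CARD('d)" and ?c' = "(1 / sqrt (2 * pi)) ^ CARD('d)"
  have F: "?F x = ?c * exp (- (norm x)\<^sup>2 / 4)" for x
    by (simp add: normal_density_def norm_power2_vec prod_dividef power_divide
      sum_negf sum_divide_distrib flip: exp_sum)
  have "integrable lborel ?F"
  proof (rule integrableI_nonneg)
    show "?F \<in> borel_measurable lborel"
      unfolding F by measurable
    have "(\<integral>\<^sup>+x. ennreal (?F x) \<partial>lborel) = 1"
      using nn_integral_lborel_vec_prod[where 'd = 'd and F = "\<lambda>x. ennreal (normal_density 0 (sqrt 2) x)"]
      by (simp add: nn_integral_normal_density prod_ennreal)
    then show "(\<integral>\<^sup>+x. ennreal (?F x) \<partial>lborel) < \<infinity>" by simp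
  qed (simp add: prod_nonneg)
  \<comment> \<open>The factor exchanges the normalising constants of variance 1 and variance 2 and
    carries the constant of \<open>power_le_exp_square\<close>.\<close>
  then have "integrable lborel (\<lambda>x. (?c' * fact q * exp 2 / ?c) * ?F x)"
    by simp
  then show ?thesis
  proof (rule Bochner_Integration.integrable_bound)
    show "AE x in lborel. norm (gauss_density x * (1 + norm x) ^ q) \<le> norm ((?c' * fact q * exp 2 / ?c) * ?F x)"
    proof (rule always_eventually, rule allI)
      fix x :: "real^'d"
      have "norm (gauss_density x * (1 + norm x) ^ q) = gauss_density x * (1 + norm x) ^ q"
        by (simp add: gauss_density_nonneg abs_mult)
      also have "\<dots> \<le> gauss_density x * (fact q * exp 2 * exp ((norm x)\<^sup>2 / 4))"
        by (intro mult_left_mono power_le_exp_square gauss_density_nonneg) auto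
      also have "\<dots> = (?c' * fact q * exp 2 / ?c) * (?c * (exp (- (norm x)\<^sup>2 / 2) * exp ((norm x)\<^sup>2 / 4)))"
        by (simp add: gauss_density_eq)
      also have "exp (- (norm x)\<^sup>2 / 2) * exp ((norm x)\<^sup>2 / 4) = exp (- (norm x)\<^sup>2 / 4)"
        by (simp flip: exp_add)
      finally show "norm (gauss_density x * (1 + norm x) ^ q) \<le> norm ((?c' * fact q * exp 2 / ?c) * ?F x)"
        unfolding F real_norm_def[of "_ / _ * _"] by (rule order_trans[OF _ abs_ge_self])
    qed
  qed measurable
qed

lemma integrable_gaussian_power: "integrable gaussian (\<lambda>x::real^'d::finite. (1 + norm x) ^ q)"
  by (subst integrable_gaussian_iff) (auto simp: integrable_gauss_density_power)

lemma integrable_gaussian_bound: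
  fixes F :: "real^'d::finite \<Rightarrow> real"
  assumes [measurable]: "F \<in> borel_measurable borel" and "\<And>x. \<bar>F x\<bar> \<le> C * (1 + norm x) ^ q"
  shows "integrable gaussian F"
proof (rule Bochner_Integration.integrable_bound)
  show "integrable gaussian (\<lambda>x::real^'d. C * (1 + norm x) ^ q)"
    using integrable_gaussian_power by auto
  show "AE x in gaussian. norm (F x) \<le> norm (C * (1 + norm x) ^ q)"
    using assms(2) by (intro always_eventually allI) (metis abs_ge_self order_trans real_norm_def)
qed simp

section \<open>Gaussian integration by parts\<close>

text \<open>Translation invariance replaces boundary terms: averaging \<open>F'\<close> over the
  translates by \<open>s *\<^sub>R e\<close> with \<open>s\<close> in the unit interval leaves its
  integral unchanged, and the fundamental theorem along each segment turns the average into the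
  integral of \<open>F (x + e) - F x\<close>, which vanishes.\<close>

lemma integral_lborel_directional_derivative:
  fixes F F' :: "'c::euclidean_space \<Rightarrow> real"
  assumes F: "integrable lborel F" and F': "integrable lborel F'" "continuous_on UNIV F'"
    and deriv: "\<And>x s. ((\<lambda>s. F (x + s *\<^sub>R e)) has_real_derivative F' (x + s *\<^sub>R e)) (at s)"
  shows "integral\<^sup>L lborel F' = 0"
proof -
  have m [measurable]: "F' \<in> borel_measurable borel"
    using F'(2) by (rule borel_measurable_continuous_onI)
  have shift: "integrable lborel (\<lambda>x. G (x + c))" "(\<integral>x. G (x + c) \<partial>lborel) = integral\<^sup>L lborel G"
    if "integrable lborel G" for G :: "'c \<Rightarrow> real" and c
  proof -
    have d: "distr lborel lborel (\<lambda>x. x + c) = (lborel :: 'c measure)"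
      using lborel_distr_plus[of c] by (simp add: add.commute cong: distr_cong)
    show "integrable lborel (\<lambda>x. G (x + c))"
      using that by (subst (asm) d[symmetric], subst (asm) integrable_distr_eq) (use that in auto)
    show "(\<integral>x. G (x + c) \<partial>lborel) = integral\<^sup>L lborel G"
      by (subst (2) d[symmetric], subst integral_distr) (use that in auto)
  qed
  let ?H = "\<lambda>(s, x). indicator {0..1::real} s * F' (x + s *\<^sub>R e)"
  have i: "integrable (lborel \<Otimes>\<^sub>M lborel) ?H"
  proof (rule lborel_pair.Fubini_integrable)
    show "?H \<in> borel_measurable (lborel \<Otimes>\<^sub>M lborel)" by measurable
    have "(\<integral>x. norm (?H (s, x)) \<partial>lborel) = indicator {0..1} s * (\<integral>x. \<bar>F' x\<bar> \<partial>lborel)" for s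
      using shift(2)[of "\<lambda>x. \<bar>F' x\<bar>" "s *\<^sub>R e"] F' by (simp add: abs_mult)
    then show "integrable lborel (\<lambda>s. \<integral>x. norm (?H (s, x)) \<partial>lborel)" by simp
    show "AE s in lborel. integrable lborel (\<lambda>x. ?H (s, x))"
      using shift(1)[OF F'(1)] by auto
  qed
  \<comment> \<open>The inner integral does not depend on \<open>s\<close>, so an average over the
    unit interval can be inserted before Fubini.\<close>
  have "integral\<^sup>L lborel F' = (\<integral>s. indicator {0..1::real} s * integral\<^sup>L lborel F' \<partial>lborel)"
    by simp
  also have "\<dots> = (\<integral>s. (\<integral>x. ?H (s, x) \<partial>lborel) \<partial>lborel)"
    by (simp add: shift(2)[OF F'(1)])
  also have "\<dots> = (\<integral>x. (\<integral>s. ?H (s, x) \<partial>lborel) \<partial>lborel)"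
    using lborel_pair.Fubini_integral[of "\<lambda>s x. ?H (s, x)"] i by simp
  also have "\<dots> = (\<integral>x. F (x + e) - F x \<partial>lborel)"
  proof (rule Bochner_Integration.integral_cong[OF refl])
    fix x
    have "(\<integral>s. indicator {0..1::real} s *\<^sub>R F' (x + s *\<^sub>R e) \<partial>lborel) = F (x + 1 *\<^sub>R e) - F (x + 0 *\<^sub>R e)"
    proof (rule integral_FTC_atLeastAtMost)
      show "((\<lambda>s. F (x + s *\<^sub>R e)) has_vector_derivative F' (x + s *\<^sub>R e)) (at s within {0..1})" for s
        using deriv[of x s]
        by (auto simp: has_real_derivative_iff_has_vector_derivative intro: has_vector_derivative_at_within)
      show "continuous_on {0..1} (\<lambda>s. F' (x + s *\<^sub>R e))"
        by (intro continuous_on_compose2[OF F'(2)] continuous_intros) auto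
    qed simp
    then show "(\<integral>s. ?H (s, x) \<partial>lborel) = F (x + e) - F x" by simp
  qed
  also have "\<dots> = 0"
    using shift[OF F, of e] F by simp
  finally show ?thesis .
qed

lemma gauss_density_directional_derivative:
  "((\<lambda>s. gauss_density (x + s *\<^sub>R e)) has_real_derivative
     - ((x + s *\<^sub>R e) \<bullet> e) * gauss_density (x + s *\<^sub>R e)) (at s)"
  unfolding gauss_density_eq power2_norm_eq_inner
  by (auto intro!: derivative_eq_intros simp: inner_add_left inner_add_right inner_commute field_simps)

text \<open>Stein's identity. The derivative of \<open>gauss_density x * p x\<close> along
  \<open>e\<close> is \<open>gauss_density x * (p' x - p x * (x \<bullet> e))\<close>, whose
  Lebesgue integral is zero; polynomial growth supplies the integrability of each summand.\<close>

lemma gaussian_integration_by_parts: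
  fixes p p' :: "real^'d::finite \<Rightarrow> real"
  assumes cont: "continuous_on UNIV p" "continuous_on UNIV p'"
    and deriv: "\<And>x s. ((\<lambda>s. p (x + s *\<^sub>R e)) has_real_derivative p' (x + s *\<^sub>R e)) (at s)"
    and bound: "\<And>x. \<bar>p x\<bar> \<le> C * (1 + norm x) ^ q" "\<And>x. \<bar>p' x\<bar> \<le> C * (1 + norm x) ^ q"
  shows "(\<integral>x. p x * (x \<bullet> e) \<partial>gaussian) = (\<integral>x. p' x \<partial>gaussian)"
proof -
  have m [measurable]: "p \<in> borel_measurable borel" "p' \<in> borel_measurable borel"
    using cont by (auto intro: borel_measurable_continuous_onI)
  have C: "C \<ge> 0" using bound(1)[of 0] by auto
  have ip: "integrable gaussian p" "integrable gaussian p'"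
    by (rule integrable_gaussian_bound[OF m(1) bound(1)], rule integrable_gaussian_bound[OF m(2) bound(2)])
  have ipe: "integrable gaussian (\<lambda>x. p x * (x \<bullet> e))"
  proof (rule integrable_gaussian_bound[where C = "C * norm e" and q = "Suc q"])
    fix x
    have "\<bar>x \<bullet> e\<bar> \<le> (1 + norm x) * norm e"
      using Cauchy_Schwarz_ineq2[of x e] norm_ge_zero[of e]
      unfolding distrib_right by linarith
    then have "\<bar>p x * (x \<bullet> e)\<bar> \<le> (C * (1 + norm x) ^ q) * ((1 + norm x) * norm e)"
      unfolding abs_mult using bound(1)[of x] C by (intro mult_mono) auto
    then show "\<bar>p x * (x \<bullet> e)\<bar> \<le> C * norm e * (1 + norm x) ^ Suc q"
      by (simp add: mult_ac)
  qed simp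
  let ?F' = "\<lambda>x. gauss_density x * p' x - gauss_density x * (p x * (x \<bullet> e))"
  have "integral\<^sup>L lborel ?F' = 0"
  proof (rule integral_lborel_directional_derivative[where F = "\<lambda>x. gauss_density x * p x" and e = e])
    show "integrable lborel (\<lambda>x. gauss_density x * p x)"
      using ip by (simp add: integrable_gaussian_iff)
    show "integrable lborel ?F'"
      using ip ipe by (simp add: integrable_gaussian_iff)
    show "continuous_on UNIV ?F'"
      by (intro continuous_intros cont continuous_gauss_density)
    show "((\<lambda>s. gauss_density (x + s *\<^sub>R e) * p (x + s *\<^sub>R e)) has_real_derivative ?F' (x + s *\<^sub>R e)) (at s)" for x s
      by (rule DERIV_cong[OF DERIV_mult[OF gauss_density_directional_derivative deriv]])
        (simp add: algebra_simps)
  qed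
  then show ?thesis
    using ip ipe by (simp add: integral_gaussian_eq integrable_gaussian_iff)
qed

text \<open>Stein's identity for the constant function 1, whose derivative is zero.\<close>

lemma integral_gaussian_inner:
  fixes a :: "real^'d::finite"
  shows "(\<integral>x. a \<bullet> x \<partial>gaussian) = 0"
proof -
  have "(\<integral>x. 1 * (x \<bullet> a) \<partial>gaussian) = integral\<^sup>L gaussian (\<lambda>x::real^'d. 0)"
    by (rule gaussian_integration_by_parts[where C = 1 and q = 0]) (auto intro!: derivative_eq_intros)
  then show ?thesis by (simp add: inner_commute)
qed

text \<open>Links the density prescribed for Brownian increments, of standard deviation
  \<open>r\<close>, to the single reference measure \<open>gaussian\<close>, so that all one-step
  integrals are taken against a measure free of the step size.\<close>

lemma distr_gaussian_scaled:
  fixes r :: real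
  assumes "r > 0"
  shows "distr (density lborel (\<lambda>x. ennreal (\<Prod>i\<in>UNIV. normal_density 0 r (x $ i)))) borel
     (\<lambda>x::real^'d::finite. (1 / r) *\<^sub>R x) = gaussian"
    (is "distr (density lborel ?f) borel ?T = _")
proof (rule measure_eqI)
  have [measurable]: "?f \<in> borel_measurable borel" by measurable
  fix A :: "(real^'d) set"
  assume "A \<in> sets (distr (density lborel ?f) borel ?T)"
  then have A [measurable]: "A \<in> sets borel" by simp
  \<comment> \<open>The Jacobian \<open>r ^ CARD('d)\<close> is distributed over the coordinates,
    one factor \<open>r\<close> per one-dimensional density.\<close>
  have f: "?f (r *\<^sub>R x) * ennreal (r ^ CARD('d)) = ennreal (gauss_density x)" for x
  proof -
    have "normal_density 0 r (r * y) * r = normal_density 0 1 y" for y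
      using assms by (simp add: normal_density_def real_sqrt_mult power_mult_distrib field_simps)
    then have "(\<Prod>i\<in>UNIV. normal_density 0 r (r * x $ i)) * r ^ CARD('d) = gauss_density x"
      by (simp add: gauss_density_def flip: prod.distrib prod_constant)
    then show ?thesis
      using assms by (simp add: prod_nonneg flip: ennreal_mult)
  qed
  have "emeasure (distr (density lborel ?f) borel ?T) A
      = (\<integral>\<^sup>+x. ?f x * indicator A ((1 / r) *\<^sub>R x) \<partial>lborel)"
    by (simp add: emeasure_distr emeasure_density indicator_def vimage_def)
  also have "\<dots> = (\<integral>\<^sup>+x. ?f x * indicator A ((1 / r) *\<^sub>R x)
      \<partial>density (distr lborel borel (\<lambda>x. 0 + r *\<^sub>R x)) (\<lambda>_. \<bar>r\<bar> ^ DIM(real^'d)))"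
    using assms by (subst lborel_affine[of r 0]) auto
  also have "\<dots> = (\<integral>\<^sup>+x. ennreal (gauss_density x) * indicator A x \<partial>lborel)"
    using assms by (simp add: nn_integral_density nn_integral_distr flip: f)
      (simp add: mult_ac)
  also have "\<dots> = emeasure gaussian A"
    by (simp add: gaussian_def emeasure_density)
  finally show "emeasure (distr (density lborel ?f) borel ?T) A = emeasure gaussian A" .
qed simp

section \<open>Matrix norms\<close>

text \<open>Cauchy-Schwarz in every row: the Frobenius norm dominates the operator norm.\<close>

lemma norm_matrix_vector_mult_le:
  fixes A :: "real^'m::finite^'n::finite"
  shows "norm (A *v x) \<le> norm A * norm x"
proof -
  have "norm (A *v x) = L2_set (\<lambda>i. \<bar>(A $ i) \<bullet> x\<bar>) UNIV"
    by (simp add: norm_vec_def matrix_mult_dot)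
  also have "\<dots> \<le> L2_set (\<lambda>i. norm (A $ i) * norm x) UNIV"
    by (intro L2_set_mono Cauchy_Schwarz_ineq2) auto
  also have "\<dots> = norm A * norm x"
    by (simp add: norm_vec_def[of A] L2_set_left_distrib)
  finally show ?thesis .
qed

lemma norm_matrix_inner: "(norm A)\<^sup>2 = (\<Sum>i\<in>UNIV. \<Sum>j\<in>UNIV. (A $ i $ j)\<^sup>2)"
  for A :: "real^'m::finite^'n::finite"
  by (simp add: norm_vec_def L2_set_def sum_nonneg)

lemma norm_transpose: "norm (transpose A) = norm A"
  for A :: "real^'m::finite^'n::finite"
proof -
  have "(norm (transpose A))\<^sup>2 = (norm A)\<^sup>2"
    unfolding norm_matrix_inner transpose_def by (subst sum.swap) simp
  then show ?thesis by (simp add: power2_eq_iff_nonneg)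
qed

lemma norm_vector_matrix_mult_le:
  fixes A :: "real^'m::finite^'n::finite"
  shows "norm (x v* A) \<le> norm x * norm A"
  using norm_matrix_vector_mult_le[of "transpose A" x] by (simp add: norm_transpose mult.commute)

lemma norm_matrix_mult_le:
  fixes A :: "real^'m::finite^'n::finite" and B :: "real^'k::finite^'m"
  shows "norm (A ** B) \<le> norm A * norm B"
proof -
  have row: "(A ** B) $ i = (A $ i) v* B" for i
    by (simp add: matrix_matrix_mult_def vector_matrix_mult_def vec_eq_iff mult.commute)
  have "norm (A ** B) \<le> L2_set (\<lambda>i. norm (A $ i) * norm B) UNIV"
    unfolding norm_vec_def[of "A ** B"] row
    by (intro L2_set_mono norm_vector_matrix_mult_le) auto
  also have "\<dots> = norm A * norm B"
    by (simp add: norm_vec_def[of A] L2_set_left_distrib)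
  finally show ?thesis .
qed

text \<open>The trace of \<open>A ** B\<close> is the Frobenius inner product of \<open>A\<close>
  and \<open>transpose B\<close>, so this is Cauchy-Schwarz.\<close>

lemma abs_trace_mult_le:
  fixes A B :: "real^'n::finite^'n"
  shows "\<bar>trace (A ** B)\<bar> \<le> norm A * norm B"
proof -
  have "trace (A ** B) = A \<bullet> transpose B"
    by (simp add: trace_def matrix_matrix_mult_def transpose_def inner_vec_def)
  then show ?thesis
    using Cauchy_Schwarz_ineq2[of A "transpose B"] by (simp add: norm_transpose)
qed

text \<open>The Euclidean norm of the vector of column norms is at most their sum. It turns bounds
  on directional derivatives into a bound on the whole Hessian.\<close>

lemma norm_matrix_le_columns:
  fixes A :: "real^'m::finite^'n::finite"
  shows "norm A \<le> (\<Sum>j\<in>UNIV. norm (A *v axis j 1))"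
proof -
  have "norm A = L2_set (\<lambda>j. norm (transpose A $ j)) UNIV"
    by (metis norm_transpose norm_vec_def)
  also have "\<dots> \<le> (\<Sum>j\<in>UNIV. norm (transpose A $ j))"
    by (intro L2_set_le_sum) auto
  also have "\<dots> = (\<Sum>j\<in>UNIV. norm (A *v axis j 1))"
    by (simp add: matrix_vector_mult_basis column_def transpose_def)
  finally show ?thesis .
qed

lemma vector_matrix_mult_diff: "(x - y) v* A = x v* A - y v* A" "x v* (A - B) = x v* A - x v* B"
  for A B :: "real^'m::finite^'n::finite"
  by (simp_all add: vector_matrix_mult_def vec_eq_iff algebra_simps sum_subtractf)

lemma continuous_on_vector_matrix_mult [continuous_intros]:
  fixes A :: "'c::topological_space \<Rightarrow> real^'m::finite^'n::finite"
  assumes "continuous_on S F" "continuous_on S A"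
  shows "continuous_on S (\<lambda>x. F x v* A x)"
  unfolding vector_matrix_mult_def
  by (intro continuous_on_vec_lambda continuous_intros assms)

lemma continuous_on_matrix_vector_mult [continuous_intros]:
  fixes A :: "'c::topological_space \<Rightarrow> real^'m::finite^'n::finite"
  assumes "continuous_on S F" "continuous_on S A"
  shows "continuous_on S (\<lambda>x. A x *v F x)"
  unfolding matrix_vector_mult_def
  by (intro continuous_on_vec_lambda continuous_intros assms)

lemma mat_vector_mult: "mat c *v x = c *\<^sub>R (x :: real^'n::finite)"
  by (simp add: mat_def matrix_vector_mult_def vec_eq_iff if_distrib if_distribR cong: if_cong)

text \<open>The quadratic form of \<open>A ** transpose A\<close> at \<open>x\<close> is the squared
  norm of \<open>x v* A\<close>. Ellipticity is thus a quantitative injectivity of multiplication by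
  \<sigma>, through which bounds on \<open>w\<close> become bounds on the gradient.\<close>

lemma loewner_le_vector_matrix_mult:
  fixes A :: "real^'n::finite^'n"
  assumes "loewner_le (mat \<delta>) (A ** transpose A)" "\<delta> \<ge> 0"
  shows "sqrt \<delta> * norm x \<le> norm (x v* A)"
proof -
  have "x \<bullet> ((A ** transpose A) *v x) = (norm (x v* A))\<^sup>2"
    by (metis dot_lmul_matrix matrix_vector_mul_assoc power2_norm_eq_inner transpose_matrix_vector)
  then have "\<delta> * (norm x)\<^sup>2 \<le> (norm (x v* A))\<^sup>2"
    using assms(1) unfolding loewner_le_def by (metis inner_scaleR_right mat_vector_mult power2_norm_eq_inner)
  then show ?thesis
    using assms(2) by (intro power2_le_imp_le[of "sqrt \<delta> * norm x"]) (simp_all add: power_mult_distrib)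
qed

section \<open>Growth of differentiable functions\<close>

text \<open>Only increments from the base point \<open>x\<close> are controlled, with a constant
  that may depend on \<open>x\<close>; this is the form in which the gradient of \<open>u\<close> is
  Lipschitz, its constant growing with \<open>x\<close>.\<close>

lemma has_derivative_norm_le_local_lipschitz:
  fixes F :: "'b::real_normed_vector \<Rightarrow> 'c::real_normed_vector"
  assumes D: "(F has_derivative D) (at x)" and lip: "\<And>y. norm (F y - F x) \<le> B * norm (y - x)"
  shows "norm (D v) \<le> B * norm v"
proof (cases "v = 0")
  case True
  then show ?thesis using linear_0[OF has_derivative_linear[OF D]] by simp
next
  case False
  show ?thesis
  proof (rule field_le_epsilon)
    fix e :: real assume "e > 0"
    then have "e / norm v > 0" using False by simp
    then obtain d where d: "d > 0" "\<And>y. norm (y - x) < d \<Longrightarrow>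
        norm (F y - F x - D (y - x)) \<le> e / norm v * norm (y - x)"
      using D unfolding has_derivative_at_alt by meson
    \<comment> \<open>The displacement \<open>s *\<^sub>R v\<close> has length \<open>d / 2\<close>,
      hence lies inside the ball where the linearisation error is controlled.\<close>
    define s where "s = d / (2 * norm v)"
    have s: "s > 0" "s * norm v < d" using d(1) False by (simp_all add: s_def)
    have Ds: "D (s *\<^sub>R v) = s *\<^sub>R D v"
      using has_derivative_linear[OF D] by (simp add: linear_scale)
    have "norm (F (x + s *\<^sub>R v) - F x - s *\<^sub>R D v) \<le> s * e"
      using d(2)[of "x + s *\<^sub>R v"] s False by (simp add: Ds mult.commute)
    moreover have "norm (F (x + s *\<^sub>R v) - F x) \<le> s * (B * norm v)"
      using lip[of "x + s *\<^sub>R v"] s by (simp add: mult_ac)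
    moreover have "norm (s *\<^sub>R D v) \<le> norm (F (x + s *\<^sub>R v) - F x) + norm (F (x + s *\<^sub>R v) - F x - s *\<^sub>R D v)"
      using norm_triangle_ineq4[of "F (x + s *\<^sub>R v) - F x" "F (x + s *\<^sub>R v) - F x - s *\<^sub>R D v"] by simp
    ultimately have "s * norm (D v) \<le> s * (B * norm v + e)"
      using s by (simp add: distrib_left)
    then show "norm (D v) \<le> B * norm v + e" using s by simp
  qed
qed

lemma linear_growth_of_lipschitz:
  fixes \<phi> :: "real \<Rightarrow> 'b::real_normed_vector \<Rightarrow> 'c::real_normed_vector"
  assumes "bounded ((\<lambda>t. \<phi> t 0) ` S)" "\<And>t. t \<in> S \<Longrightarrow> lipschitz_on K UNIV (\<phi> t)"
  shows "\<exists>C\<ge>0. \<forall>t\<in>S. \<forall>x. norm (\<phi> t x) \<le> C * (1 + norm x)"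
proof -
  obtain B where B: "\<And>t. t \<in> S \<Longrightarrow> norm (\<phi> t 0) \<le> B"
    using assms(1) by (auto simp: bounded_iff)
  have "norm (\<phi> t x) \<le> (\<bar>B\<bar> + \<bar>K\<bar>) * (1 + norm x)" if "t \<in> S" for t x
  proof -
    have "norm (\<phi> t x) \<le> norm (\<phi> t 0) + norm (\<phi> t x - \<phi> t 0)"
      by norm
    also have "\<dots> \<le> \<bar>B\<bar> + \<bar>K\<bar> * norm x"
      using B[OF that] lipschitz_onD[OF assms(2)[OF that], of x 0]
      by (simp add: dist_norm) (smt (verit) mult_right_mono norm_ge_zero)
    also have "\<dots> \<le> (\<bar>B\<bar> + \<bar>K\<bar>) * (1 + norm x)"
      by (simp add: algebra_simps)
    finally show ?thesis .
  qed
  then show ?thesis by (intro exI[of _ "\<bar>B\<bar> + \<bar>K\<bar>"]) auto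
qed

section \<open>Regularity of the classical solution\<close>

text \<open>The deterministic setting: the regularity of \<open>u\<close> and the analysis of one
  Euler step from a fixed point take place here, with the Gaussian measure as the only source of
  randomness.\<close>

locale parabolic_problem =
  fixes T K \<delta> L :: real
    and b :: "real \<Rightarrow> real^'d \<Rightarrow> real^'d::finite"
    and \<sigma> :: "real \<Rightarrow> real^'d \<Rightarrow> real^'d^'d"
    and f :: "real \<Rightarrow> real^'d \<Rightarrow> real \<Rightarrow> real^'d \<Rightarrow> real"
    and g :: "real^'d \<Rightarrow> real"
    and u :: "real \<Rightarrow> real^'d \<Rightarrow> real"
  assumes T_pos: "T > 0"
    and bounded: "bounded ((\<lambda>t. b t 0) ` {0..T})" "bounded ((\<lambda>t. \<sigma> t 0) ` {0..T})"
      "bounded ((\<lambda>t. f t 0 0 0) ` {0..T})"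
    and lipschitz:
      "\<And>t. t \<in> {0..T} \<Longrightarrow> lipschitz_on K UNIV (b t)"
      "\<And>t. t \<in> {0..T} \<Longrightarrow> lipschitz_on K UNIV (\<sigma> t)"
      "\<And>t. t \<in> {0..T} \<Longrightarrow> lipschitz_on K UNIV (\<lambda>(x, y, z). f t x y z)"
    and hoelder:
      "\<And>x. half_hoelder_on K {0..T} (\<lambda>t. b t x)"
      "\<And>x. half_hoelder_on K {0..T} (\<lambda>t. \<sigma> t x)"
      "\<And>x y z. half_hoelder_on K {0..T} (\<lambda>t. f t x y z)"
    and elliptic: "\<delta> > 0"
      "\<And>t x. t \<in> {0..T} \<Longrightarrow> loewner_le (mat \<delta>) (\<sigma> t x ** transpose (\<sigma> t x))"
    and pde: "classical_solution T b \<sigma> f g u"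
    and L: "\<And>t. t \<in> {0..T} \<Longrightarrow> lipschitz_on L UNIV (\<lambda>x. grad_x u t x v* \<sigma> t x)"
begin

abbreviation w :: "real \<Rightarrow> real^'d \<Rightarrow> real^'d" where
  "w t x \<equiv> grad_x u t x v* \<sigma> t x"

lemma C12: "C12 T u"
  using pde by (simp add: classical_solution_def)

lemma pde_eq:
  "t \<in> {0..<T} \<Longrightarrow> time_deriv T u t x = - (b t x \<bullet> grad_x u t x)
     - 1/2 * trace (hess_x u t x ** (\<sigma> t x ** transpose (\<sigma> t x))) - f t x (u t x) (w t x)"
  using pde unfolding classical_solution_def by (smt (verit))

lemma terminal: "u T x = g x"
  using pde by (simp add: classical_solution_def)

lemma K_nonneg: "K \<ge> 0"
  using lipschitz(1)[of 0] T_pos by (auto simp: lipschitz_on_def)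

lemma L_nonneg: "L \<ge> 0"
  using L[of 0] T_pos by (auto simp: lipschitz_on_def)

lemma time_deriv:
  "t \<in> {0..T} \<Longrightarrow> ((\<lambda>s. u s x) has_vector_derivative time_deriv T u t x) (at t within {0..T})"
  using C12 by (auto simp: C12_def time_deriv_def vector_derivative_works)

lemma grad:
  assumes "t \<in> {0..T}"
  shows "(u t has_derivative (\<lambda>v. grad_x u t x \<bullet> v)) (at x)"
proof -
  let ?D = "frechet_derivative (u t) (at x)"
  have D: "(u t has_derivative ?D) (at x)"
    using C12 assms by (auto simp: C12_def simp flip: frechet_derivative_works)
  have "?D v = grad_x u t x \<bullet> v" for v
  proof -
    have "v = (\<Sum>i\<in>UNIV. (v $ i) *\<^sub>R axis i 1)"
      using basis_expansion[of v] by (simp add: scalar_mult_eq_scaleR)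
    then have "?D v = ?D (\<Sum>i\<in>UNIV. (v $ i) *\<^sub>R axis i 1)" by simp
    also have "\<dots> = (\<Sum>i\<in>UNIV. (v $ i) *\<^sub>R ?D (axis i 1))"
      using has_derivative_linear[OF D] by (simp add: linear_sum linear_scale)
    finally show ?thesis by (simp add: grad_x_def inner_vec_def mult.commute)
  qed
  then have "?D = (\<lambda>v. grad_x u t x \<bullet> v)" by auto
  with D show ?thesis by simp
qed

lemma hess:
  assumes "t \<in> {0..T}"
  shows "(grad_x u t has_derivative (\<lambda>v. hess_x u t x *v v)) (at x)"
proof -
  have "grad_x u t differentiable (at x)"
    using C12 assms by (auto simp: C12_def)
  then show ?thesis by (simp add: jacobian_works hess_x_def)
qed

lemma continuous_u: "continuous_on ({0..T} \<times> UNIV) (\<lambda>(t, x). u t x)"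
  and continuous_time_deriv: "continuous_on ({0..T} \<times> UNIV) (\<lambda>(t, x). time_deriv T u t x)"
  and continuous_grad: "continuous_on ({0..T} \<times> UNIV) (\<lambda>(t, x). grad_x u t x)"
  and continuous_hess: "continuous_on ({0..T} \<times> UNIV) (\<lambda>(t, x). hess_x u t x)"
  using C12 by (auto simp: C12_def)

lemma continuous_slices:
  assumes "t \<in> {0..T}"
  shows "continuous_on UNIV (u t)" "continuous_on UNIV (time_deriv T u t)"
    "continuous_on UNIV (grad_x u t)" "continuous_on UNIV (hess_x u t)"
proof -
  have "continuous_on UNIV (\<lambda>x. F t x)" if "continuous_on ({0..T} \<times> UNIV) (\<lambda>(t, x). F t x)"
    for F :: "real \<Rightarrow> real^'d \<Rightarrow> 'x::topological_space"
  proof -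
    have "continuous_on UNIV (\<lambda>x. (\<lambda>(t, x). F t x) (t, x))"
      by (intro continuous_on_compose2[OF that] continuous_intros) (use assms in auto)
    then show ?thesis by simp
  qed
  from this[OF continuous_u] this[OF continuous_time_deriv] this[OF continuous_grad] this[OF continuous_hess]
  show "continuous_on UNIV (u t)" "continuous_on UNIV (time_deriv T u t)"
    "continuous_on UNIV (grad_x u t)" "continuous_on UNIV (hess_x u t)" by simp_all
qed

lemma continuous_time_slices:
  shows "continuous_on {0..T} (\<lambda>t. u t x)" "continuous_on {0..T} (\<lambda>t. time_deriv T u t x)"
    "continuous_on {0..T} (\<lambda>t. grad_x u t x)"
proof -
  have "continuous_on {0..T} (\<lambda>t. F t x)" if "continuous_on ({0..T} \<times> UNIV) (\<lambda>(t, x). F t x)"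
    for F :: "real \<Rightarrow> real^'d \<Rightarrow> 'x::topological_space"
  proof -
    have "continuous_on {0..T} (\<lambda>t. (\<lambda>(t, x). F t x) (t, x))"
      by (intro continuous_on_compose2[OF that] continuous_intros) auto
    then show ?thesis by simp
  qed
  from this[OF continuous_u] this[OF continuous_time_deriv] this[OF continuous_grad]
  show "continuous_on {0..T} (\<lambda>t. u t x)" "continuous_on {0..T} (\<lambda>t. time_deriv T u t x)"
    "continuous_on {0..T} (\<lambda>t. grad_x u t x)" by simp_all
qed

lemma continuous_coefficients:
  assumes "t \<in> {0..T}"
  shows "continuous_on UNIV (b t)" "continuous_on UNIV (\<sigma> t)"
    "continuous_on UNIV (\<lambda>(x, y, z). f t x y z)"
  using lipschitz[OF assms] by (auto intro: lipschitz_on_continuous_on)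

lemma b_bound: "s \<in> {0..T} \<Longrightarrow> t \<in> {0..T} \<Longrightarrow> norm (b s x - b t y) \<le> K * (sqrt \<bar>s - t\<bar> + norm (x - y))"
  using hoelder(1)[of x] lipschitz_onD[OF lipschitz(1), of t x y] dist_triangle[of "b s x" "b t y" "b t x"]
  unfolding half_hoelder_on_def dist_norm distrib_left by (smt (verit) UNIV_I)

lemma \<sigma>_bound: "s \<in> {0..T} \<Longrightarrow> t \<in> {0..T} \<Longrightarrow> norm (\<sigma> s x - \<sigma> t y) \<le> K * (sqrt \<bar>s - t\<bar> + norm (x - y))"
  using hoelder(2)[of x] lipschitz_onD[OF lipschitz(2), of t x y] dist_triangle[of "\<sigma> s x" "\<sigma> t y" "\<sigma> t x"]
  unfolding half_hoelder_on_def dist_norm distrib_left by (smt (verit) UNIV_I)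

lemma f_bound:
  assumes "s \<in> {0..T}" "t \<in> {0..T}"
  shows "\<bar>f s x y z - f t x' y' z'\<bar> \<le> K * (sqrt \<bar>s - t\<bar> + norm (x - x') + \<bar>y - y'\<bar> + norm (z - z'))"
proof -
  have "dist (x, y, z) (x', y', z') \<le> norm (x - x') + (\<bar>y - y'\<bar> + norm (z - z'))"
    unfolding dist_norm diff_Pair
    using norm_Pair_le[of "x - x'" "(y - y', z - z')"] norm_Pair_le[of "y - y'" "z - z'"] by simp
  then have "K * dist (x, y, z) (x', y', z') \<le> K * (norm (x - x') + (\<bar>y - y'\<bar> + norm (z - z')))"
    using K_nonneg by (rule mult_left_mono)
  moreover have "\<bar>f t x y z - f t x' y' z'\<bar> \<le> K * dist (x, y, z) (x', y', z')"
    using lipschitz_onD[OF lipschitz(3)[OF assms(2)], of "(x, y, z)" "(x', y', z')"] by (simp add: dist_norm)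
  moreover have "\<bar>f s x y z - f t x y z\<bar> \<le> K * sqrt \<bar>s - t\<bar>"
    using hoelder(3)[of x y z] assms by (auto simp: half_hoelder_on_def dist_norm)
  ultimately show ?thesis unfolding distrib_left by linarith
qed

section \<open>Growth and Lipschitz bounds in space\<close>

lemma b_growth: "\<exists>C\<ge>0. \<forall>t\<in>{0..T}. \<forall>x. norm (b t x) \<le> C * (1 + norm x)"
  and \<sigma>_growth: "\<exists>C\<ge>0. \<forall>t\<in>{0..T}. \<forall>x. norm (\<sigma> t x) \<le> C * (1 + norm x)"
  by (rule linear_growth_of_lipschitz[OF bounded(1) lipschitz(1)], simp)
    (rule linear_growth_of_lipschitz[OF bounded(2) lipschitz(2)], simp)

text \<open>At the origin the gradient is bounded because it is continuous on the compact time
  interval, and \<sigma> is bounded there by hypothesis; the Lipschitz constant \<open>L\<close>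
  carries the bound to all points.\<close>

lemma w_growth: "\<exists>C\<ge>0. \<forall>t\<in>{0..T}. \<forall>x. norm (w t x) \<le> C * (1 + norm x)"
proof (rule linear_growth_of_lipschitz)
  obtain A where A: "A \<ge> 0" "\<And>t. t \<in> {0..T} \<Longrightarrow> norm (\<sigma> t 0) \<le> A"
    using \<sigma>_growth by (metis add_0_right mult.right_neutral norm_zero)
  obtain B where B: "\<And>t. t \<in> {0..T} \<Longrightarrow> norm (grad_x u t 0) \<le> B"
    using compact_imp_bounded[OF compact_continuous_image[OF continuous_time_slices(3)[of 0] compact_Icc]]
    unfolding bounded_iff by (metis imageI)
  show "bounded ((\<lambda>t. w t 0) ` {0..T})"
    unfolding bounded_iff
  proof (intro exI ballI)
    fix y assume "y \<in> (\<lambda>t. w t 0) ` {0..T}"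
    then obtain t where t: "t \<in> {0..T}" and y: "y = w t 0" by auto
    have "norm (w t 0) \<le> norm (grad_x u t 0) * norm (\<sigma> t 0)" by (rule norm_vector_matrix_mult_le)
    also have "\<dots> \<le> B * A" using A B[OF t] t by (intro mult_mono) (auto intro: order_trans[OF norm_ge_zero])
    finally show "norm y \<le> B * A" by (simp add: y)
  qed
qed (rule L)

lemma norm_le_vector_matrix_mult: "t \<in> {0..T} \<Longrightarrow> norm v \<le> norm (v v* \<sigma> t x) / sqrt \<delta>"
  using loewner_le_vector_matrix_mult[OF elliptic(2)[of t x], of v] elliptic(1)
  by (simp add: field_simps)

lemma grad_growth: "\<exists>C\<ge>0. \<forall>t\<in>{0..T}. \<forall>x. norm (grad_x u t x) \<le> C * (1 + norm x)"
proof -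
  obtain C where C: "C \<ge> 0" "\<And>t x. t \<in> {0..T} \<Longrightarrow> norm (w t x) \<le> C * (1 + norm x)"
    using w_growth by blast
  have "norm (grad_x u t x) \<le> (C / sqrt \<delta>) * (1 + norm x)" if "t \<in> {0..T}" for t x
    using norm_le_vector_matrix_mult[OF that, of "grad_x u t x" x] C(2)[OF that, of x] elliptic(1)
    by (simp add: field_simps)
  then show ?thesis using C(1) elliptic(1) by (intro exI[of _ "C / sqrt \<delta>"]) auto
qed

text \<open>Multiplying the gradient difference by \<sigma> at \<open>y\<close> gives the increment
  of \<open>w\<close> minus the gradient at \<open>x\<close> times the increment of \<sigma>. Both
  are Lipschitz, the second with the linearly growing factor \<open>norm (grad_x u t x)\<close>, and
  ellipticity removes \<sigma> from the left-hand side.\<close>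

lemma grad_lipschitz:
  "\<exists>C\<ge>0. \<forall>t\<in>{0..T}. \<forall>x y. norm (grad_x u t y - grad_x u t x) \<le> C * (1 + norm x) * norm (y - x)"
proof -
  obtain C where C: "C \<ge> 0" "\<And>t x. t \<in> {0..T} \<Longrightarrow> norm (grad_x u t x) \<le> C * (1 + norm x)"
    using grad_growth by blast
  have "norm (grad_x u t y - grad_x u t x) \<le> ((L + C * K) / sqrt \<delta>) * (1 + norm x) * norm (y - x)"
    if t: "t \<in> {0..T}" for t x y
  proof -
    have "(grad_x u t y - grad_x u t x) v* \<sigma> t y = (w t y - w t x) - grad_x u t x v* (\<sigma> t y - \<sigma> t x)"
      by (simp add: vector_matrix_mult_diff)
    also have "norm \<dots> \<le> norm (w t y - w t x) + norm (grad_x u t x) * norm (\<sigma> t y - \<sigma> t x)"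
      by (rule order_trans[OF norm_triangle_ineq4]) (simp add: norm_vector_matrix_mult_le)
    also have "\<dots> \<le> L * norm (y - x) + (C * (1 + norm x)) * (K * norm (y - x))"
      using lipschitz_onD[OF L[OF t], of y x] lipschitz_onD[OF lipschitz(2)[OF t], of y x] C t
      by (intro add_mono mult_mono) (auto simp: dist_norm)
    also have "\<dots> \<le> (L + C * K) * (1 + norm x) * norm (y - x)"
      using L_nonneg by (simp add: algebra_simps mult_nonneg_nonneg)
    finally have "norm ((grad_x u t y - grad_x u t x) v* \<sigma> t y) \<le> (L + C * K) * (1 + norm x) * norm (y - x)" .
    from divide_right_mono[OF this, of "sqrt \<delta>"] norm_le_vector_matrix_mult[OF t, of "grad_x u t y - grad_x u t x" y] elliptic(1)
    show ?thesis by simp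
  qed
  then show ?thesis using C(1) K_nonneg L_nonneg elliptic(1)
    by (intro exI[of _ "(L + C * K) / sqrt \<delta>"]) auto
qed

text \<open>The Lipschitz constant of the gradient at \<open>x\<close> bounds every column of its
  derivative there; the sum over columns brings in \<open>CARD('d)\<close>.\<close>

lemma hess_growth: "\<exists>C\<ge>0. \<forall>t\<in>{0..T}. \<forall>x. norm (hess_x u t x) \<le> C * (1 + norm x)"
proof -
  obtain C where C: "C \<ge> 0" "\<And>t x y. t \<in> {0..T} \<Longrightarrow>
      norm (grad_x u t y - grad_x u t x) \<le> C * (1 + norm x) * norm (y - x)"
    using grad_lipschitz by blast
  have "norm (hess_x u t x) \<le> (CARD('d) * C) * (1 + norm x)" if t: "t \<in> {0..T}" for t x
  proof -
    have "norm (hess_x u t x) \<le> (\<Sum>j\<in>UNIV. norm (hess_x u t x *v axis j 1))"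
      by (rule norm_matrix_le_columns)
    also have "\<dots> \<le> (\<Sum>j\<in>(UNIV::'d set). C * (1 + norm x))"
    proof (rule sum_mono)
      fix j :: 'd
      show "norm (hess_x u t x *v axis j 1) \<le> C * (1 + norm x)"
        using has_derivative_norm_le_local_lipschitz[OF hess[OF t, of x] C(2)[OF t], of "axis j 1"]
        by (simp add: norm_axis_1)
    qed
    finally show ?thesis by simp
  qed
  then show ?thesis using C(1) by (intro exI[of _ "CARD('d) * C"]) auto
qed

lemma u_mean_value:
  assumes "t \<in> {0..T}"
  obtains z where "norm (z - x) \<le> norm (y - x)" "u t y - u t x = grad_x u t z \<bullet> (y - x)"
proof -
  have d: "((\<lambda>s. u t (x + s *\<^sub>R (y - x))) has_derivative (\<lambda>r. grad_x u t (x + s *\<^sub>R (y - x)) \<bullet> (r *\<^sub>R (y - x))))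
      (at s within {0..1})" for s
    by (rule has_derivative_at_withinI, rule has_derivative_compose[OF _ grad[OF assms]])
      (auto intro!: derivative_eq_intros)
  obtain s where s: "s \<in> {0..1}"
    "u t (x + 1 *\<^sub>R (y - x)) - u t (x + 0 *\<^sub>R (y - x)) = grad_x u t (x + s *\<^sub>R (y - x)) \<bullet> ((1 - 0) *\<^sub>R (y - x))"
    using mvt_very_simple[OF zero_le_one d] by auto
  show ?thesis
    using s by (intro that[of "x + s *\<^sub>R (y - x)"]) (auto simp: mult_left_le_one_le)
qed

text \<open>A second-order remainder that needs no Hessian: the mean value theorem yields a gradient
  at an intermediate point, and its Lipschitz bound from \<open>x\<close> gives the second factor
  \<open>norm (y - x)\<close>.\<close>

lemma u_taylor:
  "\<exists>C\<ge>0. \<forall>t\<in>{0..T}. \<forall>x y. \<bar>u t y - u t x - grad_x u t x \<bullet> (y - x)\<bar> \<le> C * (1 + norm x) * (norm (y - x))\<^sup>2"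
proof -
  obtain C where C: "C \<ge> 0" "\<And>t x y. t \<in> {0..T} \<Longrightarrow>
      norm (grad_x u t y - grad_x u t x) \<le> C * (1 + norm x) * norm (y - x)"
    using grad_lipschitz by blast
  have "\<bar>u t y - u t x - grad_x u t x \<bullet> (y - x)\<bar> \<le> C * (1 + norm x) * (norm (y - x))\<^sup>2"
    if t: "t \<in> {0..T}" for t x y
  proof -
    obtain z where z: "norm (z - x) \<le> norm (y - x)" "u t y - u t x = grad_x u t z \<bullet> (y - x)"
      using u_mean_value[OF t] .
    have "\<bar>u t y - u t x - grad_x u t x \<bullet> (y - x)\<bar> = \<bar>(grad_x u t z - grad_x u t x) \<bullet> (y - x)\<bar>"
      unfolding z(2) by (simp add: inner_diff_left)
    also have "\<dots> \<le> norm (grad_x u t z - grad_x u t x) * norm (y - x)"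
      by (rule Cauchy_Schwarz_ineq2)
    also have "\<dots> \<le> (C * (1 + norm x) * norm (y - x)) * norm (y - x)"
      using C z(1) by (intro mult_right_mono order_trans[OF C(2)[OF t]] mult_left_mono) auto
    finally show ?thesis by (simp add: power2_eq_square mult.assoc)
  qed
  then show ?thesis using C(1) by blast
qed

lemma u_space_lipschitz:
  "\<exists>C\<ge>0. \<forall>t\<in>{0..T}. \<forall>x y. \<bar>u t y - u t x\<bar> \<le> C * (1 + norm x + norm (y - x)) * norm (y - x)"
proof -
  obtain C where C: "C \<ge> 0" "\<And>t x. t \<in> {0..T} \<Longrightarrow> norm (grad_x u t x) \<le> C * (1 + norm x)"
    using grad_growth by blast
  have "\<bar>u t y - u t x\<bar> \<le> C * (1 + norm x + norm (y - x)) * norm (y - x)"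
    if t: "t \<in> {0..T}" for t x y
  proof -
    obtain z where z: "norm (z - x) \<le> norm (y - x)" "u t y - u t x = grad_x u t z \<bullet> (y - x)"
      using u_mean_value[OF t] .
    have "\<bar>u t y - u t x\<bar> \<le> norm (grad_x u t z) * norm (y - x)"
      unfolding z(2) by (rule Cauchy_Schwarz_ineq2)
    also have "\<dots> \<le> (C * (1 + norm x + norm (y - x))) * norm (y - x)"
    proof (rule mult_right_mono)
      have "norm z \<le> norm x + norm (y - x)" using z(1) norm_triangle_sub[of z x] by linarith
      then show "norm (grad_x u t z) \<le> C * (1 + norm x + norm (y - x))"
        using C(1) by (intro order_trans[OF C(2)[OF t]] mult_left_mono) auto
    qed simp
    finally show ?thesis .
  qed
  then show ?thesis using C(1) by blast
qed

lemma u_growth: "\<exists>C\<ge>0. \<forall>t\<in>{0..T}. \<forall>x. \<bar>u t x\<bar> \<le> C * (1 + norm x)\<^sup>2"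
proof -
  obtain C where C: "C \<ge> 0" "\<And>t x y. t \<in> {0..T} \<Longrightarrow>
      \<bar>u t y - u t x\<bar> \<le> C * (1 + norm x + norm (y - x)) * norm (y - x)"
    using u_space_lipschitz by blast
  obtain B where B: "\<And>t. t \<in> {0..T} \<Longrightarrow> \<bar>u t 0\<bar> \<le> B"
    using compact_imp_bounded[OF compact_continuous_image[OF continuous_time_slices(1)[of 0] compact_Icc]]
    unfolding bounded_iff real_norm_def by (metis imageI)
  have B0: "B \<ge> 0" using B[of 0] T_pos by auto
  have "\<bar>u t x\<bar> \<le> (B + C) * (1 + norm x)\<^sup>2" if t: "t \<in> {0..T}" for t x
  proof -
    have "\<bar>u t x\<bar> \<le> B + C * ((1 + norm x) * norm x)"
      using C(2)[OF t, of x 0] B[OF t] by (simp add: mult.assoc)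
    also have "\<dots> \<le> B * (1 + norm x)\<^sup>2 + C * (1 + norm x)\<^sup>2"
      using B0 C(1) by (intro add_mono mult_left_mono mult_left_le[of _ B, simplified mult.commute])
        (auto simp: power2_eq_square algebra_simps)
    finally show ?thesis by (simp add: distrib_right)
  qed
  then show ?thesis using C(1) B0 by (intro exI[of _ "B + C"]) auto
qed


section \<open>Regularity in time\<close>

text \<open>The PDE expresses the time derivative through terms already bounded. The degree 3 comes
  from the trace, where the Hessian grows linearly and the diffusion matrix quadratically.\<close>

lemma time_deriv_growth: "\<exists>C\<ge>0. \<forall>t\<in>{0..T}. \<forall>x. \<bar>time_deriv T u t x\<bar> \<le> C * (1 + norm x) ^ 3"
proof -
  obtain Cb where Cb: "Cb \<ge> 0" "\<And>t x. t \<in> {0..T} \<Longrightarrow> norm (b t x) \<le> Cb * (1 + norm x)"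
    using b_growth by blast
  obtain Cs where Cs: "Cs \<ge> 0" "\<And>t x. t \<in> {0..T} \<Longrightarrow> norm (\<sigma> t x) \<le> Cs * (1 + norm x)"
    using \<sigma>_growth by blast
  obtain Cg where Cg: "Cg \<ge> 0" "\<And>t x. t \<in> {0..T} \<Longrightarrow> norm (grad_x u t x) \<le> Cg * (1 + norm x)"
    using grad_growth by blast
  obtain Ch where Ch: "Ch \<ge> 0" "\<And>t x. t \<in> {0..T} \<Longrightarrow> norm (hess_x u t x) \<le> Ch * (1 + norm x)"
    using hess_growth by blast
  obtain Cw where Cw: "Cw \<ge> 0" "\<And>t x. t \<in> {0..T} \<Longrightarrow> norm (w t x) \<le> Cw * (1 + norm x)"
    using w_growth by blast
  obtain Cu where Cu: "Cu \<ge> 0" "\<And>t x. t \<in> {0..T} \<Longrightarrow> \<bar>u t x\<bar> \<le> Cu * (1 + norm x)\<^sup>2"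
    using u_growth by blast
  obtain Cf where Cf: "\<And>t. t \<in> {0..T} \<Longrightarrow> \<bar>f t 0 0 0\<bar> \<le> Cf"
    using bounded(3) unfolding bounded_iff real_norm_def by (metis imageI)
  have Cf0: "Cf \<ge> 0" using Cf[of 0] T_pos by auto
  let ?C = "Cb * Cg + Ch * Cs\<^sup>2 + (Cf + K * (1 + Cu + Cw))"
  have bound: "\<bar>time_deriv T u t x\<bar> \<le> ?C * (1 + norm x) ^ 3" if t': "t \<in> {0..<T}" for t x
  proof -
    define R where "R = 1 + norm x"
    have t: "t \<in> {0..T}" using t' by auto
    have R: "R \<ge> 1" "R \<le> R ^ 3" "R\<^sup>2 \<le> R ^ 3" "1 \<le> R ^ 3"
      by (auto simp: R_def intro: power_increasing self_le_power)
    have 1: "\<bar>b t x \<bullet> grad_x u t x\<bar> \<le> Cb * Cg * R ^ 3"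
    proof -
      have "\<bar>b t x \<bullet> grad_x u t x\<bar> \<le> (Cb * R) * (Cg * R)"
        unfolding R_def using Cb Cg t by (intro order_trans[OF Cauchy_Schwarz_ineq2] mult_mono) auto
      also have "\<dots> = Cb * Cg * R\<^sup>2" by (simp add: power2_eq_square)
      also have "\<dots> \<le> Cb * Cg * R ^ 3" using R Cb(1) Cg(1) by (intro mult_left_mono) auto
      finally show ?thesis .
    qed
    have 2: "\<bar>1/2 * trace (hess_x u t x ** (\<sigma> t x ** transpose (\<sigma> t x)))\<bar> \<le> Ch * Cs\<^sup>2 * R ^ 3"
    proof -
      have "norm (\<sigma> t x ** transpose (\<sigma> t x)) \<le> (Cs * R) * (Cs * R)"
        unfolding R_def using Cs t
        by (intro order_trans[OF norm_matrix_mult_le] mult_mono) (auto simp: norm_transpose)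
      then have "\<bar>trace (hess_x u t x ** (\<sigma> t x ** transpose (\<sigma> t x)))\<bar> \<le> (Ch * R) * ((Cs * R) * (Cs * R))"
        using Ch R t by (intro order_trans[OF abs_trace_mult_le] mult_mono) (auto simp: R_def)
      also have "\<dots> = Ch * Cs\<^sup>2 * R ^ 3" by (simp add: power2_eq_square power3_eq_cube)
      finally show ?thesis by (simp add: abs_mult)
    qed
    have 3: "\<bar>f t x (u t x) (w t x)\<bar> \<le> (Cf + K * (1 + Cu + Cw)) * R ^ 3"
    proof -
      have "norm x + \<bar>u t x\<bar> + norm (w t x) \<le> R + Cu * R\<^sup>2 + Cw * R"
        using Cu(2)[OF t, of x] Cw(2)[OF t, of x] by (simp add: R_def)
      also have "\<dots> \<le> R ^ 3 + Cu * R ^ 3 + Cw * R ^ 3"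
        using R Cu(1) Cw(1) by (intro add_mono mult_left_mono) auto
      finally have "K * (norm x + \<bar>u t x\<bar> + norm (w t x)) \<le> K * ((1 + Cu + Cw) * R ^ 3)"
        using K_nonneg by (intro mult_left_mono) (auto simp: algebra_simps)
      moreover have "\<bar>f t x (u t x) (w t x) - f t 0 0 0\<bar> \<le> K * (norm x + \<bar>u t x\<bar> + norm (w t x))"
        using f_bound[OF t t, of x "u t x" "w t x" 0 0 0] by simp
      moreover have "Cf \<le> Cf * R ^ 3" using R Cf0 by (simp add: mult_le_cancel_left1)
      ultimately show ?thesis using Cf[OF t] by (simp add: distrib_right mult.assoc)
    qed
    have "\<bar>time_deriv T u t x\<bar> \<le> \<bar>b t x \<bullet> grad_x u t x\<bar>
        + \<bar>1/2 * trace (hess_x u t x ** (\<sigma> t x ** transpose (\<sigma> t x)))\<bar> + \<bar>f t x (u t x) (w t x)\<bar>"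
      unfolding pde_eq[OF t'] by linarith
    also have "\<dots> \<le> Cb * Cg * R ^ 3 + Ch * Cs\<^sup>2 * R ^ 3 + (Cf + K * (1 + Cu + Cw)) * R ^ 3"
      using 1 2 3 by linarith
    finally show ?thesis by (simp add: R_def distrib_right)
  qed
  have "\<bar>time_deriv T u t x\<bar> \<le> ?C * (1 + norm x) ^ 3" if t: "t \<in> {0..T}" for t x
  proof -
    \<comment> \<open>The PDE is available before the terminal time only; the bound extends to
      \<open>T\<close> by continuity of the time derivative.\<close>
    have cl: "closure {0..<T} = {0..T}" using T_pos by simp
    show ?thesis
      using continuous_on_closure_norm_le[of "{0..<T}" "\<lambda>t. time_deriv T u t x" "?C * (1 + norm x) ^ 3" t]
        continuous_time_slices(2)[of x] bound t unfolding cl by simp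
  qed
  moreover have "?C \<ge> 0" using Cb Cg Ch Cs Cf0 Cu Cw K_nonneg by simp
  ultimately show ?thesis by blast
qed

lemma u_time_lipschitz:
  "\<exists>C\<ge>0. \<forall>s\<in>{0..T}. \<forall>t\<in>{0..T}. \<forall>x. \<bar>u s x - u t x\<bar> \<le> C * (1 + norm x) ^ 3 * \<bar>s - t\<bar>"
proof -
  obtain C where C: "C \<ge> 0" "\<And>t x. t \<in> {0..T} \<Longrightarrow> \<bar>time_deriv T u t x\<bar> \<le> C * (1 + norm x) ^ 3"
    using time_deriv_growth by blast
  have "\<bar>u s x - u t x\<bar> \<le> C * (1 + norm x) ^ 3 * \<bar>s - t\<bar>" if "s \<in> {0..T}" "t \<in> {0..T}" for s t x
    using field_differentiable_bound[of "{0..T}" "\<lambda>t. u t x" "\<lambda>t. time_deriv T u t x" "C * (1 + norm x) ^ 3" s t]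
      time_deriv[of _ x] C(2) that by (simp add: has_real_derivative_iff_has_vector_derivative)
  then show ?thesis using C(1) by blast
qed

text \<open>Interpolation: a difference quotient of step \<open>sqrt \<bar>s - t\<bar>\<close> balances the Lipschitz bound
  of \<open>u\<close> in time against that of its gradient in space.\<close>

lemma grad_time_hoelder:
  "\<exists>C\<ge>0. \<forall>s\<in>{0..T}. \<forall>t\<in>{0..T}. \<forall>x.
     norm (grad_x u s x - grad_x u t x) \<le> C * (1 + norm x) ^ 3 * sqrt \<bar>s - t\<bar>"
proof -
  obtain A where A: "A \<ge> 0" "\<And>t x y. t \<in> {0..T} \<Longrightarrow>
      \<bar>u t y - u t x - grad_x u t x \<bullet> (y - x)\<bar> \<le> A * (1 + norm x) * (norm (y - x))\<^sup>2"
    using u_taylor by blast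
  obtain B where B: "B \<ge> 0" "\<And>s t x. s \<in> {0..T} \<Longrightarrow> t \<in> {0..T} \<Longrightarrow>
      \<bar>u s x - u t x\<bar> \<le> B * (1 + norm x) ^ 3 * \<bar>s - t\<bar>"
    using u_time_lipschitz by blast
  let ?C = "2 * A + B * (1 + sqrt T) ^ 3 + B"
  have C0: "?C \<ge> 0" using A B T_pos by auto
  have "norm (grad_x u s x - grad_x u t x) \<le> ?C * (1 + norm x) ^ 3 * sqrt \<bar>s - t\<bar>"
    if s: "s \<in> {0..T}" and t: "t \<in> {0..T}" for s t x
  proof (cases "grad_x u s x = grad_x u t x")
    case True
    then show ?thesis using A B T_pos by simp
  next
    case False
    define D where "D = grad_x u s x - grad_x u t x"
    define e where "e = D /\<^sub>R norm D"
    define \<epsilon> where "\<epsilon> = sqrt \<bar>s - t\<bar>"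
    define R where "R = 1 + norm x"
    have D: "D \<noteq> 0" using False by (simp add: D_def)
    have e: "norm e = 1" "D \<bullet> e = norm D"
      using D by (simp_all add: e_def power2_norm_eq_inner[symmetric] power2_eq_square)
    have \<epsilon>: "\<epsilon> > 0" "\<epsilon>\<^sup>2 = \<bar>s - t\<bar>" "\<epsilon> \<le> sqrt T"
      using False s t by (auto simp: \<epsilon>_def)
    have R: "R \<ge> 1" "R \<le> R ^ 3" by (auto simp: R_def intro: self_le_power)
    let ?y = "x + \<epsilon> *\<^sub>R e"
    have y: "1 + norm ?y \<le> (1 + sqrt T) * R"
    proof -
      have "norm ?y \<le> norm x + \<epsilon>" using norm_triangle_ineq[of x "\<epsilon> *\<^sub>R e"] e \<epsilon> by simp
      also have "\<dots> \<le> norm x + sqrt T * R"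
        using \<epsilon> R T_pos by (intro add_left_mono order_trans[OF \<epsilon>(3)]) (simp add: mult_le_cancel_left1)
      finally show ?thesis by (simp add: R_def distrib_right)
    qed
    \<comment> \<open>Comparing the expansions at times \<open>s\<close> and \<open>t\<close> leaves
      two Taylor remainders in space and two increments in time, all of order
      \<open>\<epsilon>\<^sup>2\<close>; division by \<epsilon> leaves one power.\<close>
    have "\<epsilon> * norm D = grad_x u s x \<bullet> (?y - x) - grad_x u t x \<bullet> (?y - x)"
      using e(2) by (simp add: D_def inner_diff_left flip: right_diff_distrib)
    also have "\<dots> \<le> \<bar>u s ?y - u s x - grad_x u s x \<bullet> (?y - x)\<bar> + \<bar>u t ?y - u t x - grad_x u t x \<bullet> (?y - x)\<bar>
        + \<bar>u s ?y - u t ?y\<bar> + \<bar>u s x - u t x\<bar>" by linarith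
    also have "\<dots> \<le> A * R * \<epsilon>\<^sup>2 + A * R * \<epsilon>\<^sup>2 + B * (1 + norm ?y) ^ 3 * \<epsilon>\<^sup>2 + B * R ^ 3 * \<epsilon>\<^sup>2"
      using A(2)[OF s, of ?y x] A(2)[OF t, of ?y x] B(2)[OF s t, of ?y] B(2)[OF s t, of x] e \<epsilon>
      by (intro add_mono) (simp_all add: R_def)
    also have "\<dots> \<le> A * R ^ 3 * \<epsilon>\<^sup>2 + A * R ^ 3 * \<epsilon>\<^sup>2 + B * ((1 + sqrt T) * R) ^ 3 * \<epsilon>\<^sup>2 + B * R ^ 3 * \<epsilon>\<^sup>2"
      using A(1) B(1) R y by (intro add_mono mult_right_mono mult_left_mono power_mono) auto
    also have "\<dots> = \<epsilon> * (?C * R ^ 3 * \<epsilon>)"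
      unfolding power_mult_distrib[of "1 + sqrt T"] by (simp add: power2_eq_square distrib_left distrib_right mult_ac)
    finally show ?thesis using \<epsilon>(1) by (simp add: D_def R_def \<epsilon>_def)
  qed
  then show ?thesis using C0 by blast
qed

text \<open>Product rule for differences: the cubic factor of the gradient meets the linear growth
  of \<sigma>, hence the fourth power.\<close>

lemma w_time_hoelder:
  "\<exists>C\<ge>0. \<forall>s\<in>{0..T}. \<forall>t\<in>{0..T}. \<forall>x. norm (w s x - w t x) \<le> C * (1 + norm x) ^ 4 * sqrt \<bar>s - t\<bar>"
proof -
  obtain A where A: "A \<ge> 0" "\<And>s t x. s \<in> {0..T} \<Longrightarrow> t \<in> {0..T} \<Longrightarrow>
      norm (grad_x u s x - grad_x u t x) \<le> A * (1 + norm x) ^ 3 * sqrt \<bar>s - t\<bar>"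
    using grad_time_hoelder by blast
  obtain Cs where Cs: "Cs \<ge> 0" "\<And>t x. t \<in> {0..T} \<Longrightarrow> norm (\<sigma> t x) \<le> Cs * (1 + norm x)"
    using \<sigma>_growth by blast
  obtain Cg where Cg: "Cg \<ge> 0" "\<And>t x. t \<in> {0..T} \<Longrightarrow> norm (grad_x u t x) \<le> Cg * (1 + norm x)"
    using grad_growth by blast
  have "norm (w s x - w t x) \<le> (A * Cs + Cg * K) * (1 + norm x) ^ 4 * sqrt \<bar>s - t\<bar>"
    if s: "s \<in> {0..T}" and t: "t \<in> {0..T}" for s t x
  proof -
    define R where "R = 1 + norm x"
    have R: "R \<ge> 1" "R \<le> R ^ 4" by (auto simp: R_def intro: self_le_power)
    have "w s x - w t x = (grad_x u s x - grad_x u t x) v* \<sigma> s x + grad_x u t x v* (\<sigma> s x - \<sigma> t x)"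
      by (simp add: vector_matrix_mult_diff)
    also have "norm \<dots> \<le> norm (grad_x u s x - grad_x u t x) * norm (\<sigma> s x) + norm (grad_x u t x) * norm (\<sigma> s x - \<sigma> t x)"
      by (intro order_trans[OF norm_triangle_ineq] add_mono norm_vector_matrix_mult_le)
    also have "\<dots> \<le> (A * R ^ 3 * sqrt \<bar>s - t\<bar>) * (Cs * R) + (Cg * R) * (K * sqrt \<bar>s - t\<bar>)"
      using A(2)[OF s t, of x] Cs(2)[OF s, of x] Cg(2)[OF t, of x] \<sigma>_bound[OF s t, of x x] A(1) Cg(1) R
      by (intro add_mono mult_mono) (auto simp: R_def)
    also have "\<dots> = A * Cs * R ^ 4 * sqrt \<bar>s - t\<bar> + Cg * K * R * sqrt \<bar>s - t\<bar>"
      by (simp add: numeral_eq_Suc)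
    also have "\<dots> \<le> A * Cs * R ^ 4 * sqrt \<bar>s - t\<bar> + Cg * K * R ^ 4 * sqrt \<bar>s - t\<bar>"
      using R Cg(1) K_nonneg by (intro add_left_mono mult_right_mono mult_left_mono) auto
    finally show ?thesis by (simp add: R_def algebra_simps)
  qed
  then show ?thesis using A Cs Cg K_nonneg by (intro exI[of _ "A * Cs + Cg * K"]) auto
qed

end

section \<open>One step of the Euler scheme\<close>

text \<open>A mean value inequality for parameter integrals. The integrable bound \<open>G\<close>
  on the derivative makes \<open>F\<close> Lipschitz in the parameter, which yields both continuity
  of the integral on the closed interval and domination of the difference quotients inside.
  Derivatives are asked for in the open interval only, since \<open>u\<close> may have just a
  one-sided time derivative at the two ends of an Euler step.\<close>

lemma integral_increment_le:
  fixes F F' :: "real \<Rightarrow> 'x \<Rightarrow> real"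
  assumes ab: "a \<le> b"
    and int: "\<And>s. s \<in> {a..b} \<Longrightarrow> integrable M (F s)"
    and meas: "\<And>s. s \<in> {a<..<b} \<Longrightarrow> F' s \<in> borel_measurable M"
    and cont: "\<And>\<xi>. \<xi> \<in> space M \<Longrightarrow> continuous_on {a..b} (\<lambda>s. F s \<xi>)"
    and deriv: "\<And>s \<xi>. s \<in> {a<..<b} \<Longrightarrow> \<xi> \<in> space M \<Longrightarrow> ((\<lambda>s. F s \<xi>) has_real_derivative F' s \<xi>) (at s)"
    and dom: "\<And>s \<xi>. s \<in> {a<..<b} \<Longrightarrow> \<xi> \<in> space M \<Longrightarrow> \<bar>F' s \<xi>\<bar> \<le> G \<xi>" "integrable M G"
    and bound: "\<And>s. s \<in> {a<..<b} \<Longrightarrow> \<bar>\<integral>\<xi>. F' s \<xi> \<partial>M\<bar> \<le> B"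
  shows "\<bar>(\<integral>\<xi>. F b \<xi> \<partial>M) - (\<integral>\<xi>. F a \<xi> \<partial>M)\<bar> \<le> B * (b - a)"
proof (cases "a = b")
  case False
  then have ab: "a < b" using ab by simp
  let ?\<phi> = "\<lambda>s. \<integral>\<xi>. F s \<xi> \<partial>M"
  have lip: "\<bar>F s \<xi> - F r \<xi>\<bar> \<le> G \<xi> * \<bar>s - r\<bar>" if "s \<in> {a..b}" "r \<in> {a..b}" "\<xi> \<in> space M" for s r \<xi>
  proof -
    have *: "\<bar>F s \<xi> - F r \<xi>\<bar> \<le> G \<xi> * \<bar>s - r\<bar>" if rs: "r < s" "s \<in> {a..b}" "r \<in> {a..b}" for s r
    proof -
      obtain l z where z: "r < z" "z < s" "((\<lambda>s. F s \<xi>) has_real_derivative l) (at z)"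
          "F s \<xi> - F r \<xi> = (s - r) * l"
      proof -
        have "continuous_on {r..s} (\<lambda>s. F s \<xi>)"
          by (rule continuous_on_subset[OF cont[OF \<open>\<xi> \<in> space M\<close>]]) (use rs in auto)
        moreover have "(\<lambda>s. F s \<xi>) differentiable (at z)" if "r < z" "z < s" for z
          using deriv[OF _ \<open>\<xi> \<in> space M\<close>, of z] that rs by (force simp: real_differentiable_def)
        ultimately show ?thesis using MVT[OF rs(1), of "\<lambda>s. F s \<xi>"] that by blast
      qed
      have zab: "z \<in> {a<..<b}" using z rs by auto
      have "l = F' z \<xi>" using DERIV_unique[OF z(3) deriv[OF zab \<open>\<xi> \<in> space M\<close>]] .
      then show ?thesis
        using z dom(1)[OF zab \<open>\<xi> \<in> space M\<close>] rs(1) by (simp add: abs_mult mult.commute)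
    qed
    show ?thesis using *[of r s] *[of s r] that by (cases r s rule: linorder_cases) (auto simp: abs_minus_commute)
  qed
  have "continuous_on {a..b} ?\<phi>"
  proof -
    have "lipschitz_on \<bar>\<integral>\<xi>. G \<xi> \<partial>M\<bar> {a..b} ?\<phi>"
    proof (rule lipschitz_onI)
      fix s r assume sr: "s \<in> {a..b}" "r \<in> {a..b}"
      have "\<bar>?\<phi> s - ?\<phi> r\<bar> = \<bar>\<integral>\<xi>. F s \<xi> - F r \<xi> \<partial>M\<bar>" using int sr by simp
      also have "\<dots> \<le> (\<integral>\<xi>. G \<xi> * \<bar>s - r\<bar> \<partial>M)"
        using int sr dom(2) lip[OF sr] by (intro integral_abs_bound[THEN order_trans] integral_mono) auto
      also have "\<dots> \<le> \<bar>\<integral>\<xi>. G \<xi> \<partial>M\<bar> * \<bar>s - r\<bar>" by (simp add: mult_right_mono)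
      finally show "dist (?\<phi> s) (?\<phi> r) \<le> \<bar>\<integral>\<xi>. G \<xi> \<partial>M\<bar> * dist s r" by (simp add: dist_real_def)
    qed simp
    then show ?thesis by (rule lipschitz_on_continuous_on)
  qed
  moreover have D: "(?\<phi> has_real_derivative (\<integral>\<xi>. F' s \<xi> \<partial>M)) (at s)" if s: "s \<in> {a<..<b}" for s
  proof -
    \<comment> \<open>Dominated convergence is a statement on sequences, so the limit of the
      difference quotients is tested along an arbitrary sequence.\<close>
    have "((\<lambda>r. (?\<phi> r - ?\<phi> s) / (r - s)) \<longlongrightarrow> (\<integral>\<xi>. F' s \<xi> \<partial>M)) (at s within {a<..<b})"
      unfolding tendsto_at_iff_sequentially
    proof (intro allI impI)
      fix X assume X: "\<forall>i. X i \<in> {a<..<b} - {s}" "X \<longlonglongrightarrow> s"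
      have eq: "(?\<phi> (X i) - ?\<phi> s) / (X i - s) = (\<integral>\<xi>. (F (X i) \<xi> - F s \<xi>) / (X i - s) \<partial>M)" for i
        using int[of "X i"] int[of s] X(1)[rule_format, of i] s by simp
      have "(\<lambda>i. \<integral>\<xi>. (F (X i) \<xi> - F s \<xi>) / (X i - s) \<partial>M) \<longlonglongrightarrow> (\<integral>\<xi>. F' s \<xi> \<partial>M)"
      proof (rule integral_dominated_convergence[where w = G])
        show "F' s \<in> borel_measurable M" by (rule meas[OF s])
        show "integrable M G" by (rule dom)
        show "(\<lambda>\<xi>. (F (X i) \<xi> - F s \<xi>) / (X i - s)) \<in> borel_measurable M" for i
          using int[of "X i"] int[of s] X(1)[rule_format, of i] s by auto
        show "AE \<xi> in M. (\<lambda>i. (F (X i) \<xi> - F s \<xi>) / (X i - s)) \<longlonglongrightarrow> F' s \<xi>"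
        proof (rule AE_I2)
          fix \<xi> assume "\<xi> \<in> space M"
          from deriv[OF s this] have "((\<lambda>r. (F r \<xi> - F s \<xi>) / (r - s)) \<longlongrightarrow> F' s \<xi>) (at s)"
            by (simp add: has_field_derivative_iff)
          then show "(\<lambda>i. (F (X i) \<xi> - F s \<xi>) / (X i - s)) \<longlonglongrightarrow> F' s \<xi>"
            using X unfolding tendsto_at_iff_sequentially by (auto simp: comp_def)
        qed
        show "AE \<xi> in M. norm ((F (X i) \<xi> - F s \<xi>) / (X i - s)) \<le> G \<xi>" for i
        proof (rule AE_I2)
          fix \<xi> assume "\<xi> \<in> space M"
          then show "norm ((F (X i) \<xi> - F s \<xi>) / (X i - s)) \<le> G \<xi>"
            using lip[of "X i" s \<xi>] X(1)[rule_format, of i] s by (simp add: pos_divide_le_eq)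
        qed
      qed
      then show "((\<lambda>r. (?\<phi> r - ?\<phi> s) / (r - s)) \<circ> X) \<longlonglongrightarrow> (\<integral>\<xi>. F' s \<xi> \<partial>M)"
        by (simp add: comp_def eq)
    qed
    then show ?thesis
      using s by (simp add: has_field_derivative_iff at_within_open[of s "{a<..<b}"])
  qed
  ultimately obtain l z where z: "a < z" "z < b" "(?\<phi> has_real_derivative l) (at z)" "?\<phi> b - ?\<phi> a = (b - a) * l"
    using MVT[OF ab, of ?\<phi>] by (auto simp: real_differentiable_def)
  then have "l = (\<integral>\<xi>. F' z \<xi> \<partial>M)" using D[of z] by (auto intro: DERIV_unique)
  then show ?thesis using z bound[of z] ab by (simp add: abs_mult mult.commute)
qed simp

text \<open>The shape in which second derivatives arrive from integration by parts, one term per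
  coordinate of the Gaussian, recognised as the second-order term of the PDE.\<close>

lemma sum_columns_trace:
  fixes H S :: "real^'n::finite^'n"
  shows "(\<Sum>j\<in>UNIV. (H *v (S *v axis j 1)) \<bullet> (S *v axis j 1)) = trace (H ** (S ** transpose S))"
proof -
  have "(\<Sum>j\<in>UNIV. (H *v (S *v axis j 1)) \<bullet> (S *v axis j 1))
      = (\<Sum>j\<in>UNIV. \<Sum>a\<in>UNIV. \<Sum>c\<in>UNIV. H $ a $ c * (S $ c $ j * S $ a $ j))"
    unfolding matrix_vector_mult_basis
    by (simp add: column_def inner_vec_def matrix_vector_mult_def sum_distrib_right mult.assoc)
  also have "\<dots> = (\<Sum>a\<in>UNIV. \<Sum>j\<in>UNIV. \<Sum>c\<in>UNIV. H $ a $ c * (S $ c $ j * S $ a $ j))"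
    by (rule sum.swap)
  also have "\<dots> = (\<Sum>a\<in>UNIV. \<Sum>c\<in>UNIV. \<Sum>j\<in>UNIV. H $ a $ c * (S $ c $ j * S $ a $ j))"
    by (intro sum.cong refl sum.swap)
  also have "\<dots> = trace (H ** (S ** transpose S))"
    by (simp add: trace_def matrix_matrix_mult_def transpose_def sum_distrib_left)
  finally show ?thesis .
qed

text \<open>Splits the diffusion term into products with a single Gaussian coordinate, to each of
  which Stein's identity applies.\<close>

lemma inner_matrix_vector_sum:
  fixes A :: "real^'n::finite^'n"
  shows "v \<bullet> (A *v \<xi>) = (\<Sum>j\<in>UNIV. (v \<bullet> (A *v axis j 1)) * (\<xi> \<bullet> axis j 1))"
proof -
  have "v \<bullet> (A *v \<xi>) = (v v* A) \<bullet> \<xi>" by (simp add: dot_lmul_matrix)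
  also have "\<dots> = (\<Sum>j\<in>UNIV. (v v* A) $ j * \<xi> $ j)" by (simp add: inner_vec_def)
  also have "\<dots> = (\<Sum>j\<in>UNIV. ((v v* A) \<bullet> axis j 1) * (\<xi> \<bullet> axis j 1))" by (simp add: inner_axis)
  finally show ?thesis by (simp add: dot_lmul_matrix)
qed

lemma trace_mult_diff: "trace (A ** (B - C)) = trace (A ** B) - trace (A ** C)"
  for A B C :: "real^'n::finite^'n"
  by (simp add: trace_def matrix_matrix_mult_def sum_subtractf right_diff_distrib)

lemma mult_transpose_diff:
  "A ** transpose A - B ** transpose B = (A - B) ** transpose A + B ** transpose (A - B)"
  for A B :: "real^'n::finite^'n"
  by (simp add: matrix_matrix_mult_def transpose_def vec_eq_iff flip: sum.distrib sum_subtractf)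
    (simp add: left_diff_distrib right_diff_distrib)

text \<open>A second-order Bernoulli estimate that keeps the linear term exact, so that its
  mean-zero part can later be integrated away. The induction multiplies by
  \<open>1 + \<eta>\<close>, nonnegative by assumption, and closes because
  \<open>q + q\<^sup>2 \<le> (q + 1)\<^sup>2\<close>.\<close>

lemma one_plus_power_le:
  fixes \<eta> :: real
  assumes "\<eta> \<ge> - 1"
  shows "(1 + \<eta>) ^ q \<le> 1 + q * \<eta> + (real q)\<^sup>2 * \<eta>\<^sup>2 * (1 + \<bar>\<eta>\<bar>) ^ q"
proof (induction q)
  case (Suc q)
  define E where "E = (1 + \<bar>\<eta>\<bar>) ^ q"
  have E: "1 \<le> E" "E \<le> E * (1 + \<bar>\<eta>\<bar>)" by (auto simp: E_def mult_le_cancel_left1)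
  have "(1 + \<eta>) ^ Suc q \<le> (1 + \<eta>) * (1 + q * \<eta> + (real q)\<^sup>2 * \<eta>\<^sup>2 * E)"
    using Suc assms by (simp add: E_def mult_left_mono)
  also have "\<dots> = 1 + Suc q * \<eta> + q * \<eta>\<^sup>2 + (real q)\<^sup>2 * \<eta>\<^sup>2 * (E * (1 + \<eta>))"
    by (simp add: algebra_simps power2_eq_square)
  also have "\<dots> \<le> 1 + Suc q * \<eta> + q * \<eta>\<^sup>2 * (E * (1 + \<bar>\<eta>\<bar>)) + (real q)\<^sup>2 * \<eta>\<^sup>2 * (E * (1 + \<bar>\<eta>\<bar>))"
  proof (intro add_mono order_refl)
    show "real q * \<eta>\<^sup>2 \<le> real q * \<eta>\<^sup>2 * (E * (1 + \<bar>\<eta>\<bar>))"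
      using mult_left_mono[of 1 "E * (1 + \<bar>\<eta>\<bar>)" "real q * \<eta>\<^sup>2"] E by simp
    show "(real q)\<^sup>2 * \<eta>\<^sup>2 * (E * (1 + \<eta>)) \<le> (real q)\<^sup>2 * \<eta>\<^sup>2 * (E * (1 + \<bar>\<eta>\<bar>))"
      using E by (intro mult_left_mono) auto
  qed
  also have "\<dots> \<le> 1 + Suc q * \<eta> + (real (Suc q))\<^sup>2 * \<eta>\<^sup>2 * (E * (1 + \<bar>\<eta>\<bar>))"
  proof -
    have "real q * (\<eta>\<^sup>2 * (E * (1 + \<bar>\<eta>\<bar>))) + (real q)\<^sup>2 * (\<eta>\<^sup>2 * (E * (1 + \<bar>\<eta>\<bar>)))
        \<le> (real (Suc q))\<^sup>2 * (\<eta>\<^sup>2 * (E * (1 + \<bar>\<eta>\<bar>)))"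
      unfolding distrib_right[symmetric]
    proof (rule mult_right_mono)
      show "0 \<le> \<eta>\<^sup>2 * (E * (1 + \<bar>\<eta>\<bar>))" using E by (intro mult_nonneg_nonneg) auto
    qed (simp add: power2_eq_square algebra_simps)
    then show ?thesis by (simp only: mult.assoc add.assoc)
  qed
  finally show ?case by (simp only: E_def power_Suc mult_ac)
qed simp

context parabolic_problem
begin

text \<open>With \<open>h = \<tau>\<^sup>2\<close> this is one Euler step driven by a standard Gaussian \<open>\<xi>\<close>. The parameter
  \<open>\<tau>\<close> makes the step a smooth function up to \<open>h = 0\<close>.\<close>

definition step :: "real \<Rightarrow> real^'d \<Rightarrow> real \<Rightarrow> real^'d \<Rightarrow> real^'d" where
  "step t x \<tau> \<xi> = x + \<tau>\<^sup>2 *\<^sub>R b t x + \<tau> *\<^sub>R (\<sigma> t x *v \<xi>)"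

section \<open>Size of one Euler step\<close>

text \<open>The product form dominates the growth in \<open>x\<close> and in \<xi> at once and
  factorises under powers: integrating \<xi> out of \<open>weight x \<xi> ^ k\<close> leaves a
  Gaussian moment times \<open>(1 + norm x) ^ k\<close>.\<close>

abbreviation weight :: "real^'d \<Rightarrow> real^'d \<Rightarrow> real" where
  "weight x \<xi> \<equiv> (1 + norm x) * (1 + norm \<xi>)"

lemma weight_ge: "1 \<le> weight x \<xi>" "1 + norm x \<le> weight x \<xi>" "1 + norm \<xi> \<le> weight x \<xi>"
  by (simp_all add: algebra_simps)

lemma weight_mono: "i \<le> j \<Longrightarrow> weight x \<xi> ^ i \<le> weight x \<xi> ^ j"
  by (intro power_increasing weight_ge)

text \<open>The drift contributes \<open>\<tau>\<^sup>2\<close>, which on the admissible range is at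
  most \<open>sqrt T * \<tau>\<close>; the order \<tau> is that of the diffusion.\<close>

lemma norm_step_diff_le:
  "\<exists>C\<ge>0. \<forall>t\<in>{0..T}. \<forall>\<tau>\<in>{0..sqrt T}. \<forall>x \<xi>. norm (step t x \<tau> \<xi> - x) \<le> C * \<tau> * weight x \<xi>"
proof -
  obtain Cb where Cb: "Cb \<ge> 0" "\<And>t x. t \<in> {0..T} \<Longrightarrow> norm (b t x) \<le> Cb * (1 + norm x)"
    using b_growth by blast
  obtain Cs where Cs: "Cs \<ge> 0" "\<And>t x. t \<in> {0..T} \<Longrightarrow> norm (\<sigma> t x) \<le> Cs * (1 + norm x)"
    using \<sigma>_growth by blast
  have "norm (step t x \<tau> \<xi> - x) \<le> (sqrt T * Cb + Cs) * \<tau> * weight x \<xi>"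
    if t: "t \<in> {0..T}" and \<tau>: "\<tau> \<in> {0..sqrt T}" for t x \<tau> \<xi>
  proof -
    have "norm (step t x \<tau> \<xi> - x) \<le> \<tau>\<^sup>2 * norm (b t x) + \<tau> * (norm (\<sigma> t x) * norm \<xi>)"
      using norm_triangle_ineq[of "\<tau>\<^sup>2 *\<^sub>R b t x" "\<tau> *\<^sub>R (\<sigma> t x *v \<xi>)"]
        mult_left_mono[OF norm_matrix_vector_mult_le[of "\<sigma> t x" \<xi>], of \<tau>] \<tau>
      by (simp add: step_def)
    also have "\<dots> \<le> (sqrt T * \<tau>) * (Cb * weight x \<xi>) + \<tau> * (Cs * weight x \<xi>)"
    proof (intro add_mono[OF mult_mono mult_left_mono])
      show "\<tau>\<^sup>2 \<le> sqrt T * \<tau>" using \<tau> by (simp add: power2_eq_square mult_right_mono)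
      show "norm (b t x) \<le> Cb * weight x \<xi>"
        using Cb(2)[OF t, of x] mult_left_mono[OF weight_ge(2)[of x \<xi>] Cb(1)] by linarith
      have "norm (\<sigma> t x) * norm \<xi> \<le> (Cs * (1 + norm x)) * (1 + norm \<xi>)"
        using Cs t by (intro mult_mono) auto
      then show "norm (\<sigma> t x) * norm \<xi> \<le> Cs * weight x \<xi>" by (simp add: mult.assoc)
    qed (use \<tau> T_pos in auto)
    finally show ?thesis by (simp add: algebra_simps)
  qed
  moreover have "sqrt T * Cb + Cs \<ge> 0" using Cb Cs T_pos by simp
  ultimately show ?thesis by blast
qed

lemma norm_step_le:
  "\<exists>C\<ge>0. \<forall>t\<in>{0..T}. \<forall>\<tau>\<in>{0..sqrt T}. \<forall>x \<xi>. 1 + norm (step t x \<tau> \<xi>) \<le> C * weight x \<xi>"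
proof -
  obtain C where C: "C \<ge> 0" "\<And>t \<tau> x \<xi>. t \<in> {0..T} \<Longrightarrow> \<tau> \<in> {0..sqrt T} \<Longrightarrow>
      norm (step t x \<tau> \<xi> - x) \<le> C * \<tau> * weight x \<xi>"
    using norm_step_diff_le by blast
  have "1 + norm (step t x \<tau> \<xi>) \<le> (1 + C * sqrt T) * weight x \<xi>"
    if t: "t \<in> {0..T}" and \<tau>: "\<tau> \<in> {0..sqrt T}" for t x \<tau> \<xi>
  proof -
    have "norm (step t x \<tau> \<xi>) \<le> norm x + norm (step t x \<tau> \<xi> - x)" by (rule norm_triangle_sub)
    moreover have "C * \<tau> * weight x \<xi> \<le> C * sqrt T * weight x \<xi>"
      using C(1) \<tau> by (intro mult_right_mono mult_left_mono) auto
    ultimately show ?thesis using C(2)[OF t \<tau>, of x \<xi>] weight_ge(2)[of x \<xi>]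
      unfolding distrib_right[of 1 "C * sqrt T"] by linarith
  qed
  then show ?thesis using C(1) T_pos by (intro exI[of _ "1 + C * sqrt T"]) auto
qed

text \<open>The step is affine in \<xi>, so each derivative in \<xi> releases one factor \<tau>.
  This is the factor in front of the trace after integration by parts.\<close>

lemma step_shift: "step t x \<tau> (\<xi> + s *\<^sub>R e) = step t x \<tau> \<xi> + s *\<^sub>R (\<tau> *\<^sub>R (\<sigma> t x *v e))"
  by (simp add: step_def matrix_vector_right_distrib matrix_vector_mult_scaleR scaleR_right_distrib mult.commute)

lemma continuous_step: "continuous_on UNIV (step t x \<tau>)"
  unfolding step_def[abs_def] by (intro continuous_intros matrix_vector_mult_linear_continuous_on)

text \<open>Three errors of order \<open>\<tau>\<^sup>2\<close>: the time increment of
  \<open>u\<close> at the new point, the second-order remainder in space, and the gradient paired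
  with the drift. Of the first-order term only the gradient times \<open>\<sigma> \<xi>\<close>
  survives, and this is \<open>w t x \<bullet> \<xi>\<close>.\<close>

lemma u_step_taylor:
  "\<exists>C\<ge>0. \<forall>t\<in>{0..T}. \<forall>\<tau>\<in>{0..sqrt T}. \<forall>x \<xi>. t + \<tau>\<^sup>2 \<le> T \<longrightarrow>
     \<bar>u (t + \<tau>\<^sup>2) (step t x \<tau> \<xi>) - u t x - \<tau> * (w t x \<bullet> \<xi>)\<bar> \<le> C * \<tau>\<^sup>2 * weight x \<xi> ^ 3"
proof -
  obtain A where A: "A \<ge> 0" "\<And>t \<tau> x \<xi>. t \<in> {0..T} \<Longrightarrow> \<tau> \<in> {0..sqrt T} \<Longrightarrow>
      norm (step t x \<tau> \<xi> - x) \<le> A * \<tau> * weight x \<xi>"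
    using norm_step_diff_le by blast
  obtain A' where A': "A' \<ge> 0" "\<And>t \<tau> x \<xi>. t \<in> {0..T} \<Longrightarrow> \<tau> \<in> {0..sqrt T} \<Longrightarrow>
      1 + norm (step t x \<tau> \<xi>) \<le> A' * weight x \<xi>"
    using norm_step_le by blast
  obtain B where B: "B \<ge> 0" "\<And>t x y. t \<in> {0..T} \<Longrightarrow>
      \<bar>u t y - u t x - grad_x u t x \<bullet> (y - x)\<bar> \<le> B * (1 + norm x) * (norm (y - x))\<^sup>2"
    using u_taylor by blast
  obtain D where D: "D \<ge> 0" "\<And>s t x. s \<in> {0..T} \<Longrightarrow> t \<in> {0..T} \<Longrightarrow>
      \<bar>u s x - u t x\<bar> \<le> D * (1 + norm x) ^ 3 * \<bar>s - t\<bar>"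
    using u_time_lipschitz by blast
  obtain Cb where Cb: "Cb \<ge> 0" "\<And>t x. t \<in> {0..T} \<Longrightarrow> norm (b t x) \<le> Cb * (1 + norm x)"
    using b_growth by blast
  obtain Cg where Cg: "Cg \<ge> 0" "\<And>t x. t \<in> {0..T} \<Longrightarrow> norm (grad_x u t x) \<le> Cg * (1 + norm x)"
    using grad_growth by blast
  let ?C = "D * A' ^ 3 + B * A\<^sup>2 + Cg * Cb"
  have "\<bar>u (t + \<tau>\<^sup>2) (step t x \<tau> \<xi>) - u t x - \<tau> * (w t x \<bullet> \<xi>)\<bar> \<le> ?C * \<tau>\<^sup>2 * weight x \<xi> ^ 3"
    if t: "t \<in> {0..T}" and \<tau>: "\<tau> \<in> {0..sqrt T}" and t\<tau>: "t + \<tau>\<^sup>2 \<le> T" for t \<tau> x \<xi>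
  proof -
    define y where "y = step t x \<tau> \<xi>"
    define R where "R = weight x \<xi>"
    have R: "R \<ge> 1" "1 + norm x \<le> R" by (simp_all add: R_def weight_ge)
    have t': "t + \<tau>\<^sup>2 \<in> {0..T}" using t t\<tau> by auto
    have y1: "1 + norm y \<le> A' * R" and y2: "norm (y - x) \<le> A * \<tau> * R"
      using A(2)[OF t \<tau>] A'(2)[OF t \<tau>] by (simp_all add: y_def R_def)
    have "\<bar>u (t + \<tau>\<^sup>2) y - u t y\<bar> \<le> D * (1 + norm y) ^ 3 * \<tau>\<^sup>2"
      using D(2)[OF t' t, of y] by simp
    also have "\<dots> \<le> D * (A' * R) ^ 3 * \<tau>\<^sup>2"
      using D(1) y1 by (intro mult_right_mono mult_left_mono power_mono) auto
    finally have 1: "\<bar>u (t + \<tau>\<^sup>2) y - u t y\<bar> \<le> D * A' ^ 3 * \<tau>\<^sup>2 * R ^ 3"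
      by (simp add: power_mult_distrib mult_ac)
    have "\<bar>u t y - u t x - grad_x u t x \<bullet> (y - x)\<bar> \<le> B * (1 + norm x) * (norm (y - x))\<^sup>2"
      by (rule B(2)[OF t])
    also have "\<dots> \<le> B * R * (A * \<tau> * R)\<^sup>2"
      using B(1) R y2 by (intro mult_mono mult_left_mono power_mono) auto
    finally have 2: "\<bar>u t y - u t x - grad_x u t x \<bullet> (y - x)\<bar> \<le> B * A\<^sup>2 * \<tau>\<^sup>2 * R ^ 3"
      by (simp add: power_mult_distrib power2_eq_square power3_eq_cube mult_ac)
    have "\<bar>\<tau>\<^sup>2 * (grad_x u t x \<bullet> b t x)\<bar> \<le> \<tau>\<^sup>2 * ((Cg * R) * (Cb * R))"
      unfolding abs_mult using Cg Cb R t order_trans[OF Cg(2)[OF t] mult_left_mono[OF R(2) Cg(1)]]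
        order_trans[OF Cb(2)[OF t] mult_left_mono[OF R(2) Cb(1)]]
      by (intro mult_mono order_trans[OF Cauchy_Schwarz_ineq2]) auto
    also have "\<dots> = Cg * Cb * \<tau>\<^sup>2 * R\<^sup>2" by (simp add: power2_eq_square mult_ac)
    also have "\<dots> \<le> Cg * Cb * \<tau>\<^sup>2 * R ^ 3"
      using Cg(1) Cb(1) R by (intro mult_left_mono power_increasing) auto
    finally have 3: "\<bar>\<tau>\<^sup>2 * (grad_x u t x \<bullet> b t x)\<bar> \<le> Cg * Cb * \<tau>\<^sup>2 * R ^ 3" .
    have "grad_x u t x \<bullet> (y - x) = \<tau>\<^sup>2 * (grad_x u t x \<bullet> b t x) + \<tau> * (w t x \<bullet> \<xi>)"
      by (simp add: y_def step_def inner_add_right dot_lmul_matrix)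
    then have "\<bar>u (t + \<tau>\<^sup>2) y - u t x - \<tau> * (w t x \<bullet> \<xi>)\<bar>
        \<le> \<bar>u (t + \<tau>\<^sup>2) y - u t y\<bar> + \<bar>u t y - u t x - grad_x u t x \<bullet> (y - x)\<bar> + \<bar>\<tau>\<^sup>2 * (grad_x u t x \<bullet> b t x)\<bar>"
      by linarith
    also have "\<dots> \<le> ?C * \<tau>\<^sup>2 * R ^ 3" using 1 2 3 unfolding distrib_right by linarith
    finally show ?thesis by (simp add: y_def R_def)
  qed
  moreover have "?C \<ge> 0" using A A' B D Cb Cg by simp
  ultimately show ?thesis by blast
qed

lemma u_step_increment:
  "\<exists>C\<ge>0. \<forall>t\<in>{0..T}. \<forall>\<tau>\<in>{0..sqrt T}. \<forall>x \<xi>. t + \<tau>\<^sup>2 \<le> T \<longrightarrow>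
     \<bar>u (t + \<tau>\<^sup>2) (step t x \<tau> \<xi>) - u t x\<bar> \<le> C * \<tau> * weight x \<xi> ^ 3"
proof -
  obtain A where A: "A \<ge> 0" "\<And>t \<tau> x \<xi>. t \<in> {0..T} \<Longrightarrow> \<tau> \<in> {0..sqrt T} \<Longrightarrow> t + \<tau>\<^sup>2 \<le> T \<Longrightarrow>
      \<bar>u (t + \<tau>\<^sup>2) (step t x \<tau> \<xi>) - u t x - \<tau> * (w t x \<bullet> \<xi>)\<bar> \<le> A * \<tau>\<^sup>2 * weight x \<xi> ^ 3"
    using u_step_taylor by blast
  obtain Cw where Cw: "Cw \<ge> 0" "\<And>t x. t \<in> {0..T} \<Longrightarrow> norm (w t x) \<le> Cw * (1 + norm x)"
    using w_growth by blast
  have "\<bar>u (t + \<tau>\<^sup>2) (step t x \<tau> \<xi>) - u t x\<bar> \<le> (A * sqrt T + Cw) * \<tau> * weight x \<xi> ^ 3"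
    if t: "t \<in> {0..T}" and \<tau>: "\<tau> \<in> {0..sqrt T}" and t\<tau>: "t + \<tau>\<^sup>2 \<le> T" for t \<tau> x \<xi>
  proof -
    have "\<bar>w t x \<bullet> \<xi>\<bar> \<le> (Cw * (1 + norm x)) * (1 + norm \<xi>)"
      using Cw t by (intro order_trans[OF Cauchy_Schwarz_ineq2] mult_mono) auto
    also have "\<dots> \<le> Cw * weight x \<xi> ^ 3"
      using mult_left_mono[OF weight_mono[of 1 3 x \<xi>] Cw(1)] by (simp add: mult.assoc)
    finally have "\<bar>\<tau> * (w t x \<bullet> \<xi>)\<bar> \<le> \<tau> * (Cw * weight x \<xi> ^ 3)"
      unfolding abs_mult using \<tau> by (intro mult_mono) auto
    moreover have "A * \<tau>\<^sup>2 * weight x \<xi> ^ 3 \<le> A * (sqrt T * \<tau>) * weight x \<xi> ^ 3"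
      using A(1) \<tau> by (intro mult_right_mono mult_left_mono) (auto simp: power2_eq_square mult_right_mono)
    ultimately have "\<bar>u (t + \<tau>\<^sup>2) (step t x \<tau> \<xi>) - u t x\<bar>
        \<le> A * (sqrt T * \<tau>) * weight x \<xi> ^ 3 + \<tau> * (Cw * weight x \<xi> ^ 3)"
      using A(2)[OF t \<tau> t\<tau>, of x \<xi>] by linarith
    then show ?thesis by (simp add: algebra_simps)
  qed
  moreover have "A * sqrt T + Cw \<ge> 0" using A Cw T_pos by simp
  ultimately show ?thesis by blast
qed


section \<open>Weak error of one step\<close>

text \<open>The parabolic operator of the Euler scheme inside one step: coefficients frozen at the
  start \<open>(t, x)\<close>, derivatives of \<open>u\<close> at the current point
  \<open>(s, y)\<close>.\<close>

abbreviation generator :: "real \<Rightarrow> real^'d \<Rightarrow> real \<Rightarrow> real^'d \<Rightarrow> real" where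
  "generator t x s y \<equiv> time_deriv T u s y + b t x \<bullet> grad_x u s y
     + 1/2 * trace (hess_x u s y ** (\<sigma> t x ** transpose (\<sigma> t x)))"

text \<open>Subtracting the PDE at \<open>(s, y)\<close> cancels the time derivative and leaves
  differences of \<open>b\<close>, of the diffusion matrix and of \<open>f\<close> between
  \<open>(t, x)\<close> and \<open>(s, y)\<close>, all of order \<tau>. The Hessian is never
  compared between two points. The fourth power stems from the time regularity of \<open>w\<close>;
  the strict inequality keeps \<open>s\<close> below \<open>T\<close>, where the PDE holds.\<close>

lemma generator_bound:
  "\<exists>C\<ge>0. \<forall>t\<in>{0..T}. \<forall>\<tau>\<in>{0..sqrt T}. \<forall>x \<xi>. t + \<tau>\<^sup>2 < T \<longrightarrow>
     \<bar>generator t x (t + \<tau>\<^sup>2) (step t x \<tau> \<xi>) + f t x (u t x) (w t x)\<bar> \<le> C * \<tau> * weight x \<xi> ^ 4"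
proof -
  obtain A where A: "A \<ge> 0" "\<And>t \<tau> x \<xi>. t \<in> {0..T} \<Longrightarrow> \<tau> \<in> {0..sqrt T} \<Longrightarrow>
      norm (step t x \<tau> \<xi> - x) \<le> A * \<tau> * weight x \<xi>"
    using norm_step_diff_le by blast
  obtain A' where A': "A' \<ge> 0" "\<And>t \<tau> x \<xi>. t \<in> {0..T} \<Longrightarrow> \<tau> \<in> {0..sqrt T} \<Longrightarrow>
      1 + norm (step t x \<tau> \<xi>) \<le> A' * weight x \<xi>"
    using norm_step_le by blast
  obtain Cu where Cu: "Cu \<ge> 0" "\<And>t \<tau> x \<xi>. t \<in> {0..T} \<Longrightarrow> \<tau> \<in> {0..sqrt T} \<Longrightarrow> t + \<tau>\<^sup>2 \<le> T \<Longrightarrow>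
      \<bar>u (t + \<tau>\<^sup>2) (step t x \<tau> \<xi>) - u t x\<bar> \<le> Cu * \<tau> * weight x \<xi> ^ 3"
    using u_step_increment by blast
  obtain Cs where Cs: "Cs \<ge> 0" "\<And>t x. t \<in> {0..T} \<Longrightarrow> norm (\<sigma> t x) \<le> Cs * (1 + norm x)"
    using \<sigma>_growth by blast
  obtain Cg where Cg: "Cg \<ge> 0" "\<And>t x. t \<in> {0..T} \<Longrightarrow> norm (grad_x u t x) \<le> Cg * (1 + norm x)"
    using grad_growth by blast
  obtain Ch where Ch: "Ch \<ge> 0" "\<And>t x. t \<in> {0..T} \<Longrightarrow> norm (hess_x u t x) \<le> Ch * (1 + norm x)"
    using hess_growth by blast
  obtain Cw where Cw: "Cw \<ge> 0" "\<And>s t x. s \<in> {0..T} \<Longrightarrow> t \<in> {0..T} \<Longrightarrow>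
      norm (w s x - w t x) \<le> Cw * (1 + norm x) ^ 4 * sqrt \<bar>s - t\<bar>"
    using w_time_hoelder by blast
  let ?Cb = "K * (1 + A) * (Cg * A')" and ?Cs = "(Ch * A') * (K * (1 + A) * (Cs + Cs * A'))"
    and ?Cf = "K * (1 + A + Cu + (Cw * A' ^ 4 + L * A))"
  have "\<bar>generator t x (t + \<tau>\<^sup>2) (step t x \<tau> \<xi>) + f t x (u t x) (w t x)\<bar> \<le> (?Cb + ?Cs + ?Cf) * \<tau> * weight x \<xi> ^ 4"
    if t: "t \<in> {0..T}" and \<tau>: "\<tau> \<in> {0..sqrt T}" and t\<tau>: "t + \<tau>\<^sup>2 < T" for t \<tau> x \<xi>
  proof -
    define y where "y = step t x \<tau> \<xi>"
    define R where "R = weight x \<xi>"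
    define s where "s = t + \<tau>\<^sup>2"
    have R: "R \<ge> 1" "1 + norm x \<le> R" by (simp_all add: R_def weight_ge)
    have Rpow: "R \<le> R ^ 4" "R\<^sup>2 \<le> R ^ 4" "R ^ 3 \<le> R ^ 4" "1 \<le> R ^ 4"
      using R by (auto intro: self_le_power power_increasing)
    have s: "s \<in> {0..T}" "s \<in> {0..<T}" and st: "sqrt \<bar>s - t\<bar> = \<tau>" using t t\<tau> \<tau> by (auto simp: s_def)
    have \<tau>0: "\<tau> \<ge> 0" using \<tau> by simp
    have y1: "1 + norm y \<le> A' * R" and y2: "norm (y - x) \<le> A * \<tau> * R"
      using A(2)[OF t \<tau>] A'(2)[OF t \<tau>] by (simp_all add: y_def R_def)
    have y3: "\<tau> + norm (y - x) \<le> (1 + A) * \<tau> * R"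
      using y2 mult_left_mono[OF R(1) \<tau>0] by (simp add: algebra_simps)
    have c: "norm (b t x - b s y) \<le> K * ((1 + A) * \<tau> * R)" "norm (\<sigma> t x - \<sigma> s y) \<le> K * ((1 + A) * \<tau> * R)"
    proof -
      have *: "K * (sqrt \<bar>t - s\<bar> + norm (x - y)) \<le> K * ((1 + A) * \<tau> * R)"
        using y3 st K_nonneg by (intro mult_left_mono) (simp_all add: abs_minus_commute norm_minus_commute)
      show "norm (b t x - b s y) \<le> K * ((1 + A) * \<tau> * R)" "norm (\<sigma> t x - \<sigma> s y) \<le> K * ((1 + A) * \<tau> * R)"
        using b_bound[OF t s(1), of x y] \<sigma>_bound[OF t s(1), of x y] * by linarith+
    qed
    have gy: "norm (grad_x u s y) \<le> Cg * A' * R" and hy: "norm (hess_x u s y) \<le> Ch * A' * R"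
      and sy: "norm (\<sigma> s y) \<le> Cs * A' * R" and sx: "norm (\<sigma> t x) \<le> Cs * R"
      using order_trans[OF Cg(2)[OF s(1)] mult_left_mono[OF y1 Cg(1)]]
        order_trans[OF Ch(2)[OF s(1)] mult_left_mono[OF y1 Ch(1)]]
        order_trans[OF Cs(2)[OF s(1)] mult_left_mono[OF y1 Cs(1)]]
        order_trans[OF Cs(2)[OF t] mult_left_mono[OF R(2) Cs(1)]]
      by (simp_all add: mult.assoc)
    have 1: "\<bar>(b t x - b s y) \<bullet> grad_x u s y\<bar> \<le> ?Cb * \<tau> * R ^ 4"
    proof -
      have "\<bar>(b t x - b s y) \<bullet> grad_x u s y\<bar> \<le> (K * ((1 + A) * \<tau> * R)) * (Cg * A' * R)"
        using c gy K_nonneg A(1) \<tau>0 R by (intro order_trans[OF Cauchy_Schwarz_ineq2] mult_mono) auto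
      also have "\<dots> = ?Cb * \<tau> * R\<^sup>2" by (simp add: power2_eq_square mult_ac)
      also have "\<dots> \<le> ?Cb * \<tau> * R ^ 4"
        using K_nonneg A(1) Cg(1) A'(1) \<tau>0 Rpow by (intro mult_left_mono) auto
      finally show ?thesis .
    qed
    let ?S = "\<sigma> t x ** transpose (\<sigma> t x)" and ?S' = "\<sigma> s y ** transpose (\<sigma> s y)"
    have 2: "\<bar>trace (hess_x u s y ** ?S) - trace (hess_x u s y ** ?S')\<bar> \<le> ?Cs * \<tau> * R ^ 4"
    proof -
      have "?S - ?S' = (\<sigma> t x - \<sigma> s y) ** transpose (\<sigma> t x) + \<sigma> s y ** transpose (\<sigma> t x - \<sigma> s y)"
        by (rule mult_transpose_diff)
      also have "norm \<dots> \<le> norm (\<sigma> t x - \<sigma> s y) * norm (\<sigma> t x) + norm (\<sigma> s y) * norm (\<sigma> t x - \<sigma> s y)"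
        by (intro order_trans[OF norm_triangle_ineq] add_mono order_trans[OF norm_matrix_mult_le])
          (simp_all add: norm_transpose)
      also have "\<dots> \<le> (K * ((1 + A) * \<tau> * R)) * (Cs * R) + (Cs * A' * R) * (K * ((1 + A) * \<tau> * R))"
        using c sx sy K_nonneg A(1) A'(1) Cs(1) \<tau>0 R by (intro add_mono mult_mono) auto
      finally have S: "norm (?S - ?S') \<le> K * (1 + A) * (Cs + Cs * A') * \<tau> * R\<^sup>2"
        by (simp add: power2_eq_square algebra_simps)
      have "trace (hess_x u s y ** ?S) - trace (hess_x u s y ** ?S') = trace (hess_x u s y ** (?S - ?S'))"
        by (simp add: trace_mult_diff)
      also have "\<bar>\<dots>\<bar> \<le> (Ch * A' * R) * (K * (1 + A) * (Cs + Cs * A') * \<tau> * R\<^sup>2)"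
        using S hy Ch(1) A'(1) R by (intro order_trans[OF abs_trace_mult_le] mult_mono) auto
      also have "\<dots> = ?Cs * \<tau> * R ^ 3" by (simp add: power2_eq_square power3_eq_cube mult_ac)
      also have "\<dots> \<le> ?Cs * \<tau> * R ^ 4"
        using K_nonneg A(1) Cs(1) Ch(1) A'(1) \<tau>0 Rpow by (intro mult_left_mono) auto
      finally show ?thesis .
    qed
    have 3: "\<bar>f t x (u t x) (w t x) - f s y (u s y) (w s y)\<bar> \<le> ?Cf * \<tau> * R ^ 4"
    proof -
      have "norm (w t x - w s y) \<le> norm (w s y - w t y) + norm (w t y - w t x)"
        using norm_triangle_ineq4[of "w s y - w t y" "w t x - w t y"] by (simp add: norm_minus_commute)
      also have "norm (w s y - w t y) \<le> Cw * (A' * R) ^ 4 * \<tau>"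
      proof (rule order_trans[OF Cw(2)[OF s(1) t, of y]])
        show "Cw * (1 + norm y) ^ 4 * sqrt \<bar>s - t\<bar> \<le> Cw * (A' * R) ^ 4 * \<tau>"
          unfolding st using Cw(1) \<tau>0 y1 by (intro mult_right_mono mult_left_mono power_mono) auto
      qed
      also have "norm (w t y - w t x) \<le> L * (A * \<tau> * R)"
        using lipschitz_onD[OF L[OF t], of y x] mult_left_mono[OF y2 L_nonneg] by (simp add: dist_norm)
      finally have w: "norm (w t x - w s y) \<le> Cw * A' ^ 4 * (\<tau> * R ^ 4) + L * A * (\<tau> * R)"
        by (simp add: power_mult_distrib mult_ac)
      have "\<bar>u t x - u s y\<bar> \<le> Cu * (\<tau> * R ^ 3)"
        using Cu(2)[OF t \<tau>, of x \<xi>] t\<tau> by (simp add: y_def s_def R_def abs_minus_commute mult.assoc)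
      then have "sqrt \<bar>t - s\<bar> + norm (x - y) + \<bar>u t x - u s y\<bar> + norm (w t x - w s y)
          \<le> \<tau> + A * (\<tau> * R) + Cu * (\<tau> * R ^ 3) + (Cw * A' ^ 4 * (\<tau> * R ^ 4) + L * A * (\<tau> * R))"
        using w y2 st by (simp add: abs_minus_commute norm_minus_commute mult.assoc)
      also have "\<dots> \<le> \<tau> * R ^ 4 + A * (\<tau> * R ^ 4) + Cu * (\<tau> * R ^ 4) + (Cw * A' ^ 4 * (\<tau> * R ^ 4) + L * A * (\<tau> * R ^ 4))"
        using Rpow \<tau>0 A(1) Cu(1) L_nonneg mult_left_mono[OF Rpow(4) \<tau>0]
        by (intro add_mono mult_left_mono order_refl) auto
      finally have "sqrt \<bar>t - s\<bar> + norm (x - y) + \<bar>u t x - u s y\<bar> + norm (w t x - w s y)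
          \<le> (1 + A + Cu + (Cw * A' ^ 4 + L * A)) * (\<tau> * R ^ 4)"
        unfolding distrib_right mult_1_left .
      from order_trans[OF f_bound[OF t s(1)] mult_left_mono[OF this K_nonneg]]
      show ?thesis by (simp add: mult.assoc)
    qed
    have "generator t x s y + f t x (u t x) (w t x)
        = (b t x - b s y) \<bullet> grad_x u s y + 1/2 * (trace (hess_x u s y ** ?S) - trace (hess_x u s y ** ?S'))
          + (f t x (u t x) (w t x) - f s y (u s y) (w s y))"
      using pde_eq[OF s(2), of y] by (simp add: inner_diff_left algebra_simps)
    moreover have half: "\<bar>p + 1/2 * q + r\<bar> \<le> a + c + d" if "\<bar>p\<bar> \<le> a" "\<bar>q\<bar> \<le> c" "\<bar>r\<bar> \<le> d" for p q r a c d :: real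
      using that by linarith
    ultimately have "\<bar>generator t x s y + f t x (u t x) (w t x)\<bar> \<le> ?Cb * \<tau> * R ^ 4 + ?Cs * \<tau> * R ^ 4 + ?Cf * \<tau> * R ^ 4"
      using 1 2 3 half by metis
    then show ?thesis by (simp add: distrib_right y_def s_def R_def)
  qed
  moreover have "?Cb + ?Cs + ?Cf \<ge> 0" using K_nonneg L_nonneg A A' Cu Cs Cg Ch Cw by simp
  ultimately show ?thesis by blast
qed

text \<open>Joint differentiability from a time derivative at the point and a jointly continuous
  space derivative. The latter is written as \<open>blinfun_inner_right\<close> of the gradient, so
  that its continuity is that of an operator-valued map. Interior times make the strip open and the
  derivative two-sided.\<close>

lemma has_derivative_u:
  assumes t: "t \<in> {0<..<T}"
  shows "((\<lambda>(t, x). u t x) has_derivative (\<lambda>(r, v). r * time_deriv T u t x + grad_x u t x \<bullet> v)) (at (t, x))"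
proof -
  have 1: "((\<lambda>s. u s x) has_derivative (\<lambda>r. r * time_deriv T u t x)) (at t within {0<..<T})"
  proof -
    have "((\<lambda>s. u s x) has_vector_derivative time_deriv T u t x) (at t within {0<..<T})"
      by (rule has_vector_derivative_within_subset[OF time_deriv]) (use t in auto)
    then show ?thesis by (simp add: has_vector_derivative_def)
  qed
  have 2: "(u s has_derivative blinfun_apply (blinfun_inner_right (grad_x u s y))) (at y within UNIV)"
    if "s \<in> {0<..<T}" "y \<in> UNIV" for s y
    unfolding blinfun_inner_right.rep_eq by (rule grad) (use that in auto)
  have 3: "continuous (at (t, x) within {0<..<T} \<times> UNIV) (\<lambda>(s, y). blinfun_inner_right (grad_x u s y))"
  proof -
    have "continuous_on ({0<..<T} \<times> UNIV) (\<lambda>p. blinfun_inner_right ((\<lambda>(s, y). grad_x u s y) p))"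
      by (intro bounded_linear.continuous_on[OF bounded_linear_blinfun_inner_right]
          continuous_on_subset[OF continuous_grad]) auto
    moreover have "(t, x) \<in> {0<..<T} \<times> UNIV" using t by simp
    ultimately show ?thesis
      unfolding continuous_on_eq_continuous_within by (auto simp only: case_prod_unfold)
  qed
  have "((\<lambda>(t, x). u t x) has_derivative (\<lambda>(r, v). r * time_deriv T u t x + grad_x u t x \<bullet> v))
      (at (t, x) within {0<..<T} \<times> UNIV)"
    using has_derivative_partialsI[OF 1 2 3 UNIV_I convex_UNIV] unfolding blinfun_inner_right.rep_eq .
  moreover have "(t, x) \<in> {0<..<T} \<times> UNIV" "open ({0<..<T} \<times> (UNIV :: (real^'d) set))"
    using t by (auto intro: open_Times)
  ultimately show ?thesis by (simp only: at_within_open)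
qed

lemma u_step_derivative:
  assumes "t \<ge> 0" "\<tau> > 0" "t + \<tau>\<^sup>2 < T"
  shows "((\<lambda>\<tau>. u (t + \<tau>\<^sup>2) (step t x \<tau> \<xi>)) has_real_derivative
     2 * \<tau> * time_deriv T u (t + \<tau>\<^sup>2) (step t x \<tau> \<xi>)
     + grad_x u (t + \<tau>\<^sup>2) (step t x \<tau> \<xi>) \<bullet> ((2 * \<tau>) *\<^sub>R b t x + \<sigma> t x *v \<xi>)) (at \<tau>)"
proof -
  have s: "t + \<tau>\<^sup>2 \<in> {0<..<T}" using assms by (auto intro: add_nonneg_pos)
  have "((\<lambda>\<tau>. (t + \<tau>\<^sup>2, step t x \<tau> \<xi>)) has_derivative (\<lambda>r. (r * (2 * \<tau>), r *\<^sub>R ((2 * \<tau>) *\<^sub>R b t x + \<sigma> t x *v \<xi>)))) (at \<tau>)"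
    unfolding step_def by (auto intro!: derivative_eq_intros simp: algebra_simps)
  from has_derivative_compose[OF this has_derivative_u[OF s, of "step t x \<tau> \<xi>"]]
  show ?thesis
    unfolding has_field_derivative_def prod.case inner_scaleR_right
    by (rule has_derivative_eq_rhs) (auto simp only: algebra_simps)
qed


lemma gaussian_weight_integrable: "integrable gaussian (\<lambda>\<xi>. weight x \<xi> ^ k)"
  using integrable_gaussian_power[where 'd = 'd, of k] by (simp add: power_mult_distrib)

lemma gaussian_weight_bound:
  fixes F :: "real^'d \<Rightarrow> real"
  assumes "F \<in> borel_measurable borel" "\<And>\<xi>. \<bar>F \<xi>\<bar> \<le> C * weight x \<xi> ^ k"
  shows "integrable gaussian F"
    and "\<bar>\<integral>\<xi>. F \<xi> \<partial>gaussian\<bar> \<le> C * (\<integral>\<xi>. (1 + norm \<xi>) ^ k \<partial>(gaussian :: (real^'d) measure)) * (1 + norm x) ^ k"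
proof -
  show *: "integrable gaussian F"
    by (rule integrable_gaussian_bound[of _ "C * (1 + norm x) ^ k" k])
      (use assms in \<open>simp_all add: power_mult_distrib mult.assoc\<close>)
  have "\<bar>\<integral>\<xi>. F \<xi> \<partial>gaussian\<bar> \<le> (\<integral>\<xi>. C * weight x \<xi> ^ k \<partial>gaussian)"
    using * assms(2) by (intro integral_abs_bound[THEN order_trans] integral_mono)
      (auto simp: gaussian_weight_integrable)
  then show "\<bar>\<integral>\<xi>. F \<xi> \<partial>gaussian\<bar> \<le> C * (\<integral>\<xi>. (1 + norm \<xi>) ^ k \<partial>(gaussian :: (real^'d) measure)) * (1 + norm x) ^ k"
    by (simp add: power_mult_distrib mult_ac)
qed

lemma measurable_comp_step:
  fixes F :: "real^'d \<Rightarrow> 'x::topological_space"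
  assumes "continuous_on UNIV F"
  shows "(\<lambda>\<xi>. F (step t x \<tau> \<xi>)) \<in> borel_measurable borel"
  using continuous_on_compose2[OF assms continuous_step] by (intro borel_measurable_continuous_onI) auto

text \<open>The source of the second-order term usually supplied by the Ito formula: Stein's
  identity is applied, for every coordinate \<open>j\<close>, to the gradient paired with the column
  \<open>\<sigma> t x *v axis j 1\<close>, and the resulting Hessian terms sum to \<tau> times the
  trace.\<close>

lemma gaussian_grad_inner:
  assumes t: "t \<in> {0..T}" and \<tau>: "\<tau> \<in> {0..sqrt T}" and s: "s \<in> {0..T}"
  shows "integrable gaussian (\<lambda>\<xi>. grad_x u s (step t x \<tau> \<xi>) \<bullet> (\<sigma> t x *v \<xi>))"
    and "integrable gaussian (\<lambda>\<xi>. trace (hess_x u s (step t x \<tau> \<xi>) ** (\<sigma> t x ** transpose (\<sigma> t x))))"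
    and "(\<integral>\<xi>. grad_x u s (step t x \<tau> \<xi>) \<bullet> (\<sigma> t x *v \<xi>) \<partial>gaussian)
      = (\<integral>\<xi>. \<tau> * trace (hess_x u s (step t x \<tau> \<xi>) ** (\<sigma> t x ** transpose (\<sigma> t x))) \<partial>gaussian)"
proof -
  obtain A where A: "A \<ge> 0" "\<And>t \<tau> x \<xi>. t \<in> {0..T} \<Longrightarrow> \<tau> \<in> {0..sqrt T} \<Longrightarrow>
      1 + norm (step t x \<tau> \<xi>) \<le> A * weight x \<xi>"
    using norm_step_le by blast
  obtain Cg where Cg: "Cg \<ge> 0" "\<And>t x. t \<in> {0..T} \<Longrightarrow> norm (grad_x u t x) \<le> Cg * (1 + norm x)"
    using grad_growth by blast
  obtain Ch where Ch: "Ch \<ge> 0" "\<And>t x. t \<in> {0..T} \<Longrightarrow> norm (hess_x u t x) \<le> Ch * (1 + norm x)"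
    using hess_growth by blast
  let ?e = "\<lambda>j. \<sigma> t x *v axis j (1::real)"
  let ?p = "\<lambda>j \<xi>. grad_x u s (step t x \<tau> \<xi>) \<bullet> ?e j"
  let ?p' = "\<lambda>j \<xi>. (hess_x u s (step t x \<tau> \<xi>) *v (\<tau> *\<^sub>R ?e j)) \<bullet> ?e j"
  have gb: "norm (grad_x u s (step t x \<tau> \<xi>)) \<le> Cg * A * weight x \<xi>" for \<xi>
    using order_trans[OF Cg(2)[OF s] mult_left_mono[OF A(2)[OF t \<tau>] Cg(1)]] by (simp add: mult.assoc)
  have hb: "norm (hess_x u s (step t x \<tau> \<xi>)) \<le> Ch * A * weight x \<xi>" for \<xi>
    using order_trans[OF Ch(2)[OF s] mult_left_mono[OF A(2)[OF t \<tau>] Ch(1)]] by (simp add: mult.assoc)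
  have cp: "continuous_on UNIV (?p j)" "continuous_on UNIV (?p' j)" for j
    by (intro continuous_intros continuous_on_compose2[OF continuous_slices(3)[OF s] continuous_step]
        continuous_on_compose2[OF continuous_slices(4)[OF s] continuous_step]; auto)+
  have bp: "\<bar>?p j \<xi>\<bar> \<le> Cg * A * norm (?e j) * weight x \<xi> ^ 1" for j \<xi>
    using order_trans[OF Cauchy_Schwarz_ineq2 mult_right_mono[OF gb[of \<xi>]], of "?e j"] by (simp add: mult_ac)
  have bp': "\<bar>?p' j \<xi>\<bar> \<le> Ch * A * \<tau> * norm (?e j) * norm (?e j) * weight x \<xi> ^ 1" for j \<xi>
  proof -
    have "\<bar>?p' j \<xi>\<bar> \<le> norm (hess_x u s (step t x \<tau> \<xi>)) * norm (\<tau> *\<^sub>R ?e j) * norm (?e j)"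
      by (intro order_trans[OF Cauchy_Schwarz_ineq2] mult_right_mono norm_matrix_vector_mult_le) simp
    also have "\<dots> \<le> (Ch * A * weight x \<xi>) * norm (\<tau> *\<^sub>R ?e j) * norm (?e j)"
      by (intro mult_right_mono hb) auto
    finally show ?thesis using \<tau> by (simp add: mult_ac)
  qed
  have mp: "?p j \<in> borel_measurable borel" "?p' j \<in> borel_measurable borel" for j
    using cp by (auto intro: borel_measurable_continuous_onI)
  have ip': "integrable gaussian (?p' j)" for j
    by (rule gaussian_weight_bound(1)[OF mp(2) bp'])
  have ibp: "(\<integral>\<xi>. ?p j \<xi> * (\<xi> \<bullet> axis j 1) \<partial>gaussian) = (\<integral>\<xi>. ?p' j \<xi> \<partial>gaussian)" for j
  proof (rule gaussian_integration_by_parts[OF cp])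
    \<comment> \<open>Stein's identity asks for one constant bounding both the function and its
      derivative, hence the maximum.\<close>
    let ?C = "max (Cg * A * norm (?e j)) (Ch * A * \<tau> * norm (?e j) * norm (?e j)) * (1 + norm x)"
    show "\<bar>?p j \<xi>\<bar> \<le> ?C * (1 + norm \<xi>) ^ 1" for \<xi>
    proof -
      have "\<bar>?p j \<xi>\<bar> \<le> max (Cg * A * norm (?e j)) (Ch * A * \<tau> * norm (?e j) * norm (?e j)) * weight x \<xi> ^ 1"
        by (rule order_trans[OF bp mult_right_mono[OF max.cobounded1]]) simp
      then show ?thesis by (simp only: power_one_right mult.assoc)
    qed
    show "\<bar>?p' j \<xi>\<bar> \<le> ?C * (1 + norm \<xi>) ^ 1" for \<xi>
    proof -
      have "\<bar>?p' j \<xi>\<bar> \<le> max (Cg * A * norm (?e j)) (Ch * A * \<tau> * norm (?e j) * norm (?e j)) * weight x \<xi> ^ 1"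
        by (rule order_trans[OF bp' mult_right_mono[OF max.cobounded2]]) simp
      then show ?thesis by (simp only: power_one_right mult.assoc)
    qed
    fix \<xi> r
    have "((\<lambda>r. step t x \<tau> (\<xi> + r *\<^sub>R axis j 1)) has_derivative (\<lambda>h. h *\<^sub>R (\<tau> *\<^sub>R ?e j))) (at r)"
      unfolding step_shift by (auto intro!: derivative_eq_intros)
    from has_derivative_inner_left[OF has_derivative_compose[OF this hess[OF s]], of "?e j"]
    show "((\<lambda>r. ?p j (\<xi> + r *\<^sub>R axis j 1)) has_real_derivative ?p' j (\<xi> + r *\<^sub>R axis j 1)) (at r)"
      unfolding has_field_derivative_def
      by (rule has_derivative_eq_rhs) (simp add: fun_eq_iff matrix_vector_mult_scaleR)
  qed
  have ipe: "integrable gaussian (\<lambda>\<xi>. ?p j \<xi> * (\<xi> \<bullet> axis j 1))" for j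
  proof (rule gaussian_weight_bound(1))
    show "(\<lambda>\<xi>. ?p j \<xi> * (\<xi> \<bullet> axis j 1)) \<in> borel_measurable borel"
      using mp(1)[of j] by measurable
    fix \<xi> :: "real^'d"
    have "\<bar>\<xi> \<bullet> axis j 1\<bar> \<le> weight x \<xi>"
      using Cauchy_Schwarz_ineq2[of \<xi> "axis j 1"] weight_ge(3)[of \<xi> x] by simp
    then have "\<bar>?p j \<xi> * (\<xi> \<bullet> axis j 1)\<bar> \<le> (Cg * A * norm (?e j) * weight x \<xi> ^ 1) * weight x \<xi>"
      unfolding abs_mult using bp[where j = j and \<xi> = \<xi>] by (intro mult_mono) auto
    then show "\<bar>?p j \<xi> * (\<xi> \<bullet> axis j 1)\<bar> \<le> (Cg * A * norm (?e j)) * weight x \<xi> ^ 2"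
      by (simp add: power2_eq_square mult.assoc)
  qed
  have e1: "grad_x u s (step t x \<tau> \<xi>) \<bullet> (\<sigma> t x *v \<xi>) = (\<Sum>j\<in>UNIV. ?p j \<xi> * (\<xi> \<bullet> axis j 1))" for \<xi>
    by (rule inner_matrix_vector_sum)
  have e2: "(\<Sum>j\<in>UNIV. ?p' j \<xi>) = \<tau> * trace (hess_x u s (step t x \<tau> \<xi>) ** (\<sigma> t x ** transpose (\<sigma> t x)))" for \<xi>
    unfolding sum_columns_trace[symmetric] sum_distrib_left by (simp add: matrix_vector_mult_scaleR)
  show "integrable gaussian (\<lambda>\<xi>. grad_x u s (step t x \<tau> \<xi>) \<bullet> (\<sigma> t x *v \<xi>))"
    unfolding e1 by (intro Bochner_Integration.integrable_sum ipe)
  show "integrable gaussian (\<lambda>\<xi>. trace (hess_x u s (step t x \<tau> \<xi>) ** (\<sigma> t x ** transpose (\<sigma> t x))))"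
  proof (rule gaussian_weight_bound(1)[where k = 1])
    have "continuous_on UNIV (\<lambda>\<xi>. trace (hess_x u s (step t x \<tau> \<xi>) ** (\<sigma> t x ** transpose (\<sigma> t x))))"
      unfolding sum_columns_trace[symmetric]
      by (intro continuous_intros continuous_on_compose2[OF continuous_slices(4)[OF s] continuous_step]) auto
    then show "(\<lambda>\<xi>. trace (hess_x u s (step t x \<tau> \<xi>) ** (\<sigma> t x ** transpose (\<sigma> t x)))) \<in> borel_measurable borel"
      by (rule borel_measurable_continuous_onI)
    show "\<bar>trace (hess_x u s (step t x \<tau> \<xi>) ** (\<sigma> t x ** transpose (\<sigma> t x)))\<bar>
        \<le> (Ch * A * norm (\<sigma> t x ** transpose (\<sigma> t x))) * weight x \<xi> ^ 1" for \<xi>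
      using order_trans[OF abs_trace_mult_le mult_right_mono[OF hb[of \<xi>]], of "\<sigma> t x ** transpose (\<sigma> t x)"]
      by (simp add: mult_ac)
  qed
  show "(\<integral>\<xi>. grad_x u s (step t x \<tau> \<xi>) \<bullet> (\<sigma> t x *v \<xi>) \<partial>gaussian)
      = (\<integral>\<xi>. \<tau> * trace (hess_x u s (step t x \<tau> \<xi>) ** (\<sigma> t x ** transpose (\<sigma> t x))) \<partial>gaussian)"
    unfolding e1 e2[symmetric] using ipe ip' ibp by simp
qed

lemma u_step_integrable:
  assumes t: "t \<in> {0..T}" and \<tau>: "\<tau> \<in> {0..sqrt T}" and t\<tau>: "t + \<tau>\<^sup>2 \<le> T"
  shows "integrable gaussian (\<lambda>\<xi>. u (t + \<tau>\<^sup>2) (step t x \<tau> \<xi>))"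
proof -
  obtain C where C: "C \<ge> 0" "\<And>t x \<tau> \<xi>. t \<in> {0..T} \<Longrightarrow> \<tau> \<in> {0..sqrt T} \<Longrightarrow> t + \<tau>\<^sup>2 \<le> T \<Longrightarrow>
      \<bar>u (t + \<tau>\<^sup>2) (step t x \<tau> \<xi>) - u t x\<bar> \<le> C * \<tau> * weight x \<xi> ^ 3"
    using u_step_increment by blast
  have s: "t + \<tau>\<^sup>2 \<in> {0..T}" using t t\<tau> by auto
  show ?thesis
  proof (rule gaussian_weight_bound(1)[where k = 3])
    show "(\<lambda>\<xi>. u (t + \<tau>\<^sup>2) (step t x \<tau> \<xi>)) \<in> borel_measurable borel"
      by (rule measurable_comp_step[OF continuous_slices(1)[OF s]])
    fix \<xi> :: "real^'d"
    have "\<bar>u t x\<bar> \<le> \<bar>u t x\<bar> * weight x \<xi> ^ 3"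
      using weight_mono[of 0 3 x \<xi>] by (simp add: mult_le_cancel_left1)
    then show "\<bar>u (t + \<tau>\<^sup>2) (step t x \<tau> \<xi>)\<bar> \<le> (\<bar>u t x\<bar> + C * \<tau>) * weight x \<xi> ^ 3"
      using C(2)[OF t \<tau> t\<tau>, of x \<xi>] unfolding distrib_right by linarith
  qed
qed

lemma weak_error:
  "\<exists>C\<ge>0. \<forall>t\<ge>0. \<forall>\<tau>\<ge>0. \<forall>x. t + \<tau>\<^sup>2 \<le> T \<longrightarrow>
     \<bar>(\<integral>\<xi>. u (t + \<tau>\<^sup>2) (step t x \<tau> \<xi>) \<partial>gaussian) - u t x + \<tau>\<^sup>2 * f t x (u t x) (w t x)\<bar>
       \<le> C * \<tau> ^ 3 * (1 + norm x) ^ 4"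
proof -
  obtain A where A: "A \<ge> 0" "\<And>t \<tau> x \<xi>. t \<in> {0..T} \<Longrightarrow> \<tau> \<in> {0..sqrt T} \<Longrightarrow>
      1 + norm (step t x \<tau> \<xi>) \<le> A * weight x \<xi>"
    using norm_step_le by blast
  obtain Cg where Cg: "Cg \<ge> 0" "\<And>t x. t \<in> {0..T} \<Longrightarrow> norm (grad_x u t x) \<le> Cg * (1 + norm x)"
    using grad_growth by blast
  obtain Ct where Ct: "Ct \<ge> 0" "\<And>t x. t \<in> {0..T} \<Longrightarrow> \<bar>time_deriv T u t x\<bar> \<le> Ct * (1 + norm x) ^ 3"
    using time_deriv_growth by blast
  obtain G where G: "G \<ge> 0" "\<And>t \<tau> x \<xi>. t \<in> {0..T} \<Longrightarrow> \<tau> \<in> {0..sqrt T} \<Longrightarrow> t + \<tau>\<^sup>2 < T \<Longrightarrow>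
     \<bar>generator t x (t + \<tau>\<^sup>2) (step t x \<tau> \<xi>) + f t x (u t x) (w t x)\<bar> \<le> G * \<tau> * weight x \<xi> ^ 4"
    using generator_bound by blast
  interpret gaussian: prob_space "gaussian :: (real^'d) measure" by (rule prob_space_gaussian)
  define m where "m = (\<integral>\<xi>. (1 + norm \<xi>) ^ 4 \<partial>(gaussian :: (real^'d) measure))"
  have m: "m \<ge> 0" unfolding m_def by simp
  have "\<bar>(\<integral>\<xi>. u (t + \<tau>\<^sup>2) (step t x \<tau> \<xi>) \<partial>gaussian) - u t x + \<tau>\<^sup>2 * f t x (u t x) (w t x)\<bar>
      \<le> (2 * G * m) * \<tau> ^ 3 * (1 + norm x) ^ 4"
    if t0: "t \<ge> 0" and \<tau>0: "\<tau> \<ge> 0" and t\<tau>: "t + \<tau>\<^sup>2 \<le> T" for t \<tau> x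
  proof -
    define f0 where "f0 = f t x (u t x) (w t x)"
    have t: "t \<in> {0..T}" using t0 t\<tau> by (smt (verit) atLeastAtMost_iff zero_le_power2)
    have r: "r \<in> {0..sqrt T}" "t + r\<^sup>2 \<le> T" "t + r\<^sup>2 \<in> {0..T}" if "r \<in> {0..\<tau>}" for r
    proof -
      have "r\<^sup>2 \<le> \<tau>\<^sup>2" using that by (intro power_mono) auto
      then show "t + r\<^sup>2 \<le> T" "t + r\<^sup>2 \<in> {0..T}" using t\<tau> t0 by (auto intro: add_nonneg_nonneg)
      then have "r\<^sup>2 \<le> T" using t0 by linarith
      then show "r \<in> {0..sqrt T}" using that by (auto intro: real_le_rsqrt)
    qed
    have r': "r \<in> {0..\<tau>}" "r > 0" "t + r\<^sup>2 < T" if "r \<in> {0<..<\<tau>}" for r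
    proof -
      have "r\<^sup>2 < \<tau>\<^sup>2" using that by (intro power_strict_mono) auto
      then show "t + r\<^sup>2 < T" using t\<tau> by linarith
    qed (use that in auto)
    let ?F = "\<lambda>r \<xi>. u (t + r\<^sup>2) (step t x r \<xi>) + r\<^sup>2 * f0"
    let ?H = "\<lambda>r \<xi>. 2 * r * time_deriv T u (t + r\<^sup>2) (step t x r \<xi>)
       + grad_x u (t + r\<^sup>2) (step t x r \<xi>) \<bullet> ((2 * r) *\<^sub>R b t x + \<sigma> t x *v \<xi>) + 2 * r * f0"
    \<comment> \<open>A crude bound that serves as the integrable majorant only. It depends on
      \<open>t\<close>, \<open>x\<close> and \<tau>, and does not enter the final constant.\<close>
    let ?c = "2 * \<tau> * (Ct * A ^ 3) + Cg * A * (2 * \<tau> * norm (b t x) + norm (\<sigma> t x)) + 2 * \<tau> * \<bar>f0\<bar>"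
    have "\<bar>(\<integral>\<xi>. ?F \<tau> \<xi> \<partial>gaussian) - (\<integral>\<xi>. ?F 0 \<xi> \<partial>gaussian)\<bar> \<le> (2 * \<tau> * (G * \<tau> * m * (1 + norm x) ^ 4)) * (\<tau> - 0)"
    proof (rule integral_increment_le[where F' = ?H and G = "\<lambda>\<xi>. ?c * weight x \<xi> ^ 3"])
      show "0 \<le> \<tau>" by fact
      show "integrable gaussian (?F r)" if "r \<in> {0..\<tau>}" for r
        using u_step_integrable[OF t r(1,2)[OF that]] by simp
      show "continuous_on {0..\<tau>} (\<lambda>r. ?F r \<xi>)" for \<xi>
      proof (intro continuous_intros)
        have "continuous_on {0..\<tau>} (\<lambda>r. (\<lambda>(t, x). u t x) (t + r\<^sup>2, step t x r \<xi>))"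
          unfolding step_def
          by (intro continuous_on_compose2[OF continuous_u] continuous_intros) (use r(3) in blast)
        then show "continuous_on {0..\<tau>} (\<lambda>r. u (t + r\<^sup>2) (step t x r \<xi>))" by simp
      qed
      show "((\<lambda>r. ?F r \<xi>) has_real_derivative ?H r \<xi>) (at r)" if "r \<in> {0<..<\<tau>}" for r \<xi>
        by (intro DERIV_add u_step_derivative t0 r'[OF that]) (auto intro!: derivative_eq_intros)
      show mH: "?H r \<in> borel_measurable gaussian" if "r \<in> {0<..<\<tau>}" for r
      proof -
        have s: "t + r\<^sup>2 \<in> {0..T}" using r[OF r'(1)[OF that]] by simp
        have "continuous_on UNIV (?H r)"
          by (intro continuous_intros continuous_on_compose2[OF continuous_slices(2)[OF s] continuous_step]
              continuous_on_compose2[OF continuous_slices(3)[OF s] continuous_step]) auto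
        then show ?thesis
          unfolding measurable_cong_sets[OF sets_gaussian refl] by (rule borel_measurable_continuous_onI)
      qed
      show "integrable gaussian (\<lambda>\<xi>. ?c * weight x \<xi> ^ 3)"
        using gaussian_weight_integrable[of x 3] by simp
      show "\<bar>?H r \<xi>\<bar> \<le> ?c * weight x \<xi> ^ 3" if "r \<in> {0<..<\<tau>}" for r \<xi>
      proof -
        define y where "y = step t x r \<xi>"
        define R where "R = weight x \<xi>"
        have R: "R \<ge> 1" "1 + norm \<xi> \<le> R" by (simp_all add: R_def weight_ge)
        have rr: "0 < r" "r \<le> \<tau>" using that by auto
        have s: "t + r\<^sup>2 \<in> {0..T}" and rT: "r \<in> {0..sqrt T}" using r[OF r'(1)[OF that]] by simp_all
        have y: "1 + norm y \<le> A * R" using A(2)[OF t rT] by (simp add: y_def R_def)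
        have "\<bar>time_deriv T u (t + r\<^sup>2) y\<bar> \<le> Ct * (A * R) ^ 3"
          using Ct(1) y by (intro order_trans[OF Ct(2)[OF s]] mult_left_mono power_mono) auto
        then have "\<bar>2 * r * time_deriv T u (t + r\<^sup>2) y\<bar> \<le> (2 * \<tau>) * (Ct * (A * R) ^ 3)"
          unfolding abs_mult using rr by (intro mult_mono) auto
        then have 1: "\<bar>2 * r * time_deriv T u (t + r\<^sup>2) y\<bar> \<le> 2 * \<tau> * (Ct * A ^ 3) * R ^ 3"
          by (simp add: power_mult_distrib mult.assoc)
        have g: "norm (grad_x u (t + r\<^sup>2) y) \<le> Cg * A * R"
          using order_trans[OF Cg(2)[OF s] mult_left_mono[OF y Cg(1)]] by (simp add: mult.assoc)
        have "norm ((2 * r) *\<^sub>R b t x + \<sigma> t x *v \<xi>) \<le> 2 * r * norm (b t x) + norm (\<sigma> t x) * norm \<xi>"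
          using rr by (intro order_trans[OF norm_triangle_ineq] add_mono norm_matrix_vector_mult_le) simp
        also have "\<dots> \<le> 2 * \<tau> * norm (b t x) * R + norm (\<sigma> t x) * R"
        proof (rule add_mono)
          have "2 * r * norm (b t x) * 1 \<le> 2 * \<tau> * norm (b t x) * R"
            using rr R by (intro mult_mono) auto
          then show "2 * r * norm (b t x) \<le> 2 * \<tau> * norm (b t x) * R" by simp
          show "norm (\<sigma> t x) * norm \<xi> \<le> norm (\<sigma> t x) * R" using R by (intro mult_left_mono) auto
        qed
        finally have v: "norm ((2 * r) *\<^sub>R b t x + \<sigma> t x *v \<xi>) \<le> (2 * \<tau> * norm (b t x) + norm (\<sigma> t x)) * R"
          by (simp add: distrib_right)
        have "\<bar>grad_x u (t + r\<^sup>2) y \<bullet> ((2 * r) *\<^sub>R b t x + \<sigma> t x *v \<xi>)\<bar>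
            \<le> (Cg * A * R) * ((2 * \<tau> * norm (b t x) + norm (\<sigma> t x)) * R)"
          using g v Cg(1) A(1) R by (intro order_trans[OF Cauchy_Schwarz_ineq2] mult_mono) auto
        also have "\<dots> = Cg * A * (2 * \<tau> * norm (b t x) + norm (\<sigma> t x)) * R\<^sup>2"
          by (simp add: power2_eq_square mult_ac)
        also have "\<dots> \<le> Cg * A * (2 * \<tau> * norm (b t x) + norm (\<sigma> t x)) * R ^ 3"
          using Cg(1) A(1) \<tau>0 R by (intro mult_left_mono power_increasing) auto
        finally have 2: "\<bar>grad_x u (t + r\<^sup>2) y \<bullet> ((2 * r) *\<^sub>R b t x + \<sigma> t x *v \<xi>)\<bar>
            \<le> Cg * A * (2 * \<tau> * norm (b t x) + norm (\<sigma> t x)) * R ^ 3" .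
        have "\<bar>2 * r * f0\<bar> \<le> 2 * \<tau> * \<bar>f0\<bar> * 1"
          using rr by (simp add: abs_mult mult_right_mono)
        also have "\<dots> \<le> 2 * \<tau> * \<bar>f0\<bar> * R ^ 3"
          using \<tau>0 R by (intro mult_left_mono) auto
        finally have 3: "\<bar>2 * r * f0\<bar> \<le> 2 * \<tau> * \<bar>f0\<bar> * R ^ 3" .
        show ?thesis
          unfolding y_def[symmetric] R_def[symmetric] distrib_right[of _ _ "R ^ 3"]
          by (rule order_trans[OF abs_triangle_ineq add_mono[OF order_trans[OF abs_triangle_ineq add_mono[OF 1 2]] 3]])
      qed
      show "\<bar>\<integral>\<xi>. ?H r \<xi> \<partial>gaussian\<bar> \<le> 2 * \<tau> * (G * \<tau> * m * (1 + norm x) ^ 4)" if rI: "r \<in> {0<..<\<tau>}" for r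
      proof -
        have s: "t + r\<^sup>2 \<in> {0..T}" and rT: "r \<in> {0..sqrt T}" using r[OF r'(1)[OF rI]] by simp_all
        have rr: "0 < r" "r \<le> \<tau>" using rI by auto
        let ?g = "\<lambda>\<xi>. generator t x (t + r\<^sup>2) (step t x r \<xi>) + f0"
        let ?a = "\<lambda>\<xi>. grad_x u (t + r\<^sup>2) (step t x r \<xi>) \<bullet> (\<sigma> t x *v \<xi>)"
        let ?tr = "\<lambda>\<xi>. trace (hess_x u (t + r\<^sup>2) (step t x r \<xi>) ** (\<sigma> t x ** transpose (\<sigma> t x)))"
        have mg: "?g \<in> borel_measurable borel"
          unfolding sum_columns_trace[symmetric]
          by (rule borel_measurable_continuous_onI,
              intro continuous_intros continuous_on_compose2[OF continuous_slices(2)[OF s] continuous_step]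
              continuous_on_compose2[OF continuous_slices(3)[OF s] continuous_step]
              continuous_on_compose2[OF continuous_slices(4)[OF s] continuous_step]) auto
        have gb: "\<bar>?g \<xi>\<bar> \<le> G * r * weight x \<xi> ^ 4" for \<xi>
          unfolding f0_def by (rule G(2)[OF t rT r'(3)[OF rI]])
        note ig = gaussian_weight_bound[where F = "?g" and C = "G * r" and k = 4, OF mg gb]
        \<comment> \<open>Twice \<open>r\<close> times the half trace inside the generator is
          \<open>r * ?tr\<close>, which is taken off again; by Stein's identity it has the same mean
          as \<open>?a\<close>, so the bracket integrates to zero.\<close>
        have eq: "?H r \<xi> = 2 * r * ?g \<xi> + (?a \<xi> - r * ?tr \<xi>)" for \<xi>
          unfolding inner_add_right inner_scaleR_right inner_commute[of "grad_x u (t + r\<^sup>2) (step t x r \<xi>)" "b t x"]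
          by (simp add: distrib_left)
        have I: "(\<integral>\<xi>. ?H r \<xi> \<partial>gaussian) = 2 * r * (\<integral>\<xi>. ?g \<xi> \<partial>gaussian)"
        proof -
          note gi = gaussian_grad_inner[OF t rT s, of x]
          have i1: "integrable gaussian (\<lambda>\<xi>. 2 * r * ?g \<xi>)" and i2: "integrable gaussian (\<lambda>\<xi>. r * ?tr \<xi>)"
            by (rule integrable_mult_right[OF ig(1)], rule integrable_mult_right[OF gi(2)])
          have "(\<integral>\<xi>. ?H r \<xi> \<partial>gaussian) = (\<integral>\<xi>. 2 * r * ?g \<xi> \<partial>gaussian)
              + ((\<integral>\<xi>. ?a \<xi> \<partial>gaussian) - (\<integral>\<xi>. r * ?tr \<xi> \<partial>gaussian))"
            unfolding eq Bochner_Integration.integral_add[OF i1 Bochner_Integration.integrable_diff[OF gi(1) i2]]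
              Bochner_Integration.integral_diff[OF gi(1) i2] ..
          then show ?thesis unfolding gi(3) by (simp only: integral_mult_right_zero diff_self add_0_right)
        qed
        have "\<bar>2 * r * (\<integral>\<xi>. ?g \<xi> \<partial>gaussian)\<bar> = 2 * r * \<bar>\<integral>\<xi>. ?g \<xi> \<partial>gaussian\<bar>"
          using rr by (simp only: abs_mult abs_numeral abs_of_pos)
        also have "\<dots> \<le> 2 * \<tau> * (G * \<tau> * m * (1 + norm x) ^ 4)"
        proof (rule mult_mono)
          have "G * r * m * (1 + norm x) ^ 4 \<le> G * \<tau> * m * (1 + norm x) ^ 4"
            using G(1) m rr by (intro mult_right_mono mult_left_mono) auto
          then show "\<bar>\<integral>\<xi>. ?g \<xi> \<partial>gaussian\<bar> \<le> G * \<tau> * m * (1 + norm x) ^ 4"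
            using ig(2) unfolding m_def by (rule order_trans[rotated])
          show "2 * r \<le> 2 * \<tau>" "0 \<le> 2 * \<tau>" using rr by simp_all
        qed (rule abs_ge_zero)
        finally show ?thesis unfolding I .
      qed
    qed
    moreover have "(\<integral>\<xi>. ?F 0 \<xi> \<partial>gaussian) = u t x"
      by (simp add: step_def gaussian.prob_space[simplified])
    moreover have "(\<integral>\<xi>. ?F \<tau> \<xi> \<partial>gaussian) = (\<integral>\<xi>. u (t + \<tau>\<^sup>2) (step t x \<tau> \<xi>) \<partial>gaussian) + \<tau>\<^sup>2 * f0"
      using u_step_integrable[OF t r(1,2), of \<tau> x] \<tau>0 by (simp add: gaussian.prob_space[simplified])
    moreover have "(2 * \<tau> * (G * \<tau> * m * (1 + norm x) ^ 4)) * (\<tau> - 0) = (2 * G * m) * \<tau> ^ 3 * (1 + norm x) ^ 4"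
      by (simp add: power3_eq_cube)
    ultimately show ?thesis unfolding f0_def by linarith
  qed
  then show ?thesis using G m by (intro exI[of _ "2 * G * m"]) auto
qed


section \<open>Moments of one step\<close>

text \<open>The relative change of \<open>1 + (norm x)\<^sup>2\<close> is a mean-zero term linear in
  \<xi> plus a remainder of order \<open>\<tau>\<^sup>2\<close>. The growth factor must be
  \<open>1 + C * \<tau>\<^sup>2\<close> and not merely \<open>1 + C * \<tau>\<close>, for then its
  powers over \<open>T / h\<close> steps stay bounded.\<close>

lemma step_moment:
  "\<exists>C\<ge>0. \<forall>t\<in>{0..T}. \<forall>\<tau>\<in>{0..sqrt T}. \<forall>x.
     integrable gaussian (\<lambda>\<xi>. (1 + (norm (step t x \<tau> \<xi>))\<^sup>2) ^ q) \<and>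
     (\<integral>\<xi>. (1 + (norm (step t x \<tau> \<xi>))\<^sup>2) ^ q \<partial>gaussian) \<le> (1 + C * \<tau>\<^sup>2) * (1 + (norm x)\<^sup>2) ^ q"
proof -
  obtain A where A: "A \<ge> 0" "\<And>t \<tau> x \<xi>. t \<in> {0..T} \<Longrightarrow> \<tau> \<in> {0..sqrt T} \<Longrightarrow>
      norm (step t x \<tau> \<xi> - x) \<le> A * \<tau> * weight x \<xi>"
    using norm_step_diff_le by blast
  obtain Cb where Cb: "Cb \<ge> 0" "\<And>t x. t \<in> {0..T} \<Longrightarrow> norm (b t x) \<le> Cb * (1 + norm x)"
    using b_growth by blast
  obtain Cs where Cs: "Cs \<ge> 0" "\<And>t x. t \<in> {0..T} \<Longrightarrow> norm (\<sigma> t x) \<le> Cs * (1 + norm x)"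
    using \<sigma>_growth by blast
  \<comment> \<open>\<open>E * \<tau> * P\<^sup>2\<close> will bound the relative change \<eta>;
    \<open>D\<close> collects the quadratic term of \<open>one_plus_power_le\<close> and the
    second-order part \<kappa> of the linear term.\<close>
  define E where "E = 4 * Cs + (4 * Cb + 2 * A\<^sup>2) * sqrt T"
  define D where "D = (real q)\<^sup>2 * E\<^sup>2 * (1 + sqrt T * E) ^ q + real q * (4 * Cb + 2 * A\<^sup>2)"
  \<comment> \<open>Four powers come from the square of \<eta> and \<open>2 * q\<close> from the
    factor \<open>(1 + \<bar>\<eta>\<bar>) ^ q\<close>, as \<eta> is quadratic in
    \<open>P\<close>.\<close>
  define m where "m = (\<integral>\<xi>. (1 + norm \<xi>) ^ (2 * q + 4) \<partial>(gaussian :: (real^'d) measure))"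
  interpret gaussian: prob_space "gaussian :: (real^'d) measure" by (rule prob_space_gaussian)
  have E: "E \<ge> 0" using A Cb Cs T_pos by (simp add: E_def)
  have D: "D \<ge> 0" using A Cb E T_pos by (simp add: D_def)
  have m: "m \<ge> 0" unfolding m_def by simp
  have "integrable gaussian (\<lambda>\<xi>. (1 + (norm (step t x \<tau> \<xi>))\<^sup>2) ^ q) \<and>
     (\<integral>\<xi>. (1 + (norm (step t x \<tau> \<xi>))\<^sup>2) ^ q \<partial>gaussian) \<le> (1 + (D * m) * \<tau>\<^sup>2) * (1 + (norm x)\<^sup>2) ^ q"
    if t: "t \<in> {0..T}" and \<tau>: "\<tau> \<in> {0..sqrt T}" for t \<tau> x
  proof -
    define N where "N = 1 + (norm x)\<^sup>2"
    \<comment> \<open>Division by \<open>N\<close> makes the coefficient of \<xi> bounded by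
      \<open>4 * Cs\<close> uniformly in \<open>x\<close>, since \<sigma> grows linearly.\<close>
    define a where "a = (2 / N) *\<^sub>R (x v* \<sigma> t x)"
    have N: "N \<ge> 1" "(1 + norm x)\<^sup>2 \<le> 2 * N" "norm x * (1 + norm x) \<le> 2 * N"
    proof -
      show "(1 + norm x)\<^sup>2 \<le> 2 * N"
        using sum_squares_bound[of 1 "norm x"] by (simp add: N_def power2_sum)
      moreover have "norm x * (1 + norm x) \<le> (1 + norm x)\<^sup>2"
        by (simp add: power2_eq_square mult_right_mono)
      ultimately show "norm x * (1 + norm x) \<le> 2 * N" by linarith
    qed (simp add: N_def)
    have bound: "((1 + (norm (step t x \<tau> \<xi>))\<^sup>2) / N) ^ q
        \<le> 1 + real q * \<tau> * (a \<bullet> \<xi>) + (D * \<tau>\<^sup>2) * (1 + norm \<xi>) ^ (2 * q + 4)" for \<xi>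
    proof -
      define y where "y = step t x \<tau> \<xi>"
      define P where "P = 1 + norm \<xi>"
      define \<kappa> where "\<kappa> = (2 * \<tau>\<^sup>2 * (x \<bullet> b t x) + (norm (y - x))\<^sup>2) / N"
      define \<eta> where "\<eta> = \<tau> * (a \<bullet> \<xi>) + \<kappa>"
      have P: "P \<ge> 1" by (simp add: P_def)
      have \<eta>: "(1 + (norm y)\<^sup>2) / N = 1 + \<eta>"
      proof -
        have "(norm y)\<^sup>2 = (norm x)\<^sup>2 + 2 * (x \<bullet> (y - x)) + (norm (y - x))\<^sup>2"
          by (simp add: power2_norm_eq_inner inner_diff_left inner_diff_right inner_commute)
        also have "x \<bullet> (y - x) = \<tau>\<^sup>2 * (x \<bullet> b t x) + \<tau> * ((x v* \<sigma> t x) \<bullet> \<xi>)"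
          by (simp add: y_def step_def inner_add_right dot_lmul_matrix)
        finally have "1 + (norm y)\<^sup>2 = N + \<tau> * (2 * ((x v* \<sigma> t x) \<bullet> \<xi>)) + (2 * \<tau>\<^sup>2 * (x \<bullet> b t x) + (norm (y - x))\<^sup>2)"
          by (simp add: N_def)
        moreover have "2 * ((x v* \<sigma> t x) \<bullet> \<xi>) = (a \<bullet> \<xi>) * N" using N(1) by (simp add: a_def)
        moreover have "2 * \<tau>\<^sup>2 * (x \<bullet> b t x) + (norm (y - x))\<^sup>2 = \<kappa> * N" using N(1) by (simp add: \<kappa>_def)
        ultimately have "1 + (norm y)\<^sup>2 = N + \<eta> * N" by (simp add: \<eta>_def distrib_right)
        then show ?thesis using N(1) by (simp add: add_divide_distrib)
      qed
      have \<kappa>: "\<bar>\<kappa>\<bar> \<le> (4 * Cb + 2 * A\<^sup>2) * \<tau>\<^sup>2 * P\<^sup>2"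
      proof -
        have "\<bar>x \<bullet> b t x\<bar> \<le> norm x * (Cb * (1 + norm x))"
          using Cb(2)[OF t, of x] by (intro order_trans[OF Cauchy_Schwarz_ineq2] mult_left_mono) auto
        also have "\<dots> \<le> Cb * (2 * N)" using mult_left_mono[OF N(3) Cb(1)] by (simp add: mult_ac)
        also have "\<dots> \<le> Cb * (2 * N) * P\<^sup>2"
          using Cb(1) N(1) P mult_left_mono[of 1 "P\<^sup>2" "Cb * (2 * N)"] by simp
        finally have 1: "\<bar>2 * \<tau>\<^sup>2 * (x \<bullet> b t x)\<bar> \<le> 2 * \<tau>\<^sup>2 * (Cb * (2 * N) * P\<^sup>2)"
          unfolding abs_mult by (intro mult_mono) auto
        have "(norm (y - x))\<^sup>2 \<le> (A * \<tau> * ((1 + norm x) * P))\<^sup>2"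
          using A(2)[OF t \<tau>, of x \<xi>] by (intro power_mono) (auto simp: y_def P_def)
        also have "\<dots> = A\<^sup>2 * \<tau>\<^sup>2 * P\<^sup>2 * (1 + norm x)\<^sup>2" by (simp add: power_mult_distrib)
        also have "\<dots> \<le> A\<^sup>2 * \<tau>\<^sup>2 * P\<^sup>2 * (2 * N)" using N(2) by (intro mult_left_mono) auto
        finally have 2: "(norm (y - x))\<^sup>2 \<le> A\<^sup>2 * \<tau>\<^sup>2 * P\<^sup>2 * (2 * N)" .
        have "\<bar>2 * \<tau>\<^sup>2 * (x \<bullet> b t x) + (norm (y - x))\<^sup>2\<bar>
            \<le> 2 * \<tau>\<^sup>2 * (Cb * (2 * N) * P\<^sup>2) + A\<^sup>2 * \<tau>\<^sup>2 * P\<^sup>2 * (2 * N)"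
          using 1 2 by (intro order_trans[OF abs_triangle_ineq] add_mono) auto
        also have "\<dots> = ((4 * Cb + 2 * A\<^sup>2) * \<tau>\<^sup>2 * P\<^sup>2) * N" by (simp add: algebra_simps)
        finally show ?thesis using N(1) by (simp add: \<kappa>_def pos_divide_le_eq)
      qed
      have "norm (x v* \<sigma> t x) \<le> norm x * (Cs * (1 + norm x))"
        using Cs(2)[OF t, of x] by (intro order_trans[OF norm_vector_matrix_mult_le] mult_left_mono) auto
      also have "\<dots> \<le> Cs * (2 * N)" using mult_left_mono[OF N(3) Cs(1)] by (simp add: mult_ac)
      finally have "norm a \<le> 4 * Cs" using N(1) by (simp add: a_def pos_divide_le_eq mult_ac)
      then have a\<xi>: "\<bar>a \<bullet> \<xi>\<bar> \<le> 4 * Cs * P\<^sup>2"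
      proof -
        assume na: "norm a \<le> 4 * Cs"
        have "\<bar>a \<bullet> \<xi>\<bar> \<le> (4 * Cs) * P"
          using na Cs(1) by (intro order_trans[OF Cauchy_Schwarz_ineq2] mult_mono) (auto simp: P_def)
        also have "\<dots> \<le> (4 * Cs) * P\<^sup>2"
          using Cs(1) P by (intro mult_left_mono) (auto simp: power2_eq_square mult_le_cancel_left1)
        finally show ?thesis .
      qed
      have "\<bar>\<eta>\<bar> \<le> \<tau> * (4 * Cs * P\<^sup>2) + (4 * Cb + 2 * A\<^sup>2) * (sqrt T * \<tau>) * P\<^sup>2"
      proof -
        have "\<bar>\<tau> * (a \<bullet> \<xi>)\<bar> \<le> \<tau> * (4 * Cs * P\<^sup>2)"
          unfolding abs_mult using \<tau> a\<xi> by (intro mult_mono) auto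
        moreover have "(4 * Cb + 2 * A\<^sup>2) * \<tau>\<^sup>2 * P\<^sup>2 \<le> (4 * Cb + 2 * A\<^sup>2) * (sqrt T * \<tau>) * P\<^sup>2"
          using \<tau> Cb(1) by (intro mult_right_mono mult_left_mono) (auto simp: power2_eq_square mult_right_mono)
        ultimately show ?thesis using \<kappa> by (simp add: \<eta>_def)
      qed
      also have "\<dots> = E * \<tau> * P\<^sup>2" by (simp add: E_def algebra_simps)
      finally have \<eta>1: "\<bar>\<eta>\<bar> \<le> E * \<tau> * P\<^sup>2" .
      have "\<eta>\<^sup>2 \<le> (E * \<tau> * P\<^sup>2)\<^sup>2" using \<eta>1 power_mono[of "\<bar>\<eta>\<bar>" _ 2] by simp
      then have \<eta>2: "\<eta>\<^sup>2 \<le> E\<^sup>2 * \<tau>\<^sup>2 * P ^ 4" by (simp add: power_mult_distrib)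
      have "1 + \<bar>\<eta>\<bar> \<le> (1 + sqrt T * E) * P\<^sup>2"
      proof -
        have "E * \<tau> * P\<^sup>2 \<le> E * sqrt T * P\<^sup>2" using E \<tau> by (intro mult_right_mono mult_left_mono) auto
        moreover have "1 \<le> P\<^sup>2" using P by simp
        ultimately show ?thesis using \<eta>1 by (simp add: distrib_right mult.commute[of E])
      qed
      then have \<eta>3: "(1 + \<bar>\<eta>\<bar>) ^ q \<le> (1 + sqrt T * E) ^ q * P ^ (2 * q)"
        using power_mono[of "1 + \<bar>\<eta>\<bar>" "(1 + sqrt T * E) * P\<^sup>2" q] by (simp add: power_mult_distrib power_mult)
      have "1 + \<eta> \<ge> 0" unfolding \<eta>[symmetric] using N(1) by simp
      then have "(1 + \<eta>) ^ q \<le> 1 + q * \<eta> + (real q)\<^sup>2 * \<eta>\<^sup>2 * (1 + \<bar>\<eta>\<bar>) ^ q"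
        by (intro one_plus_power_le) simp
      also have "(real q)\<^sup>2 * \<eta>\<^sup>2 * (1 + \<bar>\<eta>\<bar>) ^ q
          \<le> (real q)\<^sup>2 * (E\<^sup>2 * \<tau>\<^sup>2 * P ^ 4) * ((1 + sqrt T * E) ^ q * P ^ (2 * q))"
        using \<eta>2 \<eta>3 P by (intro mult_mono) auto
      also have "q * \<eta> \<le> real q * \<tau> * (a \<bullet> \<xi>) + real q * ((4 * Cb + 2 * A\<^sup>2) * \<tau>\<^sup>2 * P ^ (2 * q + 4))"
      proof -
        have "(4 * Cb + 2 * A\<^sup>2) * \<tau>\<^sup>2 * P\<^sup>2 \<le> (4 * Cb + 2 * A\<^sup>2) * \<tau>\<^sup>2 * P ^ (2 * q + 4)"
          using Cb(1) P by (intro mult_left_mono power_increasing) auto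
        then have "\<kappa> \<le> (4 * Cb + 2 * A\<^sup>2) * \<tau>\<^sup>2 * P ^ (2 * q + 4)" using \<kappa> by linarith
        then have "real q * \<kappa> \<le> real q * ((4 * Cb + 2 * A\<^sup>2) * \<tau>\<^sup>2 * P ^ (2 * q + 4))"
          by (intro mult_left_mono) auto
        then show ?thesis by (simp add: \<eta>_def distrib_left mult.assoc)
      qed
      finally have "(1 + \<eta>) ^ q \<le> 1 + (real q * \<tau> * (a \<bullet> \<xi>) + real q * ((4 * Cb + 2 * A\<^sup>2) * \<tau>\<^sup>2 * P ^ (2 * q + 4)))
          + (real q)\<^sup>2 * (E\<^sup>2 * \<tau>\<^sup>2 * P ^ 4) * ((1 + sqrt T * E) ^ q * P ^ (2 * q))" by simp
      also have "\<dots> = 1 + real q * \<tau> * (a \<bullet> \<xi>) + (D * \<tau>\<^sup>2) * P ^ (2 * q + 4)"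
        by (simp add: D_def distrib_right distrib_left power_add mult_ac)
      finally show ?thesis unfolding \<eta>[symmetric] by (simp add: y_def P_def)
    qed
    have mS: "(\<lambda>\<xi>. ((1 + (norm (step t x \<tau> \<xi>))\<^sup>2) / N) ^ q) \<in> borel_measurable borel"
      by (rule measurable_comp_step) (intro continuous_intros, use N(1) in auto)
    have ia: "integrable gaussian (\<lambda>\<xi>. a \<bullet> \<xi>)"
      by (rule integrable_gaussian_bound[of _ "norm a" 1])
        (auto intro!: order_trans[OF Cauchy_Schwarz_ineq2] mult_left_mono)
    have ir: "integrable gaussian (\<lambda>\<xi>. 1 + real q * \<tau> * (a \<bullet> \<xi>) + (D * \<tau>\<^sup>2) * (1 + norm \<xi>) ^ (2 * q + 4))"
      using ia integrable_gaussian_power[where 'd = 'd, of "2 * q + 4"] by simp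
    have iS: "integrable gaussian (\<lambda>\<xi>. ((1 + (norm (step t x \<tau> \<xi>))\<^sup>2) / N) ^ q)"
    proof (rule Bochner_Integration.integrable_bound[OF ir])
      show "(\<lambda>\<xi>. ((1 + (norm (step t x \<tau> \<xi>))\<^sup>2) / N) ^ q) \<in> borel_measurable gaussian"
        using mS unfolding measurable_cong_sets[OF sets_gaussian refl] .
      show "AE \<xi> in gaussian. norm (((1 + (norm (step t x \<tau> \<xi>))\<^sup>2) / N) ^ q)
          \<le> norm (1 + real q * \<tau> * (a \<bullet> \<xi>) + (D * \<tau>\<^sup>2) * (1 + norm \<xi>) ^ (2 * q + 4))"
      proof (rule always_eventually, rule allI)
        fix \<xi> :: "real^'d"
        have "0 \<le> ((1 + (norm (step t x \<tau> \<xi>))\<^sup>2) / N) ^ q" using N(1) by simp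
        with bound[of \<xi>] show "norm (((1 + (norm (step t x \<tau> \<xi>))\<^sup>2) / N) ^ q)
          \<le> norm (1 + real q * \<tau> * (a \<bullet> \<xi>) + (D * \<tau>\<^sup>2) * (1 + norm \<xi>) ^ (2 * q + 4))"
          unfolding real_norm_def by linarith
      qed
    qed
    have eq: "(1 + (norm (step t x \<tau> \<xi>))\<^sup>2) ^ q = N ^ q * ((1 + (norm (step t x \<tau> \<xi>))\<^sup>2) / N) ^ q" for \<xi>
      using N(1) by (simp add: power_divide)
    have "(\<integral>\<xi>. ((1 + (norm (step t x \<tau> \<xi>))\<^sup>2) / N) ^ q \<partial>gaussian)
        \<le> (\<integral>\<xi>. 1 + real q * \<tau> * (a \<bullet> \<xi>) + (D * \<tau>\<^sup>2) * (1 + norm \<xi>) ^ (2 * q + 4) \<partial>gaussian)"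
      by (rule integral_mono[OF iS ir bound])
    also have "\<dots> = 1 + D * m * \<tau>\<^sup>2"
      using ia integrable_gaussian_power[where 'd = 'd, of "2 * q + 4"]
      by (simp add: gaussian.prob_space[simplified] integral_gaussian_inner m_def)
    finally have "N ^ q * (\<integral>\<xi>. ((1 + (norm (step t x \<tau> \<xi>))\<^sup>2) / N) ^ q \<partial>gaussian) \<le> N ^ q * (1 + D * m * \<tau>\<^sup>2)"
      using N(1) by (intro mult_left_mono) auto
    then show ?thesis unfolding eq using iS by (simp add: N_def mult.commute)
  qed
  then show ?thesis using D m by (intro exI[of _ "D * m"]) auto
qed

end

section \<open>Independence of Brownian increments from the past\<close>

lemma measurable_Collect_mem:
  assumes "F \<in> measurable M N" "A \<in> sets N"
  shows "{\<omega> \<in> space M. F \<omega> \<in> A} \<in> sets M"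
proof -
  have "{\<omega> \<in> space M. F \<omega> \<in> A} = F -` A \<inter> space M" by auto
  then show ?thesis using measurable_sets[OF assms] by simp
qed

lemma sets_augmented_filtration:
  "sets (augmented_filtration M W t) = sigma_sets (space M)
     ({W s -` A \<inter> space M | s A. s \<in> {0..t} \<and> A \<in> sets borel} \<union> null_sets M)"
  unfolding augmented_filtration_def
  by (rule sets_measure_of) (use sets.sets_into_space in \<open>auto simp: null_sets_def\<close>)

lemma space_augmented_filtration [simp]: "space (augmented_filtration M W t) = space M"
  unfolding augmented_filtration_def
  by (rule space_measure_of) (use sets.sets_into_space in \<open>auto simp: null_sets_def\<close>)

text \<open>The generating cylinder events grow with time, while the null sets adjoined are the same
  at every time.\<close>

lemma augmented_filtration_mono:
  "s \<le> t \<Longrightarrow> sets (augmented_filtration M W s) \<subseteq> sets (augmented_filtration M W t)"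
  unfolding sets_augmented_filtration
proof (rule sigma_sets_mono')
  assume "s \<le> t"
  then show "{W r -` A \<inter> space M | r A. r \<in> {0..s} \<and> A \<in> sets borel} \<union> null_sets M
      \<subseteq> {W r -` A \<inter> space M | r A. r \<in> {0..t} \<and> A \<in> sets borel} \<union> null_sets M"
    by (intro Un_mono order_refl Collect_mono ex_mono impI) (meson atLeastAtMost_iff order_trans)
qed

lemma measurable_augmented_filtration_mono:
  assumes "s \<le> t" "X \<in> measurable (augmented_filtration M W s) N"
  shows "X \<in> measurable (augmented_filtration M W t) N"
  using measurable_mono[OF order_refl refl augmented_filtration_mono[OF assms(1), of M W], of N] assms(2) by auto

lemma measurable_augmented_filtration_W:
  fixes W :: "real \<Rightarrow> 'a \<Rightarrow> 'b::topological_space"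
  assumes "s \<in> {0..t}"
  shows "W s \<in> borel_measurable (augmented_filtration M W t)"
proof (rule measurableI)
  fix A :: "'b set" assume "A \<in> sets borel"
  then show "W s -` A \<inter> space (augmented_filtration M W t) \<in> sets (augmented_filtration M W t)"
    unfolding sets_augmented_filtration using assms by (intro sigma_sets.Basic) auto
qed simp

context brownian_motion
begin

lemma augmented_filtration_le:
  assumes "t \<le> T"
  shows "sets (augmented_filtration M W t) \<subseteq> sets M"
  unfolding sets_augmented_filtration
proof (rule sets.sigma_sets_subset)
  show "{W s -` A \<inter> space M | s A. s \<in> {0..t} \<and> A \<in> sets borel} \<union> null_sets M \<subseteq> sets M"
    using measurable_W assms by (auto intro: measurable_sets)
qed

lemma measurable_augmented_filtration_le:
  assumes "t \<le> T" "X \<in> measurable (augmented_filtration M W t) N"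
  shows "X \<in> measurable M N"
  using measurable_mono[OF order_refl refl augmented_filtration_le[OF assms(1)], of N] assms(2) by auto

text \<open>The hypothesis concerns increments over a partition, so the times in \<open>S\<close>
  are completed by \<open>0\<close> and \<open>t\<close> and sorted. Values at these times are then
  partial sums of the past increments, and the increment up to \<open>t'\<close> is independent of
  all of them jointly.\<close>

lemma cylinder_increment_indep:
  assumes S: "finite S" "S \<subseteq> {0..t}" and t: "0 \<le> t" "t < t'" "t' \<le> T"
    and B: "\<And>s. B s \<in> sets borel" and D: "D \<in> sets borel"
  shows "prob {\<omega> \<in> space M. (\<forall>s\<in>S. W s \<omega> \<in> B s) \<and> W t' \<omega> - W t \<omega> \<in> D}
    = prob {\<omega> \<in> space M. \<forall>s\<in>S. W s \<omega> \<in> B s} * prob {\<omega> \<in> space M. W t' \<omega> - W t \<omega> \<in> D}"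
proof -
  define xs where "xs = sorted_list_of_set (insert 0 (insert t S))"
  define k where "k = length xs - 1"
  \<comment> \<open>Index \<open>k\<close> is time \<open>t\<close> and index \<open>Suc k\<close>
    is \<open>t'\<close>. There are \<open>Suc k\<close> increments: those below \<open>k\<close>
    belong to the past, number \<open>k\<close> is the future one.\<close>
  define \<tau> where "\<tau> i = (xs @ [t']) ! i" for i
  have fin: "finite (insert 0 (insert t S))" using S by simp
  have set: "set xs = insert 0 (insert t S)" and sorted: "sorted xs"
    unfolding xs_def by (rule set_sorted_list_of_set[OF fin], rule sorted_sorted_list_of_set)
  have len: "length xs = Suc k" "xs \<noteq> []"
  proof -
    show "xs \<noteq> []" using set by auto
    then show "length xs = Suc k" by (cases xs) (auto simp: k_def)
  qed
  have sub: "\<And>s. s \<in> set xs \<Longrightarrow> 0 \<le> s \<and> s \<le> t" using S t unfolding set by auto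
  have \<tau>xs: "\<tau> i = xs ! i" if "i \<le> k" for i using that len by (simp add: \<tau>_def nth_append)
  have \<tau>0: "\<tau> 0 = 0"
  proof -
    obtain i where "i < length xs" "xs ! i = 0" using set by (metis in_set_conv_nth insertI1)
    then have "xs ! 0 \<le> 0" using sorted_nth_mono[OF sorted, of 0 i] by simp
    moreover have "0 \<le> xs ! 0" using sub[of "xs ! 0"] len by (simp add: nth_mem)
    ultimately show ?thesis using \<tau>xs[of 0] by simp
  qed
  have \<tau>k: "\<tau> k = t"
  proof -
    obtain i where i: "i < length xs" "xs ! i = t" using set by (metis in_set_conv_nth insertI1 insertI2)
    then have "t \<le> xs ! k" using sorted_nth_mono[OF sorted, of i k] len by simp
    moreover have "xs ! k \<le> t" using sub[of "xs ! k"] len by (simp add: nth_mem)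
    ultimately show ?thesis using \<tau>xs[of k] by simp
  qed
  have \<tau>Sk: "\<tau> (Suc k) = t'" using len by (simp add: \<tau>_def nth_append)
  have \<tau>mono: "\<tau> i \<le> \<tau> (Suc i)" if "i < Suc k" for i
  proof (cases "i = k")
    case True
    then show ?thesis using \<tau>k \<tau>Sk t by simp
  next
    case False
    then show ?thesis using that \<tau>xs[of i] \<tau>xs[of "Suc i"] sorted_nth_mono[OF sorted, of i "Suc i"] len by simp
  qed
  define I where "I i \<omega> = W (\<tau> (Suc i)) \<omega> - W (\<tau> i) \<omega>" for i \<omega>
  have ind: "indep_vars (\<lambda>_. borel) I {..<Suc k}"
    unfolding I_def[abs_def] by (rule indep_increments_W) (use \<tau>0 \<tau>mono \<tau>Sk t in auto)
  have \<tau>T: "\<tau> i \<in> {0..T}" if "i \<le> k" for i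
    using sub[of "xs ! i"] that len \<tau>xs[OF that] t by (simp add: nth_mem)
  have tele: "W (\<tau> j) \<omega> - W 0 \<omega> = (\<Sum>i<j. I i \<omega>)" if "j \<le> k" for j \<omega>
    using that by (induction j) (auto simp: \<tau>0 I_def algebra_simps)
  have S_eq: "(\<forall>s\<in>S. P s) \<longleftrightarrow> (\<forall>j\<in>{..k}. \<tau> j \<in> S \<longrightarrow> P (\<tau> j))" for P
  proof
    assume *: "\<forall>j\<in>{..k}. \<tau> j \<in> S \<longrightarrow> P (\<tau> j)"
    show "\<forall>s\<in>S. P s"
    proof
      fix s assume s: "s \<in> S"
      then obtain i where "i < length xs" "xs ! i = s" using set by (metis in_set_conv_nth insertI2)
      then have "i \<le> k" "\<tau> i = s" using len \<tau>xs[of i] by simp_all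
      then show "P s" using *[rule_format, of i] s by simp
    qed
  qed simp
  let ?A = "{..<k}" and ?B = "{k}"
  \<comment> \<open>For \<open>j \<le> k\<close> the partial sum runs over indices below
    \<open>k\<close>, so the whole event lives on the past block \<open>?A\<close>.\<close>
  define EA where "EA = {v \<in> space (PiM ?A (\<lambda>_. borel :: (real^'d) measure)). \<forall>j\<in>{..k}. \<tau> j \<in> S \<longrightarrow> (\<Sum>i<j. v i) \<in> B (\<tau> j)}"
  define EB where "EB = {v \<in> space (PiM ?B (\<lambda>_. borel :: (real^'d) measure)). v k \<in> D}"
  have EA: "EA \<in> sets (PiM ?A (\<lambda>_. borel))"
  proof -
    have "{v \<in> space (PiM ?A (\<lambda>_. borel :: (real^'d) measure)). \<tau> j \<in> S \<longrightarrow> (\<Sum>i<j. v i) \<in> B (\<tau> j)} \<in> sets (PiM ?A (\<lambda>_. borel))"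
      if "j \<in> {..k}" for j
    proof -
      have m: "(\<lambda>v. \<Sum>i<j. v i) \<in> borel_measurable (PiM ?A (\<lambda>_. borel :: (real^'d) measure))"
        by (intro borel_measurable_sum measurable_component_singleton) (use that in auto)
      show ?thesis
        using measurable_Collect_mem[OF m B[of "\<tau> j"]] by (cases "\<tau> j \<in> S") auto
    qed
    then show ?thesis unfolding EA_def by (intro sets.sets_Collect_finite_All) auto
  qed
  have EB: "EB \<in> sets (PiM ?B (\<lambda>_. borel))"
  proof -
    have "(\<lambda>v. v k) \<in> measurable (PiM ?B (\<lambda>_. borel :: (real^'d) measure)) borel"
      by (rule measurable_component_singleton) simp
    from measurable_Collect_mem[OF this D] show ?thesis by (simp add: EB_def)
  qed
  have "indep_var (PiM ?A (\<lambda>_. borel)) (\<lambda>\<omega>. restrict (\<lambda>i. I i \<omega>) ?A) (PiM ?B (\<lambda>_. borel)) (\<lambda>\<omega>. restrict (\<lambda>i. I i \<omega>) ?B)"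
    by (rule indep_var_restrict[OF ind]) auto
  from indep_varD[OF this EA EB]
  have indep: "prob ((\<lambda>\<omega>. (restrict (\<lambda>i. I i \<omega>) ?A, restrict (\<lambda>i. I i \<omega>) ?B)) -` (EA \<times> EB) \<inter> space M)
     = prob ((\<lambda>\<omega>. restrict (\<lambda>i. I i \<omega>) ?A) -` EA \<inter> space M) * prob ((\<lambda>\<omega>. restrict (\<lambda>i. I i \<omega>) ?B) -` EB \<inter> space M)" .
  have rA: "restrict (\<lambda>i. I i \<omega>) ?A \<in> EA \<longleftrightarrow> (\<forall>j\<in>{..k}. \<tau> j \<in> S \<longrightarrow> (\<Sum>i<j. I i \<omega>) \<in> B (\<tau> j))" for \<omega>
  proof -
    have "(\<Sum>i<j. restrict (\<lambda>i. I i \<omega>) ?A i) = (\<Sum>i<j. I i \<omega>)" if "j \<le> k" for j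
      using that by (intro sum.cong) auto
    then show ?thesis by (auto simp: EA_def space_PiM)
  qed
  have rB: "restrict (\<lambda>i. I i \<omega>) ?B \<in> EB \<longleftrightarrow> W t' \<omega> - W t \<omega> \<in> D" for \<omega>
    by (auto simp: EB_def space_PiM I_def \<tau>k \<tau>Sk)
  \<comment> \<open>The path starts at zero only almost surely, so the cylinder event and its
    description by increments agree up to a null set.\<close>
  have ae: "AE \<omega> in M. (\<forall>s\<in>S. W s \<omega> \<in> B s) \<longleftrightarrow> (\<forall>j\<in>{..k}. \<tau> j \<in> S \<longrightarrow> (\<Sum>i<j. I i \<omega>) \<in> B (\<tau> j))"
    using start_W
  proof eventually_elim
    case (elim \<omega>)
    show ?case unfolding S_eq using tele[of _ \<omega>] elim by auto
  qed
  have mW: "W s \<in> borel_measurable M" if "s \<in> S" for s using that S t by (intro measurable_W) auto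
  have mt: "(\<lambda>\<omega>. W t' \<omega> - W t \<omega>) \<in> borel_measurable M"
    using measurable_W[of t'] measurable_W[of t] t by auto
  have mI: "I i \<in> borel_measurable M" if "i < Suc k" for i
    using ind that by (auto simp: indep_vars_def)
  have s1: "{\<omega> \<in> space M. \<forall>s\<in>S. W s \<omega> \<in> B s} \<in> events"
  proof (rule sets.sets_Collect_finite_All[OF _ S(1)])
    fix s assume "s \<in> S"
    then show "{\<omega> \<in> space M. W s \<omega> \<in> B s} \<in> events" by (rule measurable_Collect_mem[OF mW B])
  qed
  have s2: "{\<omega> \<in> space M. W t' \<omega> - W t \<omega> \<in> D} \<in> events"
    by (rule measurable_Collect_mem[OF mt D])
  have s3: "{\<omega> \<in> space M. \<forall>j\<in>{..k}. \<tau> j \<in> S \<longrightarrow> (\<Sum>i<j. I i \<omega>) \<in> B (\<tau> j)} \<in> events"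
  proof -
    have "(\<lambda>\<omega>. restrict (\<lambda>i. I i \<omega>) ?A) \<in> measurable M (PiM ?A (\<lambda>_. borel))"
      by (rule measurable_restrict) (use mI in auto)
    from measurable_Collect_mem[OF this EA] show ?thesis by (simp add: rA)
  qed
  have "prob {\<omega> \<in> space M. (\<forall>s\<in>S. W s \<omega> \<in> B s) \<and> W t' \<omega> - W t \<omega> \<in> D}
      = prob {\<omega> \<in> space M. (\<forall>j\<in>{..k}. \<tau> j \<in> S \<longrightarrow> (\<Sum>i<j. I i \<omega>) \<in> B (\<tau> j)) \<and> W t' \<omega> - W t \<omega> \<in> D}"
  proof (rule measure_eq_AE)
    show "{\<omega> \<in> space M. (\<forall>s\<in>S. W s \<omega> \<in> B s) \<and> W t' \<omega> - W t \<omega> \<in> D} \<in> events"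
      by (rule rev_iffD1[OF sets.Int[OF s1 s2] arg_cong[of _ _ "\<lambda>A. A \<in> events"]]) auto
    show "{\<omega> \<in> space M. (\<forall>j\<in>{..k}. \<tau> j \<in> S \<longrightarrow> (\<Sum>i<j. I i \<omega>) \<in> B (\<tau> j)) \<and> W t' \<omega> - W t \<omega> \<in> D} \<in> events"
      by (rule rev_iffD1[OF sets.Int[OF s3 s2] arg_cong[of _ _ "\<lambda>A. A \<in> events"]]) auto
    show "AE \<omega> in M. (\<omega> \<in> {\<omega> \<in> space M. (\<forall>s\<in>S. W s \<omega> \<in> B s) \<and> W t' \<omega> - W t \<omega> \<in> D})
        = (\<omega> \<in> {\<omega> \<in> space M. (\<forall>j\<in>{..k}. \<tau> j \<in> S \<longrightarrow> (\<Sum>i<j. I i \<omega>) \<in> B (\<tau> j)) \<and> W t' \<omega> - W t \<omega> \<in> D})"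
      using ae by eventually_elim (simp only: mem_Collect_eq)
  qed
  also have "\<dots> = prob {\<omega> \<in> space M. \<forall>j\<in>{..k}. \<tau> j \<in> S \<longrightarrow> (\<Sum>i<j. I i \<omega>) \<in> B (\<tau> j)} * prob {\<omega> \<in> space M. W t' \<omega> - W t \<omega> \<in> D}"
  proof -
    have "(\<lambda>\<omega>. (restrict (\<lambda>i. I i \<omega>) ?A, restrict (\<lambda>i. I i \<omega>) ?B)) -` (EA \<times> EB) \<inter> space M
        = {\<omega> \<in> space M. (\<forall>j\<in>{..k}. \<tau> j \<in> S \<longrightarrow> (\<Sum>i<j. I i \<omega>) \<in> B (\<tau> j)) \<and> W t' \<omega> - W t \<omega> \<in> D}"
      by (rule set_eqI) (simp only: vimage_eq mem_Times_iff fst_conv snd_conv rA rB Int_iff mem_Collect_eq, rule conj_commute)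
    moreover have "(\<lambda>\<omega>. restrict (\<lambda>i. I i \<omega>) ?A) -` EA \<inter> space M
        = {\<omega> \<in> space M. \<forall>j\<in>{..k}. \<tau> j \<in> S \<longrightarrow> (\<Sum>i<j. I i \<omega>) \<in> B (\<tau> j)}"
      by (rule set_eqI) (simp only: vimage_eq rA Int_iff mem_Collect_eq, rule conj_commute)
    moreover have "(\<lambda>\<omega>. restrict (\<lambda>i. I i \<omega>) ?B) -` EB \<inter> space M = {\<omega> \<in> space M. W t' \<omega> - W t \<omega> \<in> D}"
      by (rule set_eqI) (simp only: vimage_eq rB Int_iff mem_Collect_eq, rule conj_commute)
    ultimately show ?thesis using indep by simp
  qed
  also have "prob {\<omega> \<in> space M. \<forall>j\<in>{..k}. \<tau> j \<in> S \<longrightarrow> (\<Sum>i<j. I i \<omega>) \<in> B (\<tau> j)} = prob {\<omega> \<in> space M. \<forall>s\<in>S. W s \<omega> \<in> B s}"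
  proof (rule measure_eq_AE[OF _ s3 s1])
    show "AE \<omega> in M. (\<omega> \<in> {\<omega> \<in> space M. \<forall>j\<in>{..k}. \<tau> j \<in> S \<longrightarrow> (\<Sum>i<j. I i \<omega>) \<in> B (\<tau> j)})
        = (\<omega> \<in> {\<omega> \<in> space M. \<forall>s\<in>S. W s \<omega> \<in> B s})"
      using ae by eventually_elim (simp only: mem_Collect_eq)
  qed
  finally show ?thesis .
qed

text \<open>Events that agree almost surely with a cylinder event. Unlike the generators of the augmented
  filtration, which contain its null sets, they are closed under intersection.\<close>

definition ae_cylinders :: "real \<Rightarrow> 'a set set" where
  "ae_cylinders t = {E \<in> events. \<exists>S B. finite S \<and> S \<subseteq> {0..t} \<and> (\<forall>s. B s \<in> sets borel) \<and>
     (AE \<omega> in M. \<omega> \<in> E \<longleftrightarrow> (\<forall>s\<in>S. W s \<omega> \<in> B s))}"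

lemma ae_cylindersI:
  assumes "E \<in> events" "finite S" "S \<subseteq> {0..t}" "\<And>s. B s \<in> sets borel"
    and "AE \<omega> in M. \<omega> \<in> E \<longleftrightarrow> (\<forall>s\<in>S. W s \<omega> \<in> B s)"
  shows "E \<in> ae_cylinders t"
  using assms unfolding ae_cylinders_def by blast

lemma Int_stable_ae_cylinders: "Int_stable (ae_cylinders t)"
proof (rule Int_stableI)
  fix E E' assume "E \<in> ae_cylinders t" "E' \<in> ae_cylinders t"
  then obtain S B S' B' where E: "E \<in> events" "finite S" "S \<subseteq> {0..t}" "\<And>s. B s \<in> sets borel"
      "AE \<omega> in M. \<omega> \<in> E \<longleftrightarrow> (\<forall>s\<in>S. W s \<omega> \<in> B s)"
    and E': "E' \<in> events" "finite S'" "S' \<subseteq> {0..t}" "\<And>s. B' s \<in> sets borel"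
      "AE \<omega> in M. \<omega> \<in> E' \<longleftrightarrow> (\<forall>s\<in>S'. W s \<omega> \<in> B' s)"
    unfolding ae_cylinders_def by blast
  \<comment> \<open>A time constrained by only one of the two cylinders gets \<open>UNIV\<close>
    from the other.\<close>
  define B'' where "B'' s = (if s \<in> S then B s else UNIV) \<inter> (if s \<in> S' then B' s else UNIV)" for s
  have "AE \<omega> in M. \<omega> \<in> E \<inter> E' \<longleftrightarrow> (\<forall>s\<in>S \<union> S'. W s \<omega> \<in> B'' s)"
    using E(5) E'(5) by eventually_elim (auto simp: B''_def)
  moreover have "B'' s \<in> sets borel" for s using E(4) E'(4) by (auto simp: B''_def)
  ultimately show "E \<inter> E' \<in> ae_cylinders t"
    using E(1-3) E'(1-3) by (intro ae_cylindersI[of _ "S \<union> S'" _ B'']) auto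
qed

text \<open>Both kinds of generators of the filtration are almost sure cylinders, so independence
  may be tested on this intersection-stable family.\<close>

lemma augmented_filtration_subset_ae_cylinders:
  assumes t: "0 \<le> t" "t \<le> T"
  shows "sets (augmented_filtration M W t) \<subseteq> sigma_sets (space M) (ae_cylinders t)"
  unfolding sets_augmented_filtration
proof (rule sigma_sets_mono', rule Un_least)
  show "{W s -` A \<inter> space M | s A. s \<in> {0..t} \<and> A \<in> sets borel} \<subseteq> ae_cylinders t"
  proof safe
    fix s :: real and A :: "(real^'d) set" assume s: "s \<in> {0..t}" and A: "A \<in> sets borel"
    have "W s \<in> borel_measurable M" using s t by (intro measurable_W) auto
    then have "W s -` A \<inter> space M \<in> events" using A by (rule measurable_sets)
    moreover have "AE \<omega> in M. \<omega> \<in> W s -` A \<inter> space M \<longleftrightarrow> (\<forall>r\<in>{s}. W r \<omega> \<in> A)"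
      by (rule AE_I2) auto
    ultimately show "W s -` A \<inter> space M \<in> ae_cylinders t"
      using s A by (intro ae_cylindersI[of _ "{s}" _ "\<lambda>_. A"]) auto
  qed
  show "null_sets M \<subseteq> ae_cylinders t"
  proof
    fix N assume N: "N \<in> null_sets M"
    \<comment> \<open>A null set is represented by the impossible cylinder, with empty target at
      time 0.\<close>
    have "AE \<omega> in M. \<omega> \<in> N \<longleftrightarrow> (\<forall>r\<in>{0::real}. W r \<omega> \<in> {})"
      using AE_not_in[OF N] by simp
    then show "N \<in> ae_cylinders t"
      using N t by (intro ae_cylindersI[of _ "{0}" _ "\<lambda>_. {}"]) auto
  qed
qed

text \<open>Dynkin's argument: cylinder events up to null sets and preimages under the increment are
  intersection-stable and independent, and independence passes to the sigma-algebras they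
  generate.\<close>

lemma indep_increment:
  fixes V :: "'a \<Rightarrow> 'c::topological_space"
  assumes t: "0 \<le> t" "t < t'" "t' \<le> T" and V: "V \<in> borel_measurable (augmented_filtration M W t)"
    and A: "A \<in> sets borel" and D: "D \<in> sets borel"
  shows "prob ((V -` A \<inter> space M) \<inter> ((\<lambda>\<omega>. W t' \<omega> - W t \<omega>) -` D \<inter> space M))
    = prob (V -` A \<inter> space M) * prob ((\<lambda>\<omega>. W t' \<omega> - W t \<omega>) -` D \<inter> space M)"
proof -
  let ?D = "\<lambda>\<omega>. W t' \<omega> - W t \<omega>"
  let ?G = "{?D -` A \<inter> space M | A. A \<in> sets borel}"
  have mt [measurable]: "?D \<in> borel_measurable M"
    using measurable_W[of t'] measurable_W[of t] t by auto
  have "indep_set (ae_cylinders t) ?G"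
  proof (rule indep_setI)
    show "ae_cylinders t \<subseteq> events" by (auto simp: ae_cylinders_def)
    show "?G \<subseteq> events" by (auto intro: measurable_sets[OF mt])
    fix E H assume "E \<in> ae_cylinders t" "H \<in> ?G"
    then obtain S B D where E: "E \<in> events" "finite S" "S \<subseteq> {0..t}" "\<And>s. B s \<in> sets borel"
        "AE \<omega> in M. \<omega> \<in> E \<longleftrightarrow> (\<forall>s\<in>S. W s \<omega> \<in> B s)"
      and H: "H = ?D -` D \<inter> space M" "D \<in> sets borel"
      unfolding ae_cylinders_def by blast
    have s1: "{\<omega> \<in> space M. \<forall>s\<in>S. W s \<omega> \<in> B s} \<in> events"
    proof (rule sets.sets_Collect_finite_All[OF _ E(2)])
      fix s assume "s \<in> S"
      then have "W s \<in> borel_measurable M" using E(3) t by (intro measurable_W) auto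
      then show "{\<omega> \<in> space M. W s \<omega> \<in> B s} \<in> events" by (rule measurable_Collect_mem) (rule E(4))
    qed
    have s2: "H \<in> events" unfolding H using H(2) by (rule measurable_sets[OF mt])
    have H': "H = {\<omega> \<in> space M. W t' \<omega> - W t \<omega> \<in> D}" unfolding H by auto
    have "prob (E \<inter> H) = prob {\<omega> \<in> space M. (\<forall>s\<in>S. W s \<omega> \<in> B s) \<and> W t' \<omega> - W t \<omega> \<in> D}"
    proof (rule measure_eq_AE)
      show "E \<inter> H \<in> events" using E(1) s2 by simp
      show "{\<omega> \<in> space M. (\<forall>s\<in>S. W s \<omega> \<in> B s) \<and> W t' \<omega> - W t \<omega> \<in> D} \<in> events"
        by (rule rev_iffD1[OF sets.Int[OF s1 s2] arg_cong[of _ _ "\<lambda>A. A \<in> events"]]) (auto simp: H')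
      show "AE \<omega> in M. \<omega> \<in> E \<inter> H \<longleftrightarrow> \<omega> \<in> {\<omega> \<in> space M. (\<forall>s\<in>S. W s \<omega> \<in> B s) \<and> W t' \<omega> - W t \<omega> \<in> D}"
        using E(5) by eventually_elim (auto simp: H')
    qed
    also have "\<dots> = prob {\<omega> \<in> space M. \<forall>s\<in>S. W s \<omega> \<in> B s} * prob H"
      unfolding H' by (rule cylinder_increment_indep[OF E(2,3) t E(4) H(2)])
    also have "prob {\<omega> \<in> space M. \<forall>s\<in>S. W s \<omega> \<in> B s} = prob E"
    proof (rule measure_eq_AE[OF _ s1 E(1)])
      show "AE \<omega> in M. \<omega> \<in> {\<omega> \<in> space M. \<forall>s\<in>S. W s \<omega> \<in> B s} \<longleftrightarrow> \<omega> \<in> E"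
        using E(5) AE_space by eventually_elim auto
    qed
    finally show "prob (E \<inter> H) = prob E * prob H" .
  qed
  moreover have "Int_stable ?G"
  proof (rule Int_stableI)
    fix a c assume "a \<in> ?G" "c \<in> ?G"
    then obtain A C where "a = ?D -` A \<inter> space M" "c = ?D -` C \<inter> space M" "A \<in> sets borel" "C \<in> sets borel"
      by blast
    then show "a \<inter> c \<in> ?G" by (intro CollectI exI[of _ "A \<inter> C"]) auto
  qed
  ultimately have "indep_set (sigma_sets (space M) (ae_cylinders t)) (sigma_sets (space M) ?G)"
    by (intro indep_set_sigma_sets Int_stable_ae_cylinders)
  then have ind: "indep_set (sets (augmented_filtration M W t)) (sigma_sets (space M) ?G)"
    using augmented_filtration_subset_ae_cylinders[of t] t
    unfolding indep_sets2_eq by auto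
  show ?thesis
  proof (rule indep_setD[OF ind])
    show "V -` A \<inter> space M \<in> sets (augmented_filtration M W t)"
      using measurable_sets[OF V A] by simp
    show "?D -` D \<inter> space M \<in> sigma_sets (space M) ?G"
      using D by (intro sigma_sets.Basic) auto
  qed
qed

section \<open>Freezing the past\<close>

definition scaled_increment :: "real \<Rightarrow> real \<Rightarrow> 'a \<Rightarrow> real^'d" where
  "scaled_increment t t' \<omega> = (1 / sqrt (t' - t)) *\<^sub>R (W t' \<omega> - W t \<omega>)"

lemma distr_scaled_increment:
  assumes t: "0 \<le> t" "t < t'" "t' \<le> T"
  shows "distr M borel (scaled_increment t t') = gaussian"
proof -
  note d = normal_increments_W[OF t]
  have m: "(\<lambda>\<omega>. W t' \<omega> - W t \<omega>) \<in> measurable M lborel" using d by (simp add: distributed_def)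
  have 1: "distr M lborel (\<lambda>\<omega>. W t' \<omega> - W t \<omega>)
      = density lborel (\<lambda>x. ennreal (\<Prod>i\<in>UNIV. normal_density 0 (sqrt (t' - t)) (x $ i)))"
    using d by (simp add: distributed_def)
  have 2: "(\<lambda>x. (1 / sqrt (t' - t)) *\<^sub>R x) \<in> measurable lborel borel" by simp
  have "distr M borel (scaled_increment t t')
      = distr (distr M lborel (\<lambda>\<omega>. W t' \<omega> - W t \<omega>)) borel (\<lambda>x. (1 / sqrt (t' - t)) *\<^sub>R x)"
    unfolding distr_distr[OF 2 m] comp_def scaled_increment_def[abs_def] ..
  then show ?thesis
    unfolding 1 using distr_gaussian_scaled[of "sqrt (t' - t)"] t by simp
qed

lemma measurable_scaled_increment:
  assumes t: "0 \<le> t" "t < t'" "t' \<le> r"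
  shows "scaled_increment t t' \<in> borel_measurable (augmented_filtration M W r)"
  unfolding scaled_increment_def[abs_def]
  using t by (intro borel_measurable_scaleR borel_measurable_diff measurable_augmented_filtration_W) auto

text \<open>Independence fixes the joint law on rectangles, and these determine the product
  measure.\<close>

lemma distr_past_increment:
  fixes V :: "'a \<Rightarrow> 'c::second_countable_topology"
  assumes t: "0 \<le> t" "t < t'" "t' \<le> T" and V: "V \<in> borel_measurable (augmented_filtration M W t)"
  shows "distr M (borel \<Otimes>\<^sub>M borel) (\<lambda>\<omega>. (V \<omega>, scaled_increment t t' \<omega>)) = distr M borel V \<Otimes>\<^sub>M gaussian"
proof (rule sym, rule pair_measure_eqI)
  have mV [measurable]: "V \<in> borel_measurable M" using measurable_augmented_filtration_le[OF _ V] t by simp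
  have mS [measurable]: "scaled_increment t t' \<in> borel_measurable M"
    using measurable_augmented_filtration_le[OF t(3) measurable_scaled_increment[OF t(1,2) order_refl]] .
  interpret V: prob_space "distr M borel V" by (rule prob_space_distr) simp
  interpret g: prob_space "gaussian :: (real^'d) measure" by (rule prob_space_gaussian)
  show "sigma_finite_measure (distr M borel V)" "sigma_finite_measure (gaussian :: (real^'d) measure)"
    by unfold_locales
  show "sets (distr M borel V \<Otimes>\<^sub>M gaussian) = sets (distr M (borel \<Otimes>\<^sub>M borel) (\<lambda>\<omega>. (V \<omega>, scaled_increment t t' \<omega>)))"
    unfolding sets_distr by (rule sets_pair_measure_cong) simp_all
  fix A :: "'c set" and B :: "(real^'d) set"
  assume "A \<in> sets (distr M borel V)" "B \<in> sets gaussian"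
  then have A [measurable]: "A \<in> sets borel" and B [measurable]: "B \<in> sets borel" by simp_all
  define D where "D = (\<lambda>x. (1 / sqrt (t' - t)) *\<^sub>R x) -` B"
  have D: "D \<in> sets borel"
    using measurable_sets[of "\<lambda>x. (1 / sqrt (t' - t)) *\<^sub>R x" borel borel B] B by (simp add: D_def)
  have SB: "scaled_increment t t' -` B \<inter> space M = (\<lambda>\<omega>. W t' \<omega> - W t \<omega>) -` D \<inter> space M"
    by (auto simp: D_def scaled_increment_def)
  have "emeasure (distr M (borel \<Otimes>\<^sub>M borel) (\<lambda>\<omega>. (V \<omega>, scaled_increment t t' \<omega>))) (A \<times> B)
      = emeasure M ((V -` A \<inter> space M) \<inter> (scaled_increment t t' -` B \<inter> space M))"
  proof -
    have "(\<lambda>\<omega>. (V \<omega>, scaled_increment t t' \<omega>)) -` (A \<times> B) \<inter> space M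
        = (V -` A \<inter> space M) \<inter> (scaled_increment t t' -` B \<inter> space M)" by auto
    moreover have "(\<lambda>\<omega>. (V \<omega>, scaled_increment t t' \<omega>)) \<in> measurable M (borel \<Otimes>\<^sub>M borel)" by measurable
    ultimately show ?thesis using A B by (simp add: emeasure_distr)
  qed
  also have "\<dots> = emeasure M (V -` A \<inter> space M) * emeasure M (scaled_increment t t' -` B \<inter> space M)"
    unfolding emeasure_eq_measure SB indep_increment[OF t V A D] by (simp add: ennreal_mult)
  also have "\<dots> = emeasure (distr M borel V) A * emeasure gaussian B"
    unfolding distr_scaled_increment[OF t, symmetric] by (simp add: emeasure_distr)
  finally show "emeasure (distr M borel V) A * emeasure gaussian B
      = emeasure (distr M (borel \<Otimes>\<^sub>M borel) (\<lambda>\<omega>. (V \<omega>, scaled_increment t t' \<omega>))) (A \<times> B)" by simp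
qed

text \<open>The substitute for conditional expectations: with \<open>V\<close> known at time
  \<open>t\<close>, the mean over the next increment is a Gaussian integral with \<open>V\<close>
  frozen. The majorant \<open>H\<close> of the inner absolute moment, integrable along
  \<open>V\<close>, is what Fubini asks for.\<close>

lemma past_increment_expectation:
  fixes V :: "'a \<Rightarrow> 'c::second_countable_topology" and F :: "'c \<Rightarrow> real^'d \<Rightarrow> real"
  assumes t: "0 \<le> t" "t < t'" "t' \<le> T" and V: "V \<in> borel_measurable (augmented_filtration M W t)"
    and F: "case_prod F \<in> borel_measurable (borel \<Otimes>\<^sub>M borel)"
    and bound: "\<And>v. integrable gaussian (F v)" "\<And>v. (\<integral>\<xi>. \<bar>F v \<xi>\<bar> \<partial>gaussian) \<le> H v"
    and H: "integrable M (\<lambda>\<omega>. H (V \<omega>))"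
  shows "integrable M (\<lambda>\<omega>. F (V \<omega>) (scaled_increment t t' \<omega>))"
    and "integrable M (\<lambda>\<omega>. \<integral>\<xi>. F (V \<omega>) \<xi> \<partial>gaussian)"
    and "(\<integral>\<omega>. F (V \<omega>) (scaled_increment t t' \<omega>) \<partial>M) = (\<integral>\<omega>. (\<integral>\<xi>. F (V \<omega>) \<xi> \<partial>gaussian) \<partial>M)"
proof -
  have mV [measurable]: "V \<in> borel_measurable M" using measurable_augmented_filtration_le[OF _ V] t by simp
  have mS [measurable]: "scaled_increment t t' \<in> borel_measurable M"
    using measurable_augmented_filtration_le[OF t(3) measurable_scaled_increment[OF t(1,2) order_refl]] .
  interpret V: prob_space "distr M borel V" by (rule prob_space_distr) simp
  interpret g: prob_space "gaussian :: (real^'d) measure" by (rule prob_space_gaussian)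
  interpret P: pair_sigma_finite "distr M borel V" "gaussian :: (real^'d) measure" by unfold_locales
  have cong: "sets (distr M borel V \<Otimes>\<^sub>M (gaussian :: (real^'d) measure)) = sets (borel \<Otimes>\<^sub>M borel)"
    by (rule sets_pair_measure_cong) simp_all
  have F' [measurable]: "case_prod F \<in> borel_measurable (distr M borel V \<Otimes>\<^sub>M gaussian)"
    using F unfolding measurable_cong_sets[OF cong refl] .
  have F'': "case_prod F \<in> borel_measurable (borel \<Otimes>\<^sub>M gaussian)"
    using F unfolding measurable_cong_sets[OF sets_pair_measure_cong[OF refl sets_gaussian] refl] .
  have "(\<lambda>(v, \<xi>). \<bar>F v \<xi>\<bar>) \<in> borel_measurable (borel \<Otimes>\<^sub>M gaussian)"
    using borel_measurable_abs[OF F''] by (simp add: case_prod_unfold)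
  then have mA: "(\<lambda>v. \<integral>\<xi>. \<bar>F v \<xi>\<bar> \<partial>gaussian) \<in> borel_measurable borel"
    by (rule g.borel_measurable_lebesgue_integral)
  have mI: "(\<lambda>v. \<integral>\<xi>. F v \<xi> \<partial>gaussian) \<in> borel_measurable borel"
    by (rule g.borel_measurable_lebesgue_integral[OF F''])
  have iA: "integrable M (\<lambda>\<omega>. \<integral>\<xi>. \<bar>F (V \<omega>) \<xi>\<bar> \<partial>gaussian)"
  proof (rule Bochner_Integration.integrable_bound[OF H])
    show "AE \<omega> in M. norm (\<integral>\<xi>. \<bar>F (V \<omega>) \<xi>\<bar> \<partial>gaussian) \<le> norm (H (V \<omega>))"
    proof (rule AE_I2)
      fix \<omega>
      have "0 \<le> (\<integral>\<xi>. \<bar>F (V \<omega>) \<xi>\<bar> \<partial>gaussian)" by simp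
      then show "norm (\<integral>\<xi>. \<bar>F (V \<omega>) \<xi>\<bar> \<partial>gaussian) \<le> norm (H (V \<omega>))"
        using bound(2)[of "V \<omega>"] unfolding real_norm_def by linarith
    qed
  qed (use measurable_compose[OF mV mA] in simp)
  have iF: "integrable (distr M borel V \<Otimes>\<^sub>M gaussian) (case_prod F)"
  proof (rule P.Fubini_integrable[OF F'])
    show "integrable (distr M borel V) (\<lambda>v. \<integral>\<xi>. norm (case (v, \<xi>) of (v, \<xi>) \<Rightarrow> F v \<xi>) \<partial>gaussian)"
      using iA mA by (simp add: integrable_distr_eq)
    show "AE v in distr M borel V. integrable gaussian (\<lambda>\<xi>. case (v, \<xi>) of (v, \<xi>) \<Rightarrow> F v \<xi>)"
      using bound(1) by simp
  qed
  note d = distr_past_increment[OF t V]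
  have mp: "(\<lambda>\<omega>. (V \<omega>, scaled_increment t t' \<omega>)) \<in> measurable M (borel \<Otimes>\<^sub>M borel)" by measurable
  show "integrable M (\<lambda>\<omega>. F (V \<omega>) (scaled_increment t t' \<omega>))"
    using iF integrable_distr_eq[OF mp F] unfolding d[symmetric] by simp
  show "integrable M (\<lambda>\<omega>. \<integral>\<xi>. F (V \<omega>) \<xi> \<partial>gaussian)"
    using P.integrable_fst'[OF iF] mI by (simp add: integrable_distr_eq)
  have "(\<integral>\<omega>. F (V \<omega>) (scaled_increment t t' \<omega>) \<partial>M) = integral\<^sup>L (distr M borel V \<Otimes>\<^sub>M gaussian) (case_prod F)"
    unfolding d[symmetric] using integral_distr[OF mp F] by simp
  also have "\<dots> = (\<integral>v. (\<integral>\<xi>. F v \<xi> \<partial>gaussian) \<partial>distr M borel V)"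
    using P.integral_fst'[OF iF] by simp
  also have "\<dots> = (\<integral>\<omega>. (\<integral>\<xi>. F (V \<omega>) \<xi> \<partial>gaussian) \<partial>M)"
    using mI by (simp add: integral_distr)
  finally show "(\<integral>\<omega>. F (V \<omega>) (scaled_increment t t' \<omega>) \<partial>M) = (\<integral>\<omega>. (\<integral>\<xi>. F (V \<omega>) \<xi> \<partial>gaussian) \<partial>M)" .
qed

end

section \<open>Gaussian second moments of one step\<close>

text \<open>Converts the weights of the one-step estimates into powers of
  \<open>1 + (norm x)\<^sup>2\<close>, the form in which moments propagate along the chain.\<close>

lemma one_plus_norm_power_le: "(1 + norm x) ^ (2 * k) \<le> 2 ^ k * (1 + (norm x)\<^sup>2) ^ k"
proof -
  have "(1 + norm x)\<^sup>2 \<le> 2 * (1 + (norm x)\<^sup>2)"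
    using sum_squares_bound[of 1 "norm x"] by (simp add: power2_sum)
  from power_mono[OF this zero_le_power2, of k] show ?thesis by (simp only: power_mult power_mult_distrib)
qed

context parabolic_problem
begin

text \<open>With \<open>h = \<tau>\<^sup>2\<close>, the conditional expectation of \<open>u\<close>
  at the next grid point, given that the Euler chain is at \<open>x\<close>.\<close>

definition mean_step :: "real \<Rightarrow> real \<Rightarrow> real^'d \<Rightarrow> real" where
  "mean_step t \<tau> x = (\<integral>\<xi>. u (t + \<tau>\<^sup>2) (step t x \<tau> \<xi>) \<partial>gaussian)"

text \<open>The centred one-step fluctuation of \<open>u\<close> minus the increment
  \<open>z \<bullet> \<Delta>W\<close> subtracted by the backward scheme, where the Brownian
  increment is \<open>\<tau> *\<^sub>R \<xi>\<close>.\<close>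

definition noise :: "real \<Rightarrow> real \<Rightarrow> real^'d \<Rightarrow> real^'d \<Rightarrow> real^'d \<Rightarrow> real" where
  "noise t \<tau> x z \<xi> = u (t + \<tau>\<^sup>2) (step t x \<tau> \<xi>) - mean_step t \<tau> x - \<tau> * (z \<bullet> \<xi>)"

lemma continuous_step_joint:
  "t \<in> {0..T} \<Longrightarrow> continuous_on UNIV (\<lambda>p. step t (fst p) \<tau> (snd p))"
  unfolding step_def
  by (intro continuous_intros continuous_on_compose2[OF continuous_coefficients(1)]
      continuous_on_compose2[OF continuous_coefficients(2)]) auto

lemma measurable_step_joint:
  fixes F :: "real^'d \<Rightarrow> 'x::topological_space"
  assumes "t \<in> {0..T}" "continuous_on UNIV F"
  shows "(\<lambda>(x, \<xi>). F (step t x \<tau> \<xi>)) \<in> borel_measurable (borel \<Otimes>\<^sub>M borel)"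
proof -
  have "continuous_on UNIV (\<lambda>p. F (step t (fst p) \<tau> (snd p)))"
    by (rule continuous_on_compose2[OF assms(2) continuous_step_joint[OF assms(1)]]) auto
  then show ?thesis
    unfolding borel_prod case_prod_unfold by (rule borel_measurable_continuous_onI)
qed

lemma measurable_mean_step:
  assumes "t \<in> {0..T}" "t + \<tau>\<^sup>2 \<in> {0..T}"
  shows "mean_step t \<tau> \<in> borel_measurable borel"
proof -
  interpret g: prob_space "gaussian :: (real^'d) measure" by (rule prob_space_gaussian)
  have "(\<lambda>(x, \<xi>). u (t + \<tau>\<^sup>2) (step t x \<tau> \<xi>)) \<in> borel_measurable (borel \<Otimes>\<^sub>M gaussian)"
    using measurable_step_joint[OF assms(1) continuous_slices(1)[OF assms(2)]]
    unfolding measurable_cong_sets[OF sets_pair_measure_cong[OF refl sets_gaussian] refl] .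
  then show ?thesis unfolding mean_step_def[abs_def] by (rule g.borel_measurable_lebesgue_integral)
qed

lemma integrable_gaussian_inner: "integrable gaussian (\<lambda>\<xi>. (a :: real^'d) \<bullet> \<xi>)"
  by (rule integrable_gaussian_bound[of _ "norm a" 1])
    (auto intro!: order_trans[OF Cauchy_Schwarz_ineq2] mult_left_mono)

text \<open>The noise is the centred Taylor remainder \<open>D\<close>, of order
  \<open>\<tau>\<^sup>2\<close>, plus \<tau> times \<open>(w t x - z) \<bullet> \<xi>\<close>: the
  leading fluctuation of \<open>u\<close> is cancelled up to the error in \<open>z\<close>. Both
  parts have mean zero.\<close>

lemma noise_moments:
  "\<exists>C\<ge>0. \<forall>t\<in>{0..T}. \<forall>\<tau>\<in>{0..sqrt T}. \<forall>x z. t + \<tau>\<^sup>2 \<le> T \<longrightarrow>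
     integrable gaussian (noise t \<tau> x z) \<and> (\<integral>\<xi>. noise t \<tau> x z \<xi> \<partial>gaussian) = 0 \<and>
     integrable gaussian (\<lambda>\<xi>. (noise t \<tau> x z \<xi>)\<^sup>2) \<and>
     (\<integral>\<xi>. (noise t \<tau> x z \<xi>)\<^sup>2 \<partial>gaussian) \<le> C * (\<tau> ^ 4 * (1 + (norm x)\<^sup>2) ^ 3 + \<tau>\<^sup>2 * (norm (w t x - z))\<^sup>2)"
proof -
  obtain A where A: "A \<ge> 0" "\<And>t \<tau> x \<xi>. t \<in> {0..T} \<Longrightarrow> \<tau> \<in> {0..sqrt T} \<Longrightarrow> t + \<tau>\<^sup>2 \<le> T \<Longrightarrow>
      \<bar>u (t + \<tau>\<^sup>2) (step t x \<tau> \<xi>) - u t x - \<tau> * (w t x \<bullet> \<xi>)\<bar> \<le> A * \<tau>\<^sup>2 * weight x \<xi> ^ 3"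
    using u_step_taylor by blast
  interpret gaussian: prob_space "gaussian :: (real^'d) measure" by (rule prob_space_gaussian)
  define m where "m k = (\<integral>\<xi>. (1 + norm \<xi>) ^ k \<partial>(gaussian :: (real^'d) measure))" for k
  have m: "m k \<ge> 0" for k unfolding m_def by simp
  \<comment> \<open>The 16 is 2 from squaring a sum of two terms, times \<open>2 ^ 3\<close> from
    \<open>one_plus_norm_power_le\<close>. Centring \<open>D\<close> replaces \<open>A\<close> by
    \<open>A * (1 + m 3)\<close>.\<close>
  let ?C = "16 * (A * (1 + m 3))\<^sup>2 * m 6 + 2 * m 2"
  have "integrable gaussian (noise t \<tau> x z) \<and> (\<integral>\<xi>. noise t \<tau> x z \<xi> \<partial>gaussian) = 0 \<and>
     integrable gaussian (\<lambda>\<xi>. (noise t \<tau> x z \<xi>)\<^sup>2) \<and>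
     (\<integral>\<xi>. (noise t \<tau> x z \<xi>)\<^sup>2 \<partial>gaussian) \<le> ?C * (\<tau> ^ 4 * (1 + (norm x)\<^sup>2) ^ 3 + \<tau>\<^sup>2 * (norm (w t x - z))\<^sup>2)"
    if t: "t \<in> {0..T}" and \<tau>: "\<tau> \<in> {0..sqrt T}" and t\<tau>: "t + \<tau>\<^sup>2 \<le> T" for t \<tau> x z
  proof -
    have s: "t + \<tau>\<^sup>2 \<in> {0..T}" using t t\<tau> by auto
    define D where "D \<xi> = u (t + \<tau>\<^sup>2) (step t x \<tau> \<xi>) - u t x - \<tau> * (w t x \<bullet> \<xi>)" for \<xi>
    have iu: "integrable gaussian (\<lambda>\<xi>. u (t + \<tau>\<^sup>2) (step t x \<tau> \<xi>))"
      by (rule u_step_integrable[OF t \<tau> t\<tau>])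
    have cu: "continuous_on UNIV (\<lambda>\<xi>. u (t + \<tau>\<^sup>2) (step t x \<tau> \<xi>))"
      by (rule continuous_on_compose2[OF continuous_slices(1)[OF s] continuous_step]) auto
    have mD: "D \<in> borel_measurable borel"
      unfolding D_def[abs_def] by (intro borel_measurable_continuous_onI continuous_intros cu)
    have D1: "\<bar>D \<xi>\<bar> \<le> A * \<tau>\<^sup>2 * weight x \<xi> ^ 3" for \<xi>
      unfolding D_def by (rule A(2)[OF t \<tau> t\<tau>])
    have D2: "(\<integral>\<xi>. D \<xi> \<partial>gaussian) = mean_step t \<tau> x - u t x"
      using iu integrable_gaussian_inner
      by (simp add: D_def mean_step_def integral_gaussian_inner gaussian.prob_space[simplified])
    have D3: "\<bar>mean_step t \<tau> x - u t x\<bar> \<le> A * \<tau>\<^sup>2 * m 3 * (1 + norm x) ^ 3"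
      unfolding D2[symmetric] m_def by (rule gaussian_weight_bound(2)[OF mD D1])
    have n: "noise t \<tau> x z \<xi> = (D \<xi> - (mean_step t \<tau> x - u t x)) + \<tau> * ((w t x - z) \<bullet> \<xi>)" for \<xi>
      by (simp add: noise_def D_def inner_diff_left right_diff_distrib)
    have D4: "\<bar>D \<xi> - (mean_step t \<tau> x - u t x)\<bar> \<le> (A * (1 + m 3)) * \<tau>\<^sup>2 * weight x \<xi> ^ 3" for \<xi>
    proof -
      have "A * \<tau>\<^sup>2 * m 3 * (1 + norm x) ^ 3 \<le> A * \<tau>\<^sup>2 * m 3 * weight x \<xi> ^ 3"
        using A(1) m by (intro mult_left_mono power_mono weight_ge) auto
      then have "\<bar>D \<xi> - (mean_step t \<tau> x - u t x)\<bar> \<le> A * \<tau>\<^sup>2 * weight x \<xi> ^ 3 + A * \<tau>\<^sup>2 * m 3 * weight x \<xi> ^ 3"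
        using D1[of \<xi>] D3 by linarith
      also have "\<dots> = (A * (1 + m 3)) * \<tau>\<^sup>2 * weight x \<xi> ^ 3" by (simp add: distrib_left distrib_right mult_ac)
      finally show ?thesis .
    qed
    let ?Q = "\<lambda>\<xi>. 2 * ((A * (1 + m 3))\<^sup>2 * \<tau> ^ 4) * weight x \<xi> ^ 6 + 2 * \<tau>\<^sup>2 * (norm (w t x - z))\<^sup>2 * (1 + norm \<xi>) ^ 2"
    have n2: "(noise t \<tau> x z \<xi>)\<^sup>2 \<le> ?Q \<xi>" for \<xi>
    proof -
      have "(D \<xi> - (mean_step t \<tau> x - u t x))\<^sup>2 \<le> ((A * (1 + m 3)) * \<tau>\<^sup>2 * weight x \<xi> ^ 3)\<^sup>2"
        using power_mono[OF D4[of \<xi>], of 2] by simp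
      also have "\<dots> = (A * (1 + m 3))\<^sup>2 * \<tau> ^ 4 * weight x \<xi> ^ 6"
        unfolding power_mult_distrib[of _ "weight x \<xi> ^ 3"] power_mult_distrib[of _ "\<tau>\<^sup>2"] power_mult[symmetric] by simp
      finally have 1: "(D \<xi> - (mean_step t \<tau> x - u t x))\<^sup>2 \<le> (A * (1 + m 3))\<^sup>2 * \<tau> ^ 4 * weight x \<xi> ^ 6" .
      have "\<bar>(w t x - z) \<bullet> \<xi>\<bar> \<le> norm (w t x - z) * (1 + norm \<xi>)"
        by (intro order_trans[OF Cauchy_Schwarz_ineq2] mult_left_mono) auto
      from power_mono[OF this, of 2] have "((w t x - z) \<bullet> \<xi>)\<^sup>2 \<le> (norm (w t x - z))\<^sup>2 * (1 + norm \<xi>)\<^sup>2"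
        by (simp add: power_mult_distrib)
      from mult_left_mono[OF this, of "\<tau>\<^sup>2"]
      have 2: "(\<tau> * ((w t x - z) \<bullet> \<xi>))\<^sup>2 \<le> \<tau>\<^sup>2 * (norm (w t x - z))\<^sup>2 * (1 + norm \<xi>)\<^sup>2"
        by (simp add: power_mult_distrib mult.assoc)
      have "(p + q)\<^sup>2 \<le> 2 * p\<^sup>2 + 2 * q\<^sup>2" for p q :: real
        using sum_squares_bound[of p q] by (simp add: power2_sum)
      then have "(noise t \<tau> x z \<xi>)\<^sup>2 \<le> 2 * (D \<xi> - (mean_step t \<tau> x - u t x))\<^sup>2 + 2 * (\<tau> * ((w t x - z) \<bullet> \<xi>))\<^sup>2"
        unfolding n .
      then show ?thesis using 1 2 by linarith
    qed
    have mn: "noise t \<tau> x z \<in> borel_measurable borel"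
      unfolding noise_def[abs_def] by (intro borel_measurable_continuous_onI continuous_intros cu)
    have iQ: "integrable gaussian ?Q"
      using gaussian_weight_integrable[of x 6] integrable_gaussian_power[where 'd = 'd, of 2] by simp
    have 1: "integrable gaussian (noise t \<tau> x z)"
      unfolding noise_def[abs_def] using iu integrable_gaussian_inner by simp
    have 2: "(\<integral>\<xi>. noise t \<tau> x z \<xi> \<partial>gaussian) = 0"
      using iu integrable_gaussian_inner
      by (simp add: noise_def mean_step_def integral_gaussian_inner gaussian.prob_space[simplified])
    have 3: "integrable gaussian (\<lambda>\<xi>. (noise t \<tau> x z \<xi>)\<^sup>2)"
    proof (rule Bochner_Integration.integrable_bound[OF iQ])
      show "(\<lambda>\<xi>. (noise t \<tau> x z \<xi>)\<^sup>2) \<in> borel_measurable gaussian"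
        using borel_measurable_power[OF mn, of 2] unfolding measurable_cong_sets[OF sets_gaussian refl] .
      show "AE \<xi> in gaussian. norm ((noise t \<tau> x z \<xi>)\<^sup>2) \<le> norm (?Q \<xi>)"
      proof (rule AE_I2)
        fix \<xi> show "norm ((noise t \<tau> x z \<xi>)\<^sup>2) \<le> norm (?Q \<xi>)"
          using n2[of \<xi>] zero_le_power2[of "noise t \<tau> x z \<xi>"] unfolding real_norm_def by linarith
      qed
    qed
    have "(\<integral>\<xi>. (noise t \<tau> x z \<xi>)\<^sup>2 \<partial>gaussian) \<le> (\<integral>\<xi>. ?Q \<xi> \<partial>gaussian)"
      by (rule integral_mono[OF 3 iQ n2])
    also have "\<dots> = 2 * ((A * (1 + m 3))\<^sup>2 * \<tau> ^ 4) * (m 6 * (1 + norm x) ^ 6) + 2 * \<tau>\<^sup>2 * (norm (w t x - z))\<^sup>2 * m 2"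
      using gaussian_weight_integrable[of x 6] integrable_gaussian_power[where 'd = 'd, of 2]
      by (simp add: m_def power_mult_distrib)
    also have "\<dots> \<le> 2 * ((A * (1 + m 3))\<^sup>2 * \<tau> ^ 4) * (m 6 * (8 * (1 + (norm x)\<^sup>2) ^ 3)) + 2 * \<tau>\<^sup>2 * (norm (w t x - z))\<^sup>2 * m 2"
      using one_plus_norm_power_le[of x 3] m[of 6] by (intro add_right_mono mult_left_mono) auto
    also have "\<dots> = (16 * (A * (1 + m 3))\<^sup>2 * m 6) * (\<tau> ^ 4 * (1 + (norm x)\<^sup>2) ^ 3) + (2 * m 2) * (\<tau>\<^sup>2 * (norm (w t x - z))\<^sup>2)"
      by simp
    also have "\<dots> \<le> ?C * (\<tau> ^ 4 * (1 + (norm x)\<^sup>2) ^ 3) + ?C * (\<tau>\<^sup>2 * (norm (w t x - z))\<^sup>2)"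
      using m[of 6] m[of 2] \<tau> by (intro add_mono mult_right_mono) auto
    finally have 4: "(\<integral>\<xi>. (noise t \<tau> x z \<xi>)\<^sup>2 \<partial>gaussian) \<le> ?C * (\<tau> ^ 4 * (1 + (norm x)\<^sup>2) ^ 3 + \<tau>\<^sup>2 * (norm (w t x - z))\<^sup>2)"
      by (simp only: distrib_left)
    from 1 2 3 4 show ?thesis by blast
  qed
  moreover have "?C \<ge> 0" using m[of 6] m[of 2] by simp
  ultimately show ?thesis by blast
qed

lemma u_step_increment_moment:
  "\<exists>C\<ge>0. \<forall>t\<in>{0..T}. \<forall>\<tau>\<in>{0..sqrt T}. \<forall>x. t + \<tau>\<^sup>2 \<le> T \<longrightarrow>
     integrable gaussian (\<lambda>\<xi>. (u (t + \<tau>\<^sup>2) (step t x \<tau> \<xi>) - u t x)\<^sup>2) \<and>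
     (\<integral>\<xi>. (u (t + \<tau>\<^sup>2) (step t x \<tau> \<xi>) - u t x)\<^sup>2 \<partial>gaussian) \<le> C * \<tau>\<^sup>2 * (1 + (norm x)\<^sup>2) ^ 3"
proof -
  obtain A where A: "A \<ge> 0" "\<And>t x \<tau> \<xi>. t \<in> {0..T} \<Longrightarrow> \<tau> \<in> {0..sqrt T} \<Longrightarrow> t + \<tau>\<^sup>2 \<le> T \<Longrightarrow>
      \<bar>u (t + \<tau>\<^sup>2) (step t x \<tau> \<xi>) - u t x\<bar> \<le> A * \<tau> * weight x \<xi> ^ 3"
    using u_step_increment by blast
  define m where "m = (\<integral>\<xi>. (1 + norm \<xi>) ^ 6 \<partial>(gaussian :: (real^'d) measure))"
  have m: "m \<ge> 0" unfolding m_def by simp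
  have "integrable gaussian (\<lambda>\<xi>. (u (t + \<tau>\<^sup>2) (step t x \<tau> \<xi>) - u t x)\<^sup>2) \<and>
     (\<integral>\<xi>. (u (t + \<tau>\<^sup>2) (step t x \<tau> \<xi>) - u t x)\<^sup>2 \<partial>gaussian) \<le> (8 * A\<^sup>2 * m) * \<tau>\<^sup>2 * (1 + (norm x)\<^sup>2) ^ 3"
    if t: "t \<in> {0..T}" and \<tau>: "\<tau> \<in> {0..sqrt T}" and t\<tau>: "t + \<tau>\<^sup>2 \<le> T" for t \<tau> x
  proof -
    have s: "t + \<tau>\<^sup>2 \<in> {0..T}" using t t\<tau> by auto
    let ?F = "\<lambda>\<xi>. (u (t + \<tau>\<^sup>2) (step t x \<tau> \<xi>) - u t x)\<^sup>2"
    have mF: "?F \<in> borel_measurable borel"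
      by (intro borel_measurable_continuous_onI continuous_intros
          continuous_on_compose2[OF continuous_slices(1)[OF s] continuous_step]) auto
    have bF: "\<bar>?F \<xi>\<bar> \<le> (A\<^sup>2 * \<tau>\<^sup>2) * weight x \<xi> ^ 6" for \<xi>
    proof -
      have "(weight x \<xi> ^ 3)\<^sup>2 = weight x \<xi> ^ 6" unfolding power_mult[symmetric] by simp
      then show ?thesis
        using power_mono[OF A(2)[OF t \<tau> t\<tau>, of x \<xi>], of 2] by (simp add: power_mult_distrib[of _ "weight x \<xi> ^ 3"] power_mult_distrib[of A])
    qed
    note b = gaussian_weight_bound[where F = ?F and C = "A\<^sup>2 * \<tau>\<^sup>2" and k = 6, OF mF bF]
    have "(\<integral>\<xi>. ?F \<xi> \<partial>gaussian) \<le> A\<^sup>2 * \<tau>\<^sup>2 * m * (1 + norm x) ^ 6"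
      using b(2) unfolding m_def by linarith
    also have "\<dots> \<le> A\<^sup>2 * \<tau>\<^sup>2 * m * (8 * (1 + (norm x)\<^sup>2) ^ 3)"
      using one_plus_norm_power_le[of x 3] m by (intro mult_left_mono) auto
    finally show ?thesis using b(1) by (simp add: mult_ac)
  qed
  then show ?thesis using m by (intro exI[of _ "8 * A\<^sup>2 * m"]) auto
qed

end

section \<open>A discrete Gronwall inequality and orthogonal sums\<close>

text \<open>The induction is on the right-hand side of the hypothesis rather than on
  \<open>a k\<close>: going from \<open>Suc k\<close> back to \<open>k\<close> adds
  \<open>c * a (Suc k)\<close>, which is at most \<open>c\<close> times the previous right-hand
  side.\<close>

lemma backward_gronwall:
  fixes a :: "nat \<Rightarrow> real"
  assumes c: "c \<ge> 0" and a: "\<And>k. k \<le> n \<Longrightarrow> a k \<le> B + c * (\<Sum>i\<in>{k..<n}. a (Suc i))" and k: "k \<le> n"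
  shows "a k \<le> B * (1 + c) ^ (n - k)"
proof -
  have "B + c * (\<Sum>i\<in>{k..<n}. a (Suc i)) \<le> B * (1 + c) ^ (n - k)"
    using k
  proof (induction k rule: inc_induct)
    case (step k)
    have "B + c * (\<Sum>i\<in>{k..<n}. a (Suc i)) = (B + c * (\<Sum>i\<in>{Suc k..<n}. a (Suc i))) + c * a (Suc k)"
      using step.hyps by (simp add: sum.atLeast_Suc_lessThan algebra_simps)
    also have "\<dots> \<le> (1 + c) * (B + c * (\<Sum>i\<in>{Suc k..<n}. a (Suc i)))"
      using mult_left_mono[OF a[of "Suc k"] c] step.hyps by (simp add: algebra_simps)
    also have "\<dots> \<le> (1 + c) * (B * (1 + c) ^ (n - Suc k))"
      using step.IH c by (intro mult_left_mono) auto
    also have "\<dots> = B * (1 + c) ^ (n - k)"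
      using step.hyps by (simp add: Suc_diff_Suc[symmetric] mult_ac)
    finally show ?case .
  qed simp
  with a[OF k] show ?thesis by linarith
qed

text \<open>Pythagoras in the space of square-integrable functions; products of two terms are
  integrable by domination through the sum of their squares.\<close>

lemma orthogonal_sum_second_moment:
  fixes N :: "'i \<Rightarrow> 'a \<Rightarrow> real"
  assumes fin: "finite I" and m: "\<And>i. i \<in> I \<Longrightarrow> N i \<in> borel_measurable M"
    and sq: "\<And>i. i \<in> I \<Longrightarrow> integrable M (\<lambda>\<omega>. (N i \<omega>)\<^sup>2)"
    and orth: "\<And>i j. i \<in> I \<Longrightarrow> j \<in> I \<Longrightarrow> i \<noteq> j \<Longrightarrow> (\<integral>\<omega>. N i \<omega> * N j \<omega> \<partial>M) = 0"
  shows "integrable M (\<lambda>\<omega>. (\<Sum>i\<in>I. N i \<omega>)\<^sup>2)"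
    and "(\<integral>\<omega>. (\<Sum>i\<in>I. N i \<omega>)\<^sup>2 \<partial>M) = (\<Sum>i\<in>I. \<integral>\<omega>. (N i \<omega>)\<^sup>2 \<partial>M)"
proof -
  have prod: "integrable M (\<lambda>\<omega>. N i \<omega> * N j \<omega>)" if "i \<in> I" "j \<in> I" for i j
  proof (rule Bochner_Integration.integrable_bound)
    show "integrable M (\<lambda>\<omega>. (N i \<omega>)\<^sup>2 + (N j \<omega>)\<^sup>2)" using sq that by simp
    show "(\<lambda>\<omega>. N i \<omega> * N j \<omega>) \<in> borel_measurable M" using m that by simp
    show "AE \<omega> in M. norm (N i \<omega> * N j \<omega>) \<le> norm ((N i \<omega>)\<^sup>2 + (N j \<omega>)\<^sup>2)"
    proof (rule AE_I2)
      fix \<omega>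
      have "2 * \<bar>N i \<omega>\<bar> * \<bar>N j \<omega>\<bar> \<le> (N i \<omega>)\<^sup>2 + (N j \<omega>)\<^sup>2"
        using sum_squares_bound[of "\<bar>N i \<omega>\<bar>" "\<bar>N j \<omega>\<bar>"] by simp
      moreover have "0 \<le> \<bar>N i \<omega>\<bar> * \<bar>N j \<omega>\<bar>" by simp
      ultimately show "norm (N i \<omega> * N j \<omega>) \<le> norm ((N i \<omega>)\<^sup>2 + (N j \<omega>)\<^sup>2)"
        unfolding real_norm_def abs_mult by linarith
    qed
  qed
  have eq: "(\<Sum>i\<in>I. N i \<omega>)\<^sup>2 = (\<Sum>i\<in>I. \<Sum>j\<in>I. N i \<omega> * N j \<omega>)" for \<omega>
    by (simp add: power2_eq_square sum_product)
  show "integrable M (\<lambda>\<omega>. (\<Sum>i\<in>I. N i \<omega>)\<^sup>2)"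
    unfolding eq using prod by (intro Bochner_Integration.integrable_sum) auto
  have "(\<integral>\<omega>. (\<Sum>i\<in>I. N i \<omega>)\<^sup>2 \<partial>M) = (\<Sum>i\<in>I. \<Sum>j\<in>I. \<integral>\<omega>. N i \<omega> * N j \<omega> \<partial>M)"
    unfolding eq using prod by (subst Bochner_Integration.integral_sum) (auto intro!: sum.cong Bochner_Integration.integral_sum Bochner_Integration.integrable_sum)
  also have "\<dots> = (\<Sum>i\<in>I. \<Sum>j\<in>I. if i = j then \<integral>\<omega>. (N i \<omega>)\<^sup>2 \<partial>M else 0)"
    using orth by (intro sum.cong refl) (auto simp: power2_eq_square)
  also have "\<dots> = (\<Sum>i\<in>I. \<integral>\<omega>. (N i \<omega>)\<^sup>2 \<partial>M)" using fin by simp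
  finally show "(\<integral>\<omega>. (\<Sum>i\<in>I. N i \<omega>)\<^sup>2 \<partial>M) = (\<Sum>i\<in>I. \<integral>\<omega>. (N i \<omega>)\<^sup>2 \<partial>M)" .
qed

section \<open>The error recursion\<close>

locale bsde_scheme = brownian_motion M T W + parabolic_problem T K \<delta> L b \<sigma> f g u
  for M :: "'a measure" and T :: real and W :: "real \<Rightarrow> 'a \<Rightarrow> real^'d::finite"
    and K \<delta> L :: real
    and b :: "real \<Rightarrow> real^'d \<Rightarrow> real^'d"
    and \<sigma> :: "real \<Rightarrow> real^'d \<Rightarrow> real^'d^'d"
    and f :: "real \<Rightarrow> real^'d \<Rightarrow> real \<Rightarrow> real^'d \<Rightarrow> real"
    and g :: "real^'d \<Rightarrow> real"
    and u :: "real \<Rightarrow> real^'d \<Rightarrow> real" +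
  fixes n :: nat and h :: real and x\<^sub>0 :: "real^'d"
    and X Z :: "nat \<Rightarrow> 'a \<Rightarrow> real^'d" and Y :: "nat \<Rightarrow> 'a \<Rightarrow> real"
  assumes n_pos: "1 \<le> n" and h_def: "h = T / real n"
    and g_lipschitz: "lipschitz_on K UNIV g"
    and Z: "\<And>i. i < n \<Longrightarrow> Z i \<in> borel_measurable (augmented_filtration M W (real i * h))"
    and euler: "euler_scheme M W b \<sigma> x\<^sub>0 n h X"
    and backward: "backward_scheme M W f g n h X Z Y"
begin

abbreviation tm :: "nat \<Rightarrow> real" where "tm i \<equiv> real i * h"
abbreviation \<tau> :: real where "\<tau> \<equiv> sqrt h"
abbreviation \<xi> :: "nat \<Rightarrow> 'a \<Rightarrow> real^'d" where "\<xi> i \<equiv> scaled_increment (tm i) (tm (Suc i))"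
abbreviation \<F> :: "nat \<Rightarrow> 'a measure" where "\<F> i \<equiv> augmented_filtration M W (tm i)"

text \<open>Being a Bochner integral, this is 0 by default when the integrand is not integrable. It
  stands for the error in \<open>Z\<close> only where square-integrability of that error is at
  hand.\<close>

definition \<kappa> :: "nat \<Rightarrow> real" where
  "\<kappa> i = (\<integral>\<omega>. (norm (w (tm i) (X i \<omega>) - Z i \<omega>))\<^sup>2 \<partial>M)"

definition err :: "nat \<Rightarrow> 'a \<Rightarrow> real" where
  "err i \<omega> = Y i \<omega> - u (tm i) (X i \<omega>)"

definition N :: "nat \<Rightarrow> 'a \<Rightarrow> real" where
  "N i \<omega> = noise (tm i) \<tau> (X i \<omega>) (Z i \<omega>) (\<xi> i \<omega>)"

text \<open>One-step bias of \<open>u\<close> plus the driver actually used by the scheme. It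
  contains \<open>Y (Suc i)\<close>, hence is not adapted and has no martingale structure to
  exploit.\<close>

definition P :: "nat \<Rightarrow> 'a \<Rightarrow> real" where
  "P i \<omega> = mean_step (tm i) \<tau> (X i \<omega>) - u (tm i) (X i \<omega>)
     + h * f (tm i) (X i \<omega>) (Y (Suc i) \<omega>) (Z i \<omega>)"

section \<open>Time grid, measurability and moments of the scheme\<close>

lemma h_pos: "h > 0" and nh: "real n * h = T"
  using n_pos T_pos by (simp_all add: h_def)

lemma h_le_T: "h \<le> T"
  using mult_right_mono[of 1 "real n" h] h_pos n_pos nh by simp

lemma \<tau>: "\<tau>\<^sup>2 = h" "\<tau> \<in> {0..sqrt T}" "\<tau> ^ 4 = h\<^sup>2" "\<tau> > 0" "\<tau> ^ 3 = h * \<tau>"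
proof -
  show 2: "\<tau>\<^sup>2 = h" using h_pos by simp
  show "\<tau> ^ 4 = h\<^sup>2" using power_mult[of \<tau> 2 2] 2 by simp
  show "\<tau> ^ 3 = h * \<tau>" using 2 by (simp add: power3_eq_cube power2_eq_square)
qed (use h_pos h_le_T in simp_all)

lemma tm: "i \<le> n \<Longrightarrow> tm i \<in> {0..T}"
  using mult_right_mono[of "real i" "real n" h] h_pos nh by simp

lemma tm_Suc: "tm (Suc i) = tm i + h" "tm i + \<tau>\<^sup>2 = tm (Suc i)"
  using \<tau>(1) by (simp_all add: distrib_right)

lemma tm_step:
  assumes "i < n"
  shows "0 \<le> tm i" "tm i < tm (Suc i)" "tm (Suc i) \<le> T" "tm i \<in> {0..T}" "tm (Suc i) \<in> {0..T}" "tm i + \<tau>\<^sup>2 \<le> T"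
proof -
  show 1: "tm i \<in> {0..T}" and 2: "tm (Suc i) \<in> {0..T}" using tm[of i] tm[of "Suc i"] assms by simp_all
  show "0 \<le> tm i" "tm (Suc i) \<le> T" using 1 2 by simp_all
  then show "tm i + \<tau>\<^sup>2 \<le> T" by (simp only: tm_Suc(2))
  show "tm i < tm (Suc i)" unfolding tm_Suc(1) using h_pos by simp
qed

lemma X_0: "\<omega> \<in> space M \<Longrightarrow> X 0 \<omega> = x\<^sub>0"
  using euler by (simp add: euler_scheme_def)

lemma \<xi>_eq: "\<tau> *\<^sub>R \<xi> i \<omega> = W (tm (Suc i)) \<omega> - W (tm i) \<omega>"
proof -
  have "tm (Suc i) - tm i = h" unfolding tm_Suc(1) by simp
  then show ?thesis unfolding scaled_increment_def using \<tau>(4) by simp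
qed

lemma X_Suc:
  assumes "\<omega> \<in> space M" "i < n"
  shows "X (Suc i) \<omega> = step (tm i) (X i \<omega>) \<tau> (\<xi> i \<omega>)"
proof -
  have "\<sigma> (tm i) (X i \<omega>) *v (W (tm (Suc i)) \<omega> - W (tm i) \<omega>) = \<tau> *\<^sub>R (\<sigma> (tm i) (X i \<omega>) *v \<xi> i \<omega>)"
    unfolding \<xi>_eq[symmetric] by (rule matrix_vector_mult_scaleR)
  then show ?thesis using euler assms \<tau>(1) unfolding euler_scheme_def step_def by simp
qed

lemma \<xi>_measurable: "i < n \<Longrightarrow> \<xi> i \<in> borel_measurable (\<F> (Suc i))"
  using tm_step[of i] by (intro measurable_scaled_increment) auto

lemma \<F>_mono: "i \<le> j \<Longrightarrow> V \<in> measurable (\<F> i) S \<Longrightarrow> V \<in> measurable (\<F> j) S"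
  using h_pos by (elim measurable_augmented_filtration_mono[rotated]) (simp add: mult_right_mono)

lemma \<F>_M: "i \<le> n \<Longrightarrow> V \<in> measurable (\<F> i) S \<Longrightarrow> V \<in> measurable M S"
  using tm[of i] by (intro measurable_augmented_filtration_le) auto

lemma X_measurable: "i \<le> n \<Longrightarrow> X i \<in> borel_measurable (\<F> i)"
proof (induction i)
  case 0
  have "X 0 \<in> borel_measurable (\<F> 0) \<longleftrightarrow> (\<lambda>_. x\<^sub>0) \<in> borel_measurable (\<F> 0)"
    by (rule measurable_cong) (simp add: X_0)
  then show ?case by simp
next
  case (Suc i)
  then have i: "i < n" by simp
  have X: "X i \<in> borel_measurable (\<F> (Suc i))"
    using Suc by (intro \<F>_mono[of i "Suc i"]) auto
  have "(\<lambda>\<omega>. (\<lambda>(x, y). step (tm i) x \<tau> y) (X i \<omega>, \<xi> i \<omega>)) \<in> borel_measurable (\<F> (Suc i))"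
    by (rule measurable_compose[OF measurable_Pair[OF X \<xi>_measurable[OF i]]
          measurable_step_joint[OF tm_step(4)[OF i] continuous_on_id]])
  moreover have "X (Suc i) \<in> borel_measurable (\<F> (Suc i))
      \<longleftrightarrow> (\<lambda>\<omega>. (\<lambda>(x, y). step (tm i) x \<tau> y) (X i \<omega>, \<xi> i \<omega>)) \<in> borel_measurable (\<F> (Suc i))"
    by (rule measurable_cong) (simp add: X_Suc[OF _ i])
  ultimately show ?case by simp
qed

lemma X_M: "i \<le> n \<Longrightarrow> X i \<in> borel_measurable M"
  by (rule \<F>_M[OF _ X_measurable])

lemma Z_M: "i < n \<Longrightarrow> Z i \<in> borel_measurable M"
  using Z[of i] \<F>_M[of i] by simp

text \<open>Each step multiplies the moment by at most \<open>1 + C * h\<close>, and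
  \<open>(1 + C * h) ^ i\<close> is at most \<open>exp (C * T)\<close> on the grid. The one-step
  estimate is a premise, so that its constant is chosen before \<open>n\<close>.\<close>

lemma X_moment:
  assumes C: "C \<ge> 0" "\<And>t r x. t \<in> {0..T} \<Longrightarrow> r \<in> {0..sqrt T} \<Longrightarrow>
      integrable gaussian (\<lambda>y. (1 + (norm (step t x r y))\<^sup>2) ^ q) \<and>
      (\<integral>y. (1 + (norm (step t x r y))\<^sup>2) ^ q \<partial>gaussian) \<le> (1 + C * r\<^sup>2) * (1 + (norm x)\<^sup>2) ^ q"
    and i: "i \<le> n"
  shows "integrable M (\<lambda>\<omega>. (1 + (norm (X i \<omega>))\<^sup>2) ^ q)"
    and "(\<integral>\<omega>. (1 + (norm (X i \<omega>))\<^sup>2) ^ q \<partial>M) \<le> exp (C * T) * (1 + (norm x\<^sub>0)\<^sup>2) ^ q"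
proof -
  have "integrable M (\<lambda>\<omega>. (1 + (norm (X i \<omega>))\<^sup>2) ^ q) \<and>
      (\<integral>\<omega>. (1 + (norm (X i \<omega>))\<^sup>2) ^ q \<partial>M) \<le> (1 + C * h) ^ i * (1 + (norm x\<^sub>0)\<^sup>2) ^ q"
    using i
  proof (induction i)
    case 0
    have "integrable M (\<lambda>\<omega>. (1 + (norm (X 0 \<omega>))\<^sup>2) ^ q) \<longleftrightarrow> integrable M (\<lambda>\<omega>. (1 + (norm x\<^sub>0)\<^sup>2) ^ q)"
      by (rule Bochner_Integration.integrable_cong[OF refl]) (simp add: X_0)
    moreover have "(\<integral>\<omega>. (1 + (norm (X 0 \<omega>))\<^sup>2) ^ q \<partial>M) = (\<integral>\<omega>. (1 + (norm x\<^sub>0)\<^sup>2) ^ q \<partial>M)"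
      by (rule Bochner_Integration.integral_cong[OF refl]) (simp add: X_0)
    ultimately have "integrable M (\<lambda>\<omega>. (1 + (norm (X 0 \<omega>))\<^sup>2) ^ q)"
      "(\<integral>\<omega>. (1 + (norm (X 0 \<omega>))\<^sup>2) ^ q \<partial>M) = (1 + (norm x\<^sub>0)\<^sup>2) ^ q"
      by (simp_all add: prob_space)
    then show ?case by simp
  next
    case (Suc i)
    then have i: "i < n" and IH: "integrable M (\<lambda>\<omega>. (1 + (norm (X i \<omega>))\<^sup>2) ^ q)"
      "(\<integral>\<omega>. (1 + (norm (X i \<omega>))\<^sup>2) ^ q \<partial>M) \<le> (1 + C * h) ^ i * (1 + (norm x\<^sub>0)\<^sup>2) ^ q" by auto
    let ?F = "\<lambda>x y. (1 + (norm (step (tm i) x \<tau> y))\<^sup>2) ^ q"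
    let ?H = "\<lambda>x. (1 + C * h) * (1 + (norm x)\<^sup>2) ^ q"
    have mF: "case_prod ?F \<in> borel_measurable (borel \<Otimes>\<^sub>M borel)"
      by (rule measurable_step_joint[OF tm_step(4)[OF i]]) (intro continuous_intros)
    have b: "integrable gaussian (?F x)" "(\<integral>y. ?F x y \<partial>gaussian) \<le> ?H x" for x
      using C(2)[OF tm_step(4)[OF i] \<tau>(2), of x] \<tau>(1) by auto
    have b': "(\<integral>y. \<bar>?F x y\<bar> \<partial>gaussian) \<le> ?H x" for x using b(2)[of x] by simp
    have H: "integrable M (\<lambda>\<omega>. ?H (X i \<omega>))" using IH(1) by simp
    note e = past_increment_expectation[where F = ?F and H = ?H, OF tm_step(1-3)[OF i]
        X_measurable[OF less_imp_le[OF i]] mF b(1) b' H]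
    have c: "integrable M (\<lambda>\<omega>. (1 + (norm (X (Suc i) \<omega>))\<^sup>2) ^ q) \<longleftrightarrow> integrable M (\<lambda>\<omega>. ?F (X i \<omega>) (\<xi> i \<omega>))"
      "(\<integral>\<omega>. (1 + (norm (X (Suc i) \<omega>))\<^sup>2) ^ q \<partial>M) = (\<integral>\<omega>. ?F (X i \<omega>) (\<xi> i \<omega>) \<partial>M)"
      by (rule Bochner_Integration.integrable_cong[OF refl], simp only: X_Suc[OF _ i])
        (rule Bochner_Integration.integral_cong[OF refl], simp only: X_Suc[OF _ i])
    have "(\<integral>\<omega>. ?F (X i \<omega>) (\<xi> i \<omega>) \<partial>M) \<le> (\<integral>\<omega>. ?H (X i \<omega>) \<partial>M)"
      unfolding e(3) by (rule integral_mono[OF e(2) H b(2)])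
    also have "\<dots> = (1 + C * h) * (\<integral>\<omega>. (1 + (norm (X i \<omega>))\<^sup>2) ^ q \<partial>M)" by simp
    also have "\<dots> \<le> (1 + C * h) * ((1 + C * h) ^ i * (1 + (norm x\<^sub>0)\<^sup>2) ^ q)"
      using IH(2) C(1) h_pos by (intro mult_left_mono) auto
    finally show ?case unfolding c using e(1) by (simp only: power_Suc mult.assoc)
  qed
  moreover have "(1 + C * h) ^ i * (1 + (norm x\<^sub>0)\<^sup>2) ^ q \<le> exp (C * T) * (1 + (norm x\<^sub>0)\<^sup>2) ^ q"
  proof (rule mult_right_mono)
    have "(1 + C * h) ^ i \<le> exp (C * h) ^ i" using C(1) h_pos by (intro power_mono) auto
    also have "\<dots> = exp (C * tm i)" by (simp add: exp_of_nat_mult[symmetric] mult_ac)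
    also have "\<dots> \<le> exp (C * T)" using tm[OF i] C(1) by (simp add: mult_left_mono)
    finally show "(1 + C * h) ^ i \<le> exp (C * T)" .
  qed simp
  ultimately show "integrable M (\<lambda>\<omega>. (1 + (norm (X i \<omega>))\<^sup>2) ^ q)"
    "(\<integral>\<omega>. (1 + (norm (X i \<omega>))\<^sup>2) ^ q \<partial>M) \<le> exp (C * T) * (1 + (norm x\<^sub>0)\<^sup>2) ^ q" by auto
qed

lemma measurable_noise:
  assumes i: "i < n"
  shows "(\<lambda>((x, z), y). noise (tm i) \<tau> x z y) \<in> borel_measurable ((borel \<Otimes>\<^sub>M borel) \<Otimes>\<^sub>M borel)"
proof -
  have s: "tm i + \<tau>\<^sup>2 \<in> {0..T}" using tm_step[OF i] by (simp only: tm_Suc)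
  have 1: "(\<lambda>p. u (tm i + \<tau>\<^sup>2) (step (tm i) (fst (fst p)) \<tau> (snd p)))
      \<in> borel_measurable ((borel \<Otimes>\<^sub>M (borel :: (real^'d) measure)) \<Otimes>\<^sub>M borel)"
    using measurable_compose[OF _ measurable_step_joint[OF tm_step(4)[OF i] continuous_slices(1)[OF s], of \<tau>],
        of "\<lambda>p. (fst (fst p), snd p)" "(borel \<Otimes>\<^sub>M (borel :: (real^'d) measure)) \<Otimes>\<^sub>M borel"] by simp
  have 2: "(\<lambda>p. mean_step (tm i) \<tau> (fst (fst p))) \<in> borel_measurable ((borel \<Otimes>\<^sub>M (borel :: (real^'d) measure)) \<Otimes>\<^sub>M (borel :: (real^'d) measure))"
    by (rule measurable_compose[OF _ measurable_mean_step[OF tm_step(4)[OF i] s]]) measurable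
  show ?thesis
    unfolding noise_def case_prod_unfold using 1 2 by measurable
qed

lemma pair_measurable: "i < n \<Longrightarrow> (\<lambda>\<omega>. (X i \<omega>, Z i \<omega>)) \<in> borel_measurable (\<F> i)"
  using X_measurable[of i] Z[of i] by (simp add: borel_prod[symmetric])

lemma N_measurable: "i < n \<Longrightarrow> N i \<in> borel_measurable (\<F> (Suc i))"
proof -
  assume i: "i < n"
  have "(\<lambda>\<omega>. (\<lambda>((x, z), y). noise (tm i) \<tau> x z y) ((X i \<omega>, Z i \<omega>), \<xi> i \<omega>)) \<in> borel_measurable (\<F> (Suc i))"
    using \<F>_mono[of i "Suc i", OF _ X_measurable] \<F>_mono[of i "Suc i", OF _ Z] \<xi>_measurable[OF i] i
    by (intro measurable_compose[OF _ measurable_noise[OF i]] measurable_Pair) auto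
  then show ?thesis by (simp add: N_def[abs_def])
qed

lemma u_X_measurable: "i \<le> n \<Longrightarrow> (\<lambda>\<omega>. u (tm i) (X i \<omega>)) \<in> borel_measurable M"
  using measurable_compose[OF X_M borel_measurable_continuous_onI[OF continuous_slices(1)[OF tm]]] .

lemma Z_error_measurable:
  assumes i: "i < n"
  shows "(\<lambda>\<omega>. (norm (w (tm i) (X i \<omega>) - Z i \<omega>))\<^sup>2) \<in> borel_measurable M"
proof -
  have "continuous_on UNIV (w (tm i))"
    by (intro continuous_intros continuous_slices(3) continuous_coefficients(2) tm_step(4)[OF i])
  then have "(\<lambda>\<omega>. w (tm i) (X i \<omega>)) \<in> borel_measurable M"
    using measurable_compose[OF X_M[OF less_imp_le[OF i]] borel_measurable_continuous_onI] by blast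
  then show ?thesis using Z_M[OF i] by measurable
qed

text \<open>Backward induction from the terminal value. The measurability is with respect to
  \<open>M\<close> and not to the filtration, as each \<open>Y i\<close> depends on later
  increments.\<close>

lemma Y_measurable:
  assumes "i \<le> n"
  shows "Y i \<in> borel_measurable M"
  using assms
proof (induction i rule: inc_induct)
  case base
  have "(\<lambda>\<omega>. g (X n \<omega>)) \<in> borel_measurable M"
    using measurable_compose[OF X_M[OF order_refl]
        borel_measurable_continuous_onI[OF lipschitz_on_continuous_on[OF g_lipschitz]]] .
  moreover have "Y n \<in> borel_measurable M \<longleftrightarrow> (\<lambda>\<omega>. g (X n \<omega>)) \<in> borel_measurable M"
    by (rule measurable_cong) (use backward in \<open>simp add: backward_scheme_def\<close>)
  ultimately show ?case by simp
next
  case (step i)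
  then have i: "i < n" by simp
  have p: "(\<lambda>\<omega>. (X i \<omega>, Y (Suc i) \<omega>, Z i \<omega>)) \<in> borel_measurable M"
    using X_M[of i] Z_M[OF i] step.IH i by (simp add: borel_prod[symmetric])
  have f: "(\<lambda>\<omega>. f (tm i) (X i \<omega>) (Y (Suc i) \<omega>) (Z i \<omega>)) \<in> borel_measurable M"
    using measurable_compose[OF p borel_measurable_continuous_onI[OF continuous_coefficients(3)[OF tm_step(4)[OF i]]]]
    by simp
  have [measurable]: "W (tm i) \<in> borel_measurable M" "W (tm (Suc i)) \<in> borel_measurable M"
    using tm_step[OF i] by (auto intro: measurable_W)
  have "(\<lambda>\<omega>. Y (Suc i) \<omega> + f (tm i) (X i \<omega>) (Y (Suc i) \<omega>) (Z i \<omega>) * h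
      - Z i \<omega> \<bullet> (W (tm (Suc i)) \<omega> - W (tm i) \<omega>)) \<in> borel_measurable M"
    using f step.IH Z_M[OF i] by measurable
  moreover have "Y i \<in> borel_measurable M \<longleftrightarrow> (\<lambda>\<omega>. Y (Suc i) \<omega> + f (tm i) (X i \<omega>) (Y (Suc i) \<omega>) (Z i \<omega>) * h
      - Z i \<omega> \<bullet> (W (tm (Suc i)) \<omega> - W (tm i) \<omega>)) \<in> borel_measurable M"
    by (rule measurable_cong) (use backward i in \<open>simp add: backward_scheme_def\<close>)
  ultimately show ?case by simp
qed

section \<open>Pathwise error recursion\<close>

lemma err_measurable: "i \<le> n \<Longrightarrow> err i \<in> borel_measurable M"
  unfolding err_def[abs_def] using Y_measurable u_X_measurable by simp

lemma N_M: "i < n \<Longrightarrow> N i \<in> borel_measurable M"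
  using \<F>_M[OF _ N_measurable] by simp

text \<open>By \<open>nh\<close> the last grid point is exactly \<open>T\<close>, where
  \<open>u\<close> coincides with \<open>g\<close>.\<close>

lemma err_n: "\<omega> \<in> space M \<Longrightarrow> err n \<omega> = 0"
  using backward terminal by (simp add: err_def backward_scheme_def nh)

lemma err_step:
  assumes "\<omega> \<in> space M" "i < n"
  shows "err i \<omega> = err (Suc i) \<omega> + N i \<omega> + P i \<omega>"
proof -
  have "Y i \<omega> = Y (Suc i) \<omega> + f (tm i) (X i \<omega>) (Y (Suc i) \<omega>) (Z i \<omega>) * h
      - Z i \<omega> \<bullet> (W (tm (Suc i)) \<omega> - W (tm i) \<omega>)"
    using backward assms by (simp add: backward_scheme_def)
  then have "Y i \<omega> = Y (Suc i) \<omega> + f (tm i) (X i \<omega>) (Y (Suc i) \<omega>) (Z i \<omega>) * h - \<tau> * (Z i \<omega> \<bullet> \<xi> i \<omega>)"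
    unfolding \<xi>_eq[symmetric] inner_scaleR_right .
  moreover have "N i \<omega> = u (tm (Suc i)) (X (Suc i) \<omega>) - mean_step (tm i) \<tau> (X i \<omega>) - \<tau> * (Z i \<omega> \<bullet> \<xi> i \<omega>)"
    unfolding N_def noise_def tm_Suc(2) X_Suc[OF assms] ..
  ultimately show ?thesis by (simp add: err_def P_def)
qed

lemma err_eq_sum:
  assumes "\<omega> \<in> space M" "k \<le> n"
  shows "err k \<omega> = (\<Sum>i\<in>{k..<n}. N i \<omega>) + (\<Sum>i\<in>{k..<n}. P i \<omega>)"
  using assms(2)
proof (induction k rule: inc_induct)
  case base
  then show ?case using err_n[OF assms(1)] by simp
next
  case (step k)
  then show ?case using err_step[OF assms(1) step.hyps(2)] by (simp add: sum.atLeast_Suc_lessThan)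
qed

end

text \<open>The constants are parameters of the locale, so that they cannot depend on \<open>n\<close> or on the choice
  of \<open>Z\<close> when the locale is interpreted.\<close>

locale bsde_scheme_bounds = bsde_scheme +
  fixes C\<^sub>N C\<^sub>E C\<^sub>U M\<^sub>3 M\<^sub>4 :: real
  assumes Z_error: "\<And>i. i < n \<Longrightarrow>
      integrable M (\<lambda>\<omega>. (norm (grad_x u (real i * h) (X i \<omega>) v* \<sigma> (real i * h) (X i \<omega>) - Z i \<omega>))\<^sup>2)"
    and C\<^sub>N: "C\<^sub>N \<ge> 0" "\<And>t r x z. t \<in> {0..T} \<Longrightarrow> r \<in> {0..sqrt T} \<Longrightarrow> t + r\<^sup>2 \<le> T \<Longrightarrow>
      integrable gaussian (noise t r x z) \<and> (\<integral>y. noise t r x z y \<partial>gaussian) = 0 \<and>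
      integrable gaussian (\<lambda>y. (noise t r x z y)\<^sup>2) \<and>
      (\<integral>y. (noise t r x z y)\<^sup>2 \<partial>gaussian) \<le> C\<^sub>N * (r ^ 4 * (1 + (norm x)\<^sup>2) ^ 3 + r\<^sup>2 * (norm (w t x - z))\<^sup>2)"
    and C\<^sub>E: "C\<^sub>E \<ge> 0" "\<And>t r x. t \<ge> 0 \<Longrightarrow> r \<ge> 0 \<Longrightarrow> t + r\<^sup>2 \<le> T \<Longrightarrow>
      \<bar>mean_step t r x - u t x + r\<^sup>2 * f t x (u t x) (w t x)\<bar> \<le> C\<^sub>E * r ^ 3 * (1 + norm x) ^ 4"
    and C\<^sub>U: "C\<^sub>U \<ge> 0" "\<And>t r x. t \<in> {0..T} \<Longrightarrow> r \<in> {0..sqrt T} \<Longrightarrow> t + r\<^sup>2 \<le> T \<Longrightarrow>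
      integrable gaussian (\<lambda>y. (u (t + r\<^sup>2) (step t x r y) - u t x)\<^sup>2) \<and>
      (\<integral>y. (u (t + r\<^sup>2) (step t x r y) - u t x)\<^sup>2 \<partial>gaussian) \<le> C\<^sub>U * r\<^sup>2 * (1 + (norm x)\<^sup>2) ^ 3"
    and M\<^sub>3: "\<And>i. i \<le> n \<Longrightarrow> integrable M (\<lambda>\<omega>. (1 + (norm (X i \<omega>))\<^sup>2) ^ 3)"
      "\<And>i. i \<le> n \<Longrightarrow> (\<integral>\<omega>. (1 + (norm (X i \<omega>))\<^sup>2) ^ 3 \<partial>M) \<le> M\<^sub>3"
    and M\<^sub>4: "\<And>i. i \<le> n \<Longrightarrow> integrable M (\<lambda>\<omega>. (1 + (norm (X i \<omega>))\<^sup>2) ^ 4)"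
      "\<And>i. i \<le> n \<Longrightarrow> (\<integral>\<omega>. (1 + (norm (X i \<omega>))\<^sup>2) ^ 4 \<partial>M) \<le> M\<^sub>4"
begin

abbreviation noise_bound :: "nat \<Rightarrow> real^'b \<Rightarrow> real^'b \<Rightarrow> real" where
  "noise_bound i x z \<equiv> C\<^sub>N * (h\<^sup>2 * (1 + (norm x)\<^sup>2) ^ 3 + h * (norm (w (tm i) x - z))\<^sup>2)"

lemma noise_props:
  assumes "i < n"
  shows "integrable gaussian (noise (tm i) \<tau> x z)" "(\<integral>y. noise (tm i) \<tau> x z y \<partial>gaussian) = 0"
    "integrable gaussian (\<lambda>y. (noise (tm i) \<tau> x z y)\<^sup>2)"
    "(\<integral>y. (noise (tm i) \<tau> x z y)\<^sup>2 \<partial>gaussian) \<le> noise_bound i x z"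
  using C\<^sub>N(2)[OF tm_step(4)[OF assms] \<tau>(2) tm_step(6)[OF assms], of x z]
  unfolding \<tau>(1) \<tau>(3) by blast+

section \<open>Second moments of fluctuation and bias\<close>

lemma noise_bound_integrable:
  assumes "i < n"
  shows "integrable M (\<lambda>\<omega>. noise_bound i (X i \<omega>) (Z i \<omega>))"
    and "(\<integral>\<omega>. noise_bound i (X i \<omega>) (Z i \<omega>) \<partial>M) \<le> C\<^sub>N * (h\<^sup>2 * M\<^sub>3 + h * \<kappa> i)"
proof -
  have i: "integrable M (\<lambda>\<omega>. (1 + (norm (X i \<omega>))\<^sup>2) ^ 3)" "(\<integral>\<omega>. (1 + (norm (X i \<omega>))\<^sup>2) ^ 3 \<partial>M) \<le> M\<^sub>3"
    using M\<^sub>3[of i] assms by auto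
  show "integrable M (\<lambda>\<omega>. noise_bound i (X i \<omega>) (Z i \<omega>))"
    using i(1) Z_error[OF assms] by simp
  have "(\<integral>\<omega>. noise_bound i (X i \<omega>) (Z i \<omega>) \<partial>M)
      = C\<^sub>N * (h\<^sup>2 * (\<integral>\<omega>. (1 + (norm (X i \<omega>))\<^sup>2) ^ 3 \<partial>M) + h * \<kappa> i)"
    using i(1) Z_error[OF assms] by (simp add: \<kappa>_def)
  also have "\<dots> \<le> C\<^sub>N * (h\<^sup>2 * M\<^sub>3 + h * \<kappa> i)"
    using C\<^sub>N(1) i(2) by (intro mult_left_mono add_right_mono) auto
  finally show "(\<integral>\<omega>. noise_bound i (X i \<omega>) (Z i \<omega>) \<partial>M) \<le> C\<^sub>N * (h\<^sup>2 * M\<^sub>3 + h * \<kappa> i)" .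
qed

lemma N_second_moment:
  assumes i: "i < n"
  shows "integrable M (\<lambda>\<omega>. (N i \<omega>)\<^sup>2)" "(\<integral>\<omega>. (N i \<omega>)\<^sup>2 \<partial>M) \<le> C\<^sub>N * (h\<^sup>2 * M\<^sub>3 + h * \<kappa> i)"
proof -
  let ?F = "\<lambda>(x, z) y. (noise (tm i) \<tau> x z y)\<^sup>2" and ?H = "\<lambda>(x, z). noise_bound i x z"
  let ?V = "\<lambda>\<omega>. (X i \<omega>, Z i \<omega>)"
  have "(\<lambda>p. ((\<lambda>((x, z), y). noise (tm i) \<tau> x z y) p)\<^sup>2) \<in> borel_measurable ((borel \<Otimes>\<^sub>M borel) \<Otimes>\<^sub>M borel)"
    by (rule borel_measurable_power[OF measurable_noise[OF i]])
  then have mF: "case_prod ?F \<in> borel_measurable (borel \<Otimes>\<^sub>M borel)"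
    unfolding borel_prod[symmetric] case_prod_unfold .
  have b1: "integrable gaussian (?F v)" for v using noise_props(3)[OF i] by (simp add: case_prod_unfold)
  have b2: "(\<integral>y. \<bar>?F v y\<bar> \<partial>gaussian) \<le> ?H v" for v using noise_props(4)[OF i] by (simp add: case_prod_unfold)
  have b3: "(\<integral>y. ?F v y \<partial>gaussian) \<le> ?H v" for v using noise_props(4)[OF i] by (simp add: case_prod_unfold)
  have H: "integrable M (\<lambda>\<omega>. ?H (?V \<omega>))" using noise_bound_integrable(1)[OF i] by simp
  note e = past_increment_expectation[where F = ?F and H = ?H and V = ?V,
      OF tm_step(1-3)[OF i] pair_measurable[OF i] mF b1 b2 H]
  show "integrable M (\<lambda>\<omega>. (N i \<omega>)\<^sup>2)" using e(1) by (simp add: N_def)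
  have "(\<integral>\<omega>. (N i \<omega>)\<^sup>2 \<partial>M) = (\<integral>\<omega>. (\<integral>y. ?F (?V \<omega>) y \<partial>gaussian) \<partial>M)"
    using e(3) by (simp add: N_def)
  also have "\<dots> \<le> (\<integral>\<omega>. ?H (?V \<omega>) \<partial>M)" by (rule integral_mono[OF e(2) H b3])
  finally show "(\<integral>\<omega>. (N i \<omega>)\<^sup>2 \<partial>M) \<le> C\<^sub>N * (h\<^sup>2 * M\<^sub>3 + h * \<kappa> i)"
    using noise_bound_integrable(2)[OF i] by simp
qed

text \<open>The factor \<open>S\<close> is frozen together with \<open>X i\<close> and
  \<open>Z i\<close>, and the inner integral of the noise is zero. The majorant comes from
  \<open>\<bar>s * p\<bar> \<le> s\<^sup>2 + p\<^sup>2\<close>.\<close>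

lemma N_orthogonal:
  assumes i: "i < n" and S: "S \<in> borel_measurable (\<F> i)" "integrable M (\<lambda>\<omega>. (S \<omega>)\<^sup>2)"
  shows "(\<integral>\<omega>. S \<omega> * N i \<omega> \<partial>M) = 0"
proof -
  let ?F = "\<lambda>(s, x, z) y. s * noise (tm i) \<tau> x z y"
  let ?H = "\<lambda>(s, x, z). s\<^sup>2 + noise_bound i x z"
  let ?V = "\<lambda>\<omega>. (S \<omega>, X i \<omega>, Z i \<omega>)"
  interpret gaussian: prob_space "gaussian :: (real^'b) measure" by (rule prob_space_gaussian)
  have V: "?V \<in> borel_measurable (\<F> i)"
    using measurable_Pair[OF S(1) pair_measurable[OF i]] by (simp add: borel_prod)
  have "(\<lambda>p. fst (fst p) * (\<lambda>((x, z), y). noise (tm i) \<tau> x z y) (snd (fst p), snd p))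
      \<in> borel_measurable ((borel \<Otimes>\<^sub>M (borel \<Otimes>\<^sub>M borel)) \<Otimes>\<^sub>M borel)"
    by (rule borel_measurable_times[OF _ measurable_compose[OF _ measurable_noise[OF i]]]) measurable
  then have mF: "case_prod ?F \<in> borel_measurable (borel \<Otimes>\<^sub>M borel)"
    unfolding borel_prod[symmetric] by (simp add: case_prod_unfold)
  have b1: "integrable gaussian (?F v)" for v
    using noise_props(1)[OF i] by (simp add: case_prod_unfold)
  have b2: "(\<integral>y. \<bar>?F v y\<bar> \<partial>gaussian) \<le> ?H v" for v
  proof -
    obtain s x z where v: "v = (s, x, z)" by (cases v)
    have "(\<integral>y. \<bar>s * noise (tm i) \<tau> x z y\<bar> \<partial>gaussian) \<le> (\<integral>y. s\<^sup>2 + (noise (tm i) \<tau> x z y)\<^sup>2 \<partial>gaussian)"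
    proof (rule integral_mono)
      show "integrable gaussian (\<lambda>y. \<bar>s * noise (tm i) \<tau> x z y\<bar>)" using noise_props(1)[OF i] by simp
      show "integrable gaussian (\<lambda>y. s\<^sup>2 + (noise (tm i) \<tau> x z y)\<^sup>2)" using noise_props(3)[OF i] by simp
      show "\<bar>s * noise (tm i) \<tau> x z y\<bar> \<le> s\<^sup>2 + (noise (tm i) \<tau> x z y)\<^sup>2" for y
      proof -
        have "2 * \<bar>s\<bar> * \<bar>noise (tm i) \<tau> x z y\<bar> \<le> s\<^sup>2 + (noise (tm i) \<tau> x z y)\<^sup>2"
          using sum_squares_bound[of "\<bar>s\<bar>" "\<bar>noise (tm i) \<tau> x z y\<bar>"] by simp
        moreover have "0 \<le> \<bar>s\<bar> * \<bar>noise (tm i) \<tau> x z y\<bar>" by simp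
        ultimately show ?thesis unfolding abs_mult by linarith
      qed
    qed
    also have "\<dots> = s\<^sup>2 + (\<integral>y. (noise (tm i) \<tau> x z y)\<^sup>2 \<partial>gaussian)"
      using noise_props(3)[OF i] by (simp add: gaussian.prob_space[simplified])
    finally show ?thesis using noise_props(4)[OF i, of x z] by (simp add: v)
  qed
  have H: "integrable M (\<lambda>\<omega>. ?H (?V \<omega>))" using noise_bound_integrable(1)[OF i] S(2) by simp
  note e = past_increment_expectation[where F = ?F and H = ?H and V = ?V,
      OF tm_step(1-3)[OF i] V mF b1 b2 H]
  have "(\<integral>\<omega>. S \<omega> * N i \<omega> \<partial>M) = (\<integral>\<omega>. (\<integral>y. ?F (?V \<omega>) y \<partial>gaussian) \<partial>M)"
    using e(3) by (simp add: N_def)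
  also have "\<dots> = 0" using noise_props(2)[OF i] by simp
  finally show ?thesis .
qed

text \<open>For \<open>i < j\<close> the fluctuation \<open>N i\<close> is known at time
  \<open>tm (Suc i)\<close>, hence at \<open>tm j\<close>, and may serve as the factor
  \<open>S\<close> in \<open>N_orthogonal\<close>.\<close>

lemma N_sum_second_moment:
  assumes "k \<le> n"
  shows "integrable M (\<lambda>\<omega>. (\<Sum>i\<in>{k..<n}. N i \<omega>)\<^sup>2)"
    and "(\<integral>\<omega>. (\<Sum>i\<in>{k..<n}. N i \<omega>)\<^sup>2 \<partial>M) = (\<Sum>i\<in>{k..<n}. \<integral>\<omega>. (N i \<omega>)\<^sup>2 \<partial>M)"
proof -
  have lt: "(\<integral>\<omega>. N i \<omega> * N j \<omega> \<partial>M) = 0" if "i < j" "j < n" for i j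
    using N_orthogonal[OF that(2), of "N i"] \<F>_mono[of "Suc i" j, OF _ N_measurable[of i]] N_second_moment(1)[of i] that
    by simp
  have orth: "(\<integral>\<omega>. N i \<omega> * N j \<omega> \<partial>M) = 0" if "i \<in> {k..<n}" "j \<in> {k..<n}" "i \<noteq> j" for i j
    using lt[of i j] lt[of j i] that by (cases "i < j") (auto simp: mult.commute)
  show "integrable M (\<lambda>\<omega>. (\<Sum>i\<in>{k..<n}. N i \<omega>)\<^sup>2)"
    "(\<integral>\<omega>. (\<Sum>i\<in>{k..<n}. N i \<omega>)\<^sup>2 \<partial>M) = (\<Sum>i\<in>{k..<n}. \<integral>\<omega>. (N i \<omega>)\<^sup>2 \<partial>M)"
    by (rule orthogonal_sum_second_moment; (simp add: N_M N_second_moment(1) orth)?)+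
qed

lemma u_increment_second_moment:
  assumes i: "i < n"
  shows "integrable M (\<lambda>\<omega>. (u (tm (Suc i)) (X (Suc i) \<omega>) - u (tm i) (X i \<omega>))\<^sup>2)"
    and "(\<integral>\<omega>. (u (tm (Suc i)) (X (Suc i) \<omega>) - u (tm i) (X i \<omega>))\<^sup>2 \<partial>M) \<le> C\<^sub>U * h * M\<^sub>3"
proof -
  let ?F = "\<lambda>x y. (u (tm i + \<tau>\<^sup>2) (step (tm i) x \<tau> y) - u (tm i) x)\<^sup>2"
  let ?H = "\<lambda>x. C\<^sub>U * h * (1 + (norm x)\<^sup>2) ^ 3"
  have s: "tm i + \<tau>\<^sup>2 \<in> {0..T}" using tm_step[OF i] by (simp only: tm_Suc)
  have ut: "(\<lambda>p. u (tm i) (fst p)) \<in> borel_measurable (borel \<Otimes>\<^sub>M (borel :: (real^'b) measure))"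
    by (rule measurable_compose[OF measurable_fst
          borel_measurable_continuous_onI[OF continuous_slices(1)[OF tm_step(4)[OF i]]]])
  have mF: "case_prod ?F \<in> borel_measurable (borel \<Otimes>\<^sub>M borel)"
    using borel_measurable_power[OF borel_measurable_diff[OF
        measurable_step_joint[OF tm_step(4)[OF i] continuous_slices(1)[OF s], of \<tau>] ut], of 2]
    by (simp add: case_prod_unfold)
  have b: "integrable gaussian (?F x)" "(\<integral>y. ?F x y \<partial>gaussian) \<le> ?H x" for x
    using C\<^sub>U(2)[OF tm_step(4)[OF i] \<tau>(2) tm_step(6)[OF i], of x] unfolding \<tau>(1) by blast+
  have b': "(\<integral>y. \<bar>?F x y\<bar> \<partial>gaussian) \<le> ?H x" for x using b(2)[of x] by simp
  have iM: "integrable M (\<lambda>\<omega>. (1 + (norm (X i \<omega>))\<^sup>2) ^ 3)" "(\<integral>\<omega>. (1 + (norm (X i \<omega>))\<^sup>2) ^ 3 \<partial>M) \<le> M\<^sub>3"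
    using M\<^sub>3[of i] i by auto
  have H: "integrable M (\<lambda>\<omega>. ?H (X i \<omega>))" using iM(1) by simp
  note e = past_increment_expectation[where F = ?F and H = ?H, OF tm_step(1-3)[OF i]
      X_measurable[OF less_imp_le[OF i]] mF b(1) b' H]
  have eq: "(u (tm (Suc i)) (X (Suc i) \<omega>) - u (tm i) (X i \<omega>))\<^sup>2 = ?F (X i \<omega>) (\<xi> i \<omega>)" if "\<omega> \<in> space M" for \<omega>
    unfolding X_Suc[OF that i] tm_Suc(2) ..
  have c: "integrable M (\<lambda>\<omega>. (u (tm (Suc i)) (X (Suc i) \<omega>) - u (tm i) (X i \<omega>))\<^sup>2)
        \<longleftrightarrow> integrable M (\<lambda>\<omega>. ?F (X i \<omega>) (\<xi> i \<omega>))"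
    "(\<integral>\<omega>. (u (tm (Suc i)) (X (Suc i) \<omega>) - u (tm i) (X i \<omega>))\<^sup>2 \<partial>M) = (\<integral>\<omega>. ?F (X i \<omega>) (\<xi> i \<omega>) \<partial>M)"
    by (rule Bochner_Integration.integrable_cong[OF refl eq], assumption)
      (rule Bochner_Integration.integral_cong[OF refl eq], assumption)
  show "integrable M (\<lambda>\<omega>. (u (tm (Suc i)) (X (Suc i) \<omega>) - u (tm i) (X i \<omega>))\<^sup>2)"
    unfolding c by (rule e(1))
  have "(\<integral>\<omega>. ?F (X i \<omega>) (\<xi> i \<omega>) \<partial>M) \<le> (\<integral>\<omega>. ?H (X i \<omega>) \<partial>M)"
    unfolding e(3) by (rule integral_mono[OF e(2) H b(2)])
  also have "\<dots> \<le> C\<^sub>U * h * M\<^sub>3"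
    using iM(2) C\<^sub>U(1) h_pos by (simp add: mult_left_mono)
  finally show "(\<integral>\<omega>. (u (tm (Suc i)) (X (Suc i) \<omega>) - u (tm i) (X i \<omega>))\<^sup>2 \<partial>M) \<le> C\<^sub>U * h * M\<^sub>3"
    unfolding c .
qed

lemma P_measurable:
  assumes i: "i < n"
  shows "P i \<in> borel_measurable M"
proof -
  have s: "tm i + \<tau>\<^sup>2 \<in> {0..T}" using tm_step[OF i] by (simp only: tm_Suc)
  have p: "(\<lambda>\<omega>. (X i \<omega>, Y (Suc i) \<omega>, Z i \<omega>)) \<in> borel_measurable M"
    using X_M[of i] Z_M[OF i] Y_measurable[of "Suc i"] i by (simp add: borel_prod[symmetric])
  have f: "(\<lambda>\<omega>. f (tm i) (X i \<omega>) (Y (Suc i) \<omega>) (Z i \<omega>)) \<in> borel_measurable M"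
    using measurable_compose[OF p borel_measurable_continuous_onI[OF continuous_coefficients(3)[OF tm_step(4)[OF i]]]]
    by simp
  have "(\<lambda>\<omega>. mean_step (tm i) \<tau> (X i \<omega>)) \<in> borel_measurable M"
    using measurable_compose[OF X_M measurable_mean_step[OF tm_step(4)[OF i] s]] i by simp
  then show ?thesis
    unfolding P_def[abs_def] using f u_X_measurable[OF less_imp_le[OF i]]
    by (intro borel_measurable_add borel_measurable_diff borel_measurable_times borel_measurable_const)
qed

text \<open>The 4 is the number of terms being squared, and 64 is this 4 times \<open>2 ^ 4\<close>
  from \<open>one_plus_norm_power_le\<close>. The power \<open>h ^ 3\<close> is the square of the
  weak error \<open>\<tau> ^ 3\<close>.\<close>

abbreviation P_bound :: "nat \<Rightarrow> 'a \<Rightarrow> real" where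
  "P_bound i \<omega> \<equiv> 64 * C\<^sub>E\<^sup>2 * h ^ 3 * (1 + (norm (X i \<omega>))\<^sup>2) ^ 4
     + 4 * h\<^sup>2 * K\<^sup>2 * ((err (Suc i) \<omega>)\<^sup>2 + (u (tm (Suc i)) (X (Suc i) \<omega>) - u (tm i) (X i \<omega>))\<^sup>2
       + (norm (w (tm i) (X i \<omega>) - Z i \<omega>))\<^sup>2)"

text \<open>The driver is compared with \<open>f0\<close>, its value at the exact solution, which
  together with the mean increment of \<open>u\<close> forms the weak error. In the Lipschitz
  remainder, \<open>Y (Suc i)\<close> differs from \<open>u (tm i) (X i)\<close> by
  \<open>err (Suc i)\<close> plus the increment of \<open>u\<close> over the step.\<close>

lemma P_square_le:
  assumes i: "i < n"
  shows "(P i \<omega>)\<^sup>2 \<le> P_bound i \<omega>"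
proof -
  define x where "x = X i \<omega>"
  define a where "a = C\<^sub>E * \<tau> ^ 3 * (1 + norm x) ^ 4"
  define v where "v = \<bar>u (tm (Suc i)) (X (Suc i) \<omega>) - u (tm i) x\<bar>"
  define c where "c = norm (w (tm i) x - Z i \<omega>)"
  define e where "e = \<bar>err (Suc i) \<omega>\<bar>"
  define f0 where "f0 = f (tm i) x (u (tm i) x) (w (tm i) x)"
  have hK: "h * K \<ge> 0" using h_pos K_nonneg by simp
  have 1: "\<bar>mean_step (tm i) \<tau> x - u (tm i) x + h * f0\<bar> \<le> a"
    using C\<^sub>E(2)[OF tm_step(1)[OF i] less_imp_le[OF \<tau>(4)] tm_step(6)[OF i], of x] unfolding \<tau>(1) f0_def a_def .
  have "\<bar>f (tm i) x (Y (Suc i) \<omega>) (Z i \<omega>) - f0\<bar> \<le> K * (\<bar>Y (Suc i) \<omega> - u (tm i) x\<bar> + c)"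
    using f_bound[OF tm_step(4)[OF i] tm_step(4)[OF i], of x "Y (Suc i) \<omega>" "Z i \<omega>" x "u (tm i) x" "w (tm i) x"]
    by (simp add: f0_def c_def norm_minus_commute)
  also have "\<dots> \<le> K * (e + v + c)"
    using K_nonneg by (intro mult_left_mono) (auto simp: e_def v_def err_def)
  finally have 2: "h * \<bar>f (tm i) x (Y (Suc i) \<omega>) (Z i \<omega>) - f0\<bar> \<le> h * (K * (e + v + c))"
    using h_pos by (intro mult_left_mono) auto
  have "P i \<omega> = (mean_step (tm i) \<tau> x - u (tm i) x + h * f0) + h * (f (tm i) x (Y (Suc i) \<omega>) (Z i \<omega>) - f0)"
    by (simp add: P_def x_def algebra_simps)
  then have "\<bar>P i \<omega>\<bar> \<le> \<bar>mean_step (tm i) \<tau> x - u (tm i) x + h * f0\<bar> + h * \<bar>f (tm i) x (Y (Suc i) \<omega>) (Z i \<omega>) - f0\<bar>"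
    using h_pos abs_triangle_ineq[of "mean_step (tm i) \<tau> x - u (tm i) x + h * f0" "h * (f (tm i) x (Y (Suc i) \<omega>) (Z i \<omega>) - f0)"]
    by (simp add: abs_mult)
  also have "\<dots> \<le> a + (h * K) * e + (h * K) * v + (h * K) * c"
    using 1 2 by (simp add: distrib_left mult.assoc)
  finally have "(P i \<omega>)\<^sup>2 \<le> (a + (h * K) * e + (h * K) * v + (h * K) * c)\<^sup>2"
    using power_mono[of "\<bar>P i \<omega>\<bar>" _ 2] by simp
  also have "\<dots> \<le> 4 * (a\<^sup>2 + ((h * K) * e)\<^sup>2 + ((h * K) * v)\<^sup>2 + ((h * K) * c)\<^sup>2)"
  proof -
    have "(p + q + r + s)\<^sup>2 \<le> 4 * (p\<^sup>2 + q\<^sup>2 + r\<^sup>2 + s\<^sup>2)" for p q r s :: real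
    proof -
      have "0 \<le> (p - q)\<^sup>2 + (p - r)\<^sup>2 + (p - s)\<^sup>2 + (q - r)\<^sup>2 + (q - s)\<^sup>2 + (r - s)\<^sup>2" by simp
      then show ?thesis by (simp add: power2_eq_square algebra_simps)
    qed
    then show ?thesis .
  qed
  also have "\<dots> = 4 * a\<^sup>2 + 4 * h\<^sup>2 * K\<^sup>2 * (e\<^sup>2 + v\<^sup>2 + c\<^sup>2)"
    by (simp add: power_mult_distrib distrib_left)
  also have "a\<^sup>2 \<le> 16 * C\<^sub>E\<^sup>2 * h ^ 3 * (1 + (norm x)\<^sup>2) ^ 4"
  proof -
    have t: "(\<tau> ^ 3)\<^sup>2 = h ^ 3"
      using power_mult[of \<tau> 3 2] power_mult[of \<tau> 2 3] \<tau>(1) by simp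
    have "a\<^sup>2 = C\<^sub>E\<^sup>2 * h ^ 3 * (1 + norm x) ^ (2 * 4)"
      unfolding a_def power_mult_distrib t by (simp flip: power_mult)
    also have "\<dots> \<le> C\<^sub>E\<^sup>2 * h ^ 3 * (2 ^ 4 * (1 + (norm x)\<^sup>2) ^ 4)"
      using h_pos by (intro mult_left_mono one_plus_norm_power_le) auto
    finally show ?thesis by simp
  qed
  finally show ?thesis unfolding x_def v_def c_def e_def power2_abs by simp
qed

text \<open>Backward induction, as \<open>P_bound i\<close> contains \<open>err (Suc i)\<close>. It
  has to precede every moment estimate, for Bochner integrals are monotone only on integrable
  functions.\<close>

lemma err_square_integrable:
  assumes "k \<le> n"
  shows "integrable M (\<lambda>\<omega>. (err k \<omega>)\<^sup>2)"
  using assms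
proof (induction k rule: inc_induct)
  case base
  have "integrable M (\<lambda>\<omega>. (err n \<omega>)\<^sup>2) \<longleftrightarrow> integrable M (\<lambda>\<omega>. 0 :: real)"
    by (rule Bochner_Integration.integrable_cong[OF refl]) (simp add: err_n)
  then show ?case by simp
next
  case (step i)
  then have i: "i < n" by simp
  have b: "integrable M (P_bound i)"
    using M\<^sub>4(1)[of i] step.IH u_increment_second_moment(1)[OF i] Z_error[OF i] i by simp
  show ?case
  proof (rule Bochner_Integration.integrable_bound)
    show "integrable M (\<lambda>\<omega>. 3 * ((err (Suc i) \<omega>)\<^sup>2 + (N i \<omega>)\<^sup>2 + P_bound i \<omega>))"
      by (rule integrable_mult_right[OF Bochner_Integration.integrable_add[OF
            Bochner_Integration.integrable_add[OF step.IH N_second_moment(1)[OF i]] b]])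
    show "(\<lambda>\<omega>. (err i \<omega>)\<^sup>2) \<in> borel_measurable M" using err_measurable[of i] i by simp
    show "AE \<omega> in M. norm ((err i \<omega>)\<^sup>2) \<le> norm (3 * ((err (Suc i) \<omega>)\<^sup>2 + (N i \<omega>)\<^sup>2 + P_bound i \<omega>))"
    proof (rule AE_I2)
      fix \<omega> assume \<omega>: "\<omega> \<in> space M"
      have "(p + q + r)\<^sup>2 \<le> 3 * (p\<^sup>2 + q\<^sup>2 + r\<^sup>2)" for p q r :: real
      proof -
        have "0 \<le> (p - q)\<^sup>2 + (p - r)\<^sup>2 + (q - r)\<^sup>2" by simp
        then show ?thesis by (simp add: power2_eq_square algebra_simps)
      qed
      from order_trans[OF this[of "err (Suc i) \<omega>" "N i \<omega>" "P i \<omega>"] mult_left_mono[OF add_left_mono[OF P_square_le[OF i]]]]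
      have "(err i \<omega>)\<^sup>2 \<le> 3 * ((err (Suc i) \<omega>)\<^sup>2 + (N i \<omega>)\<^sup>2 + P_bound i \<omega>)"
        unfolding err_step[OF \<omega> i] by simp
      then show "norm ((err i \<omega>)\<^sup>2) \<le> norm (3 * ((err (Suc i) \<omega>)\<^sup>2 + (N i \<omega>)\<^sup>2 + P_bound i \<omega>))"
        unfolding real_norm_def using zero_le_power2[of "err i \<omega>"] by linarith
    qed
  qed
qed

section \<open>Gronwall estimate and variance\<close>

definition err_moment :: "nat \<Rightarrow> real" where
  "err_moment k = (\<integral>\<omega>. (err k \<omega>)\<^sup>2 \<partial>M)"

lemma P_second_moment:
  assumes i: "i < n"
  shows "integrable M (\<lambda>\<omega>. (P i \<omega>)\<^sup>2)"
    and "(\<integral>\<omega>. (P i \<omega>)\<^sup>2 \<partial>M) \<le> 64 * C\<^sub>E\<^sup>2 * h ^ 3 * M\<^sub>4 + 4 * h\<^sup>2 * K\<^sup>2 * (err_moment (Suc i) + C\<^sub>U * h * M\<^sub>3 + \<kappa> i)"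
proof -
  note ints = M\<^sub>4(1)[OF less_imp_le[OF i]] err_square_integrable[OF Suc_leI[OF i]]
    u_increment_second_moment(1)[OF i] Z_error[OF i]
  have b: "integrable M (P_bound i)" using ints by simp
  show 1: "integrable M (\<lambda>\<omega>. (P i \<omega>)\<^sup>2)"
  proof (rule Bochner_Integration.integrable_bound[OF b])
    show "(\<lambda>\<omega>. (P i \<omega>)\<^sup>2) \<in> borel_measurable M" using P_measurable[OF i] by simp
    show "AE \<omega> in M. norm ((P i \<omega>)\<^sup>2) \<le> norm (P_bound i \<omega>)"
    proof (rule AE_I2)
      fix \<omega> show "norm ((P i \<omega>)\<^sup>2) \<le> norm (P_bound i \<omega>)"
        unfolding real_norm_def using P_square_le[OF i, of \<omega>] zero_le_power2[of "P i \<omega>"] by linarith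
    qed
  qed
  have "(\<integral>\<omega>. (P i \<omega>)\<^sup>2 \<partial>M) \<le> (\<integral>\<omega>. P_bound i \<omega> \<partial>M)"
    by (rule integral_mono[OF 1 b P_square_le[OF i]])
  also have "\<dots> = 64 * C\<^sub>E\<^sup>2 * h ^ 3 * (\<integral>\<omega>. (1 + (norm (X i \<omega>))\<^sup>2) ^ 4 \<partial>M)
      + 4 * h\<^sup>2 * K\<^sup>2 * (err_moment (Suc i) + (\<integral>\<omega>. (u (tm (Suc i)) (X (Suc i) \<omega>) - u (tm i) (X i \<omega>))\<^sup>2 \<partial>M) + \<kappa> i)"
    using ints by (simp add: err_moment_def \<kappa>_def)
  also have "\<dots> \<le> 64 * C\<^sub>E\<^sup>2 * h ^ 3 * M\<^sub>4 + 4 * h\<^sup>2 * K\<^sup>2 * (err_moment (Suc i) + C\<^sub>U * h * M\<^sub>3 + \<kappa> i)"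
    using M\<^sub>4(2)[OF less_imp_le[OF i]] u_increment_second_moment(2)[OF i] h_pos
    by (intro add_mono mult_left_mono) auto
  finally show "(\<integral>\<omega>. (P i \<omega>)\<^sup>2 \<partial>M) \<le> 64 * C\<^sub>E\<^sup>2 * h ^ 3 * M\<^sub>4 + 4 * h\<^sup>2 * K\<^sup>2 * (err_moment (Suc i) + C\<^sub>U * h * M\<^sub>3 + \<kappa> i)" .
qed


text \<open>Orthogonality sums the fluctuations without loss, while the biases pay a factor
  \<open>n\<close>. Against \<open>h\<^sup>2\<close> per step this leaves \<open>T * h\<close> in
  front of the errors, the weight a Gronwall argument tolerates, and against \<open>h ^ 3\<close>
  summed over \<open>n\<close> steps it leaves \<open>T\<^sup>2 * h\<close>.\<close>

lemma err_moment_recursion: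
  assumes k: "k \<le> n"
  shows "err_moment k \<le> 2 * (\<Sum>i\<in>{k..<n}. C\<^sub>N * (h\<^sup>2 * M\<^sub>3 + h * \<kappa> i))
    + 2 * n * (\<Sum>i\<in>{k..<n}. 64 * C\<^sub>E\<^sup>2 * h ^ 3 * M\<^sub>4 + 4 * h\<^sup>2 * K\<^sup>2 * (err_moment (Suc i) + C\<^sub>U * h * M\<^sub>3 + \<kappa> i))"
proof -
  have iP: "integrable M (\<lambda>\<omega>. \<Sum>i\<in>{k..<n}. (P i \<omega>)\<^sup>2)"
    using P_second_moment(1) by (intro Bochner_Integration.integrable_sum) simp
  note iN = N_sum_second_moment[OF k]
  have "err_moment k \<le> (\<integral>\<omega>. 2 * (\<Sum>i\<in>{k..<n}. N i \<omega>)\<^sup>2 + 2 * (n * (\<Sum>i\<in>{k..<n}. (P i \<omega>)\<^sup>2)) \<partial>M)"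
    unfolding err_moment_def
  proof (rule integral_mono_AE[OF err_square_integrable[OF k]])
    show "integrable M (\<lambda>\<omega>. 2 * (\<Sum>i\<in>{k..<n}. N i \<omega>)\<^sup>2 + 2 * (n * (\<Sum>i\<in>{k..<n}. (P i \<omega>)\<^sup>2)))"
      using iP iN(1) by simp
    show "AE \<omega> in M. (err k \<omega>)\<^sup>2 \<le> 2 * (\<Sum>i\<in>{k..<n}. N i \<omega>)\<^sup>2 + 2 * (n * (\<Sum>i\<in>{k..<n}. (P i \<omega>)\<^sup>2))"
    proof (rule AE_I2)
      fix \<omega> assume \<omega>: "\<omega> \<in> space M"
      have "(\<Sum>i\<in>{k..<n}. P i \<omega>)\<^sup>2 \<le> (\<Sum>i\<in>{k..<n}. (P i \<omega>)\<^sup>2) * card {k..<n}"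
        by (rule sum_squared_le_sum_of_squares)
      also have "\<dots> \<le> (\<Sum>i\<in>{k..<n}. (P i \<omega>)\<^sup>2) * n"
        by (intro mult_left_mono sum_nonneg) auto
      finally have 1: "(\<Sum>i\<in>{k..<n}. P i \<omega>)\<^sup>2 \<le> n * (\<Sum>i\<in>{k..<n}. (P i \<omega>)\<^sup>2)"
        by (simp add: mult.commute)
      have "(p + q)\<^sup>2 \<le> 2 * p\<^sup>2 + 2 * q\<^sup>2" for p q :: real
        using sum_squares_bound[of p q] by (simp add: power2_sum)
      from this[of "\<Sum>i\<in>{k..<n}. N i \<omega>" "\<Sum>i\<in>{k..<n}. P i \<omega>"]
      show "(err k \<omega>)\<^sup>2 \<le> 2 * (\<Sum>i\<in>{k..<n}. N i \<omega>)\<^sup>2 + 2 * (n * (\<Sum>i\<in>{k..<n}. (P i \<omega>)\<^sup>2))"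
        unfolding err_eq_sum[OF \<omega> k] using 1 by linarith
    qed
  qed
  also have "\<dots> = 2 * (\<Sum>i\<in>{k..<n}. \<integral>\<omega>. (N i \<omega>)\<^sup>2 \<partial>M) + 2 * n * (\<Sum>i\<in>{k..<n}. \<integral>\<omega>. (P i \<omega>)\<^sup>2 \<partial>M)"
  proof -
    have "(\<integral>\<omega>. (\<Sum>i\<in>{k..<n}. (P i \<omega>)\<^sup>2) \<partial>M) = (\<Sum>i\<in>{k..<n}. \<integral>\<omega>. (P i \<omega>)\<^sup>2 \<partial>M)"
      using P_second_moment(1) by (intro Bochner_Integration.integral_sum) simp
    then show ?thesis using iP iN by simp
  qed
  also have "\<dots> \<le> 2 * (\<Sum>i\<in>{k..<n}. C\<^sub>N * (h\<^sup>2 * M\<^sub>3 + h * \<kappa> i))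
    + 2 * n * (\<Sum>i\<in>{k..<n}. 64 * C\<^sub>E\<^sup>2 * h ^ 3 * M\<^sub>4 + 4 * h\<^sup>2 * K\<^sup>2 * (err_moment (Suc i) + C\<^sub>U * h * M\<^sub>3 + \<kappa> i))"
    using N_second_moment(2) P_second_moment(2) by (intro add_mono mult_left_mono sum_mono) auto
  finally show ?thesis .
qed

lemma err_moment_0_le:
  "err_moment 0 \<le> (2 * C\<^sub>N * (T * M\<^sub>3 + 1) + 128 * C\<^sub>E\<^sup>2 * M\<^sub>4 * T\<^sup>2 + 8 * T\<^sup>2 * K\<^sup>2 * C\<^sub>U * M\<^sub>3 + 8 * T * K\<^sup>2)
     * exp (8 * T\<^sup>2 * K\<^sup>2) * (h + (\<Sum>i<n. \<kappa> i * h))"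
proof -
  define S where "S = (\<Sum>i<n. \<kappa> i * h)"
  have \<kappa>: "\<kappa> i \<ge> 0" for i unfolding \<kappa>_def by simp
  have S: "S \<ge> 0" unfolding S_def using \<kappa> h_pos by (intro sum_nonneg mult_nonneg_nonneg) auto
  have M3: "M\<^sub>3 \<ge> 0"
  proof -
    have "0 \<le> (\<integral>\<omega>. (1 + (norm (X 0 \<omega>))\<^sup>2) ^ 3 \<partial>M)" by simp
    then show ?thesis using M\<^sub>3(2)[of 0] by linarith
  qed
  have M4: "M\<^sub>4 \<ge> 0"
  proof -
    have "0 \<le> (\<integral>\<omega>. (1 + (norm (X 0 \<omega>))\<^sup>2) ^ 4 \<partial>M)" by simp
    then show ?thesis using M\<^sub>4(2)[of 0] by linarith
  qed
  \<comment> \<open>The summands stem from the fluctuations, the weak error (128 is twice 64), the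
    increments of \<open>u\<close> and the error in \<open>Z\<close> inside the driver (8 is twice
    4); powers of \<open>n * h\<close> have become powers of \<open>T\<close>.\<close>
  let ?C = "2 * C\<^sub>N * (T * M\<^sub>3 + 1) + 128 * C\<^sub>E\<^sup>2 * M\<^sub>4 * T\<^sup>2 + 8 * T\<^sup>2 * K\<^sup>2 * C\<^sub>U * M\<^sub>3 + 8 * T * K\<^sup>2"
  \<comment> \<open>The Gronwall weight \<open>2 * n * 4 * h\<^sup>2 * K\<^sup>2\<close> with
    \<open>n * h = T\<close>. Its \<open>n\<close>-fold compounding \<open>(1 + ?c) ^ n\<close> is
    at most \<open>exp (8 * T\<^sup>2 * K\<^sup>2)\<close>.\<close>
  let ?c = "8 * T * K\<^sup>2 * h"
  have c: "?c \<ge> 0" using T_pos h_pos by simp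
  have C: "?C \<ge> 0" using C\<^sub>N(1) C\<^sub>U(1) M3 M4 T_pos by simp
  have rec: "err_moment k \<le> ?C * (h + S) + ?c * (\<Sum>i\<in>{k..<n}. err_moment (Suc i))" if k: "k \<le> n" for k
  proof -
    have sub: "(\<Sum>i\<in>{k..<n}. F i) \<le> (\<Sum>i<n. F i)" if "\<And>i. F i \<ge> 0" for F :: "nat \<Rightarrow> real"
      using that by (intro sum_mono2) auto
    have h\<kappa>: "(\<Sum>i<n. h * \<kappa> i) = S" by (simp add: S_def mult.commute)
    have 1: "(\<Sum>i\<in>{k..<n}. C\<^sub>N * (h\<^sup>2 * M\<^sub>3 + h * \<kappa> i)) \<le> C\<^sub>N * (T * h * M\<^sub>3 + S)"
    proof -
      have "(\<Sum>i\<in>{k..<n}. C\<^sub>N * (h\<^sup>2 * M\<^sub>3 + h * \<kappa> i)) \<le> (\<Sum>i<n. C\<^sub>N * (h\<^sup>2 * M\<^sub>3 + h * \<kappa> i))"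
        using C\<^sub>N(1) M3 \<kappa> h_pos by (intro sub) simp
      also have "\<dots> = C\<^sub>N * ((real n * h) * h * M\<^sub>3 + S)"
        using h\<kappa> by (simp add: sum_distrib_left[symmetric] sum.distrib power2_eq_square mult.assoc)
      finally show ?thesis unfolding nh .
    qed
    let ?Q = "\<lambda>i. 64 * C\<^sub>E\<^sup>2 * h ^ 3 * M\<^sub>4 + 4 * h\<^sup>2 * K\<^sup>2 * C\<^sub>U * h * M\<^sub>3 + 4 * h * K\<^sup>2 * (h * \<kappa> i)"
    have 2: "2 * n * (\<Sum>i\<in>{k..<n}. 64 * C\<^sub>E\<^sup>2 * h ^ 3 * M\<^sub>4 + 4 * h\<^sup>2 * K\<^sup>2 * (err_moment (Suc i) + C\<^sub>U * h * M\<^sub>3 + \<kappa> i))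
        = 2 * n * (\<Sum>i\<in>{k..<n}. ?Q i) + ?c * (\<Sum>i\<in>{k..<n}. err_moment (Suc i))"
    proof -
      have "(\<Sum>i\<in>{k..<n}. 64 * C\<^sub>E\<^sup>2 * h ^ 3 * M\<^sub>4 + 4 * h\<^sup>2 * K\<^sup>2 * (err_moment (Suc i) + C\<^sub>U * h * M\<^sub>3 + \<kappa> i))
          = (\<Sum>i\<in>{k..<n}. ?Q i + 4 * h\<^sup>2 * K\<^sup>2 * err_moment (Suc i))"
        by (intro sum.cong refl) (simp add: distrib_left power2_eq_square)
      also have "\<dots> = (\<Sum>i\<in>{k..<n}. ?Q i) + 4 * h\<^sup>2 * K\<^sup>2 * (\<Sum>i\<in>{k..<n}. err_moment (Suc i))"
        by (simp only: sum.distrib sum_distrib_left)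
      finally have "2 * n * (\<Sum>i\<in>{k..<n}. 64 * C\<^sub>E\<^sup>2 * h ^ 3 * M\<^sub>4 + 4 * h\<^sup>2 * K\<^sup>2 * (err_moment (Suc i) + C\<^sub>U * h * M\<^sub>3 + \<kappa> i))
          = 2 * n * (\<Sum>i\<in>{k..<n}. ?Q i) + (8 * (n * h) * K\<^sup>2 * h) * (\<Sum>i\<in>{k..<n}. err_moment (Suc i))"
        by (simp only: distrib_left) (simp add: power2_eq_square)
      then show ?thesis unfolding nh .
    qed
    have 3: "2 * n * (\<Sum>i\<in>{k..<n}. ?Q i) \<le> 128 * C\<^sub>E\<^sup>2 * M\<^sub>4 * T\<^sup>2 * h + 8 * T\<^sup>2 * K\<^sup>2 * C\<^sub>U * M\<^sub>3 * h + 8 * T * K\<^sup>2 * S"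
    proof -
      have "(\<Sum>i\<in>{k..<n}. ?Q i) \<le> (\<Sum>i<n. ?Q i)"
        using C\<^sub>U(1) M3 M4 \<kappa> h_pos by (intro sub add_nonneg_nonneg) auto
      also have "\<dots> = n * (64 * C\<^sub>E\<^sup>2 * h ^ 3 * M\<^sub>4) + n * (4 * h\<^sup>2 * K\<^sup>2 * C\<^sub>U * h * M\<^sub>3) + 4 * h * K\<^sup>2 * S"
        unfolding h\<kappa>[symmetric] sum.distrib sum_distrib_left by simp
      finally have "2 * n * (\<Sum>i\<in>{k..<n}. ?Q i)
          \<le> 2 * n * (n * (64 * C\<^sub>E\<^sup>2 * h ^ 3 * M\<^sub>4) + n * (4 * h\<^sup>2 * K\<^sup>2 * C\<^sub>U * h * M\<^sub>3) + 4 * h * K\<^sup>2 * S)"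
        by (intro mult_left_mono) auto
      also have "\<dots> = 128 * C\<^sub>E\<^sup>2 * M\<^sub>4 * (n * h)\<^sup>2 * h + 8 * (n * h)\<^sup>2 * K\<^sup>2 * C\<^sub>U * M\<^sub>3 * h + 8 * (n * h) * K\<^sup>2 * S"
        by (simp add: power2_eq_square power3_eq_cube algebra_simps)
      finally show ?thesis unfolding nh .
    qed
    \<comment> \<open>A deliberately generous constant: \<open>?C\<close> multiplies both
      \<open>h\<close> and \<open>S\<close>, and the surplus cross terms are nonnegative.\<close>
    have 4: "2 * (C\<^sub>N * (T * h * M\<^sub>3 + S)) + (128 * C\<^sub>E\<^sup>2 * M\<^sub>4 * T\<^sup>2 * h + 8 * T\<^sup>2 * K\<^sup>2 * C\<^sub>U * M\<^sub>3 * h + 8 * T * K\<^sup>2 * S) \<le> ?C * (h + S)"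
    proof -
      have "?C * (h + S) - (2 * (C\<^sub>N * (T * h * M\<^sub>3 + S)) + (128 * C\<^sub>E\<^sup>2 * M\<^sub>4 * T\<^sup>2 * h + 8 * T\<^sup>2 * K\<^sup>2 * C\<^sub>U * M\<^sub>3 * h + 8 * T * K\<^sup>2 * S))
          = 2 * C\<^sub>N * T * M\<^sub>3 * S + 2 * C\<^sub>N * h + 128 * C\<^sub>E\<^sup>2 * M\<^sub>4 * T\<^sup>2 * S + 8 * T\<^sup>2 * K\<^sup>2 * C\<^sub>U * M\<^sub>3 * S + 8 * T * K\<^sup>2 * h"
        by (simp add: algebra_simps)
      also have "\<dots> \<ge> 0" using C\<^sub>N(1) C\<^sub>U(1) M3 M4 T_pos h_pos S by simp
      finally show ?thesis by simp
    qed
    show ?thesis using err_moment_recursion[OF k] 1 2 3 4 by linarith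
  qed
  have "err_moment 0 \<le> ?C * (h + S) * (1 + ?c) ^ (n - 0)"
    by (rule backward_gronwall[OF c rec]) auto
  also have "\<dots> \<le> ?C * (h + S) * exp (8 * T\<^sup>2 * K\<^sup>2)"
  proof (rule mult_left_mono)
    have "(1 + ?c) ^ n \<le> exp ?c ^ n" using c by (intro power_mono) auto
    also have "\<dots> = exp (8 * T * K\<^sup>2 * (n * h))" by (simp add: exp_of_nat_mult[symmetric] mult_ac)
    finally show "(1 + ?c) ^ (n - 0) \<le> exp (8 * T\<^sup>2 * K\<^sup>2)" unfolding nh by (simp add: power2_eq_square mult_ac)
    show "0 \<le> ?C * (h + S)" using C h_pos S by simp
  qed
  finally show ?thesis unfolding S_def by (simp only: mult_ac)
qed

text \<open>Square-integrability of \<open>Y 0\<close> comes first, because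
  \<open>extended_variance\<close> is infinite otherwise. After that, the shift by the constant
  \<open>?c\<close> leaves the variance unchanged, and a variance is at most the second
  moment.\<close>

lemma extended_variance_Y_0_le: "extended_variance M (Y 0) \<le> ennreal (err_moment 0)"
proof -
  let ?c = "u (tm 0) x\<^sub>0"
  have Y: "Y 0 \<omega> = err 0 \<omega> + ?c" if "\<omega> \<in> space M" for \<omega>
    using X_0[OF that] by (simp add: err_def)
  have sq: "integrable M (\<lambda>\<omega>. (err 0 \<omega>)\<^sup>2)" by (rule err_square_integrable) simp
  have m: "err 0 \<in> borel_measurable M" by (rule err_measurable) simp
  have i: "integrable M (err 0)" by (rule square_integrable_imp_integrable[OF m sq])
  have "integrable M (\<lambda>\<omega>. (err 0 \<omega> + ?c)\<^sup>2)"
    using sq i by (simp add: power2_sum)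
  moreover have "integrable M (\<lambda>\<omega>. (Y 0 \<omega>)\<^sup>2) \<longleftrightarrow> integrable M (\<lambda>\<omega>. (err 0 \<omega> + ?c)\<^sup>2)"
    by (rule Bochner_Integration.integrable_cong[OF refl]) (simp only: Y)
  ultimately have iY: "integrable M (\<lambda>\<omega>. (Y 0 \<omega>)\<^sup>2)" by simp
  have "expectation (Y 0) = (\<integral>\<omega>. err 0 \<omega> + ?c \<partial>M)"
    by (rule Bochner_Integration.integral_cong[OF refl]) (simp only: Y)
  then have EY: "expectation (Y 0) = expectation (err 0) + ?c" using i by (simp add: prob_space)
  have "variance (Y 0) = variance (err 0)"
    by (rule Bochner_Integration.integral_cong[OF refl]) (simp add: Y EY)
  also have "\<dots> = err_moment 0 - (expectation (err 0))\<^sup>2"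
    unfolding err_moment_def by (rule variance_eq[OF i sq])
  also have "\<dots> \<le> err_moment 0" by simp
  finally have "variance (Y 0) \<le> err_moment 0" .
  then show ?thesis
    unfolding extended_variance_def using iY Y_measurable[of 0] by (simp add: ennreal_leI)
qed

end

theorem theorem3p8:
  fixes M :: "'a measure"
    and W :: "real \<Rightarrow> 'a \<Rightarrow> real^'d::finite"
    and T K \<delta> K\<^sub>y L :: real
    and x\<^sub>0 :: "real^'d"
    and b :: "real \<Rightarrow> real^'d \<Rightarrow> real^'d"
    and \<sigma> :: "real \<Rightarrow> real^'d \<Rightarrow> real^'d^'d"
    and f :: "real \<Rightarrow> real^'d \<Rightarrow> real \<Rightarrow> real^'d \<Rightarrow> real"
    and g :: "real^'d \<Rightarrow> real"
    and u :: "real \<Rightarrow> real^'d \<Rightarrow> real"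
  assumes "T > 0"
    and "brownian_motion M T W"
    and bounded: "bounded ((\<lambda>t. b t 0) ` {0..T})" "bounded ((\<lambda>t. \<sigma> t 0) ` {0..T})"
      "bounded ((\<lambda>t. f t 0 0 0) ` {0..T})" "bounded {g 0}"
    and lipschitz:
      "\<And>t. t \<in> {0..T} \<Longrightarrow> lipschitz_on K UNIV (b t)"
      "\<And>t. t \<in> {0..T} \<Longrightarrow> lipschitz_on K UNIV (\<sigma> t)"
      "\<And>t. t \<in> {0..T} \<Longrightarrow> lipschitz_on K UNIV (\<lambda>(x, y, z). f t x y z)"
      "lipschitz_on K UNIV g"
    and hoelder:
      "\<And>x. half_hoelder_on K {0..T} (\<lambda>t. b t x)"
      "\<And>x. half_hoelder_on K {0..T} (\<lambda>t. \<sigma> t x)"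
      "\<And>x y z. half_hoelder_on K {0..T} (\<lambda>t. f t x y z)"
    and elliptic: "\<delta> > 0"
      "\<And>t x. t \<in> {0..T} \<Longrightarrow> loewner_le (mat \<delta>) (\<sigma> t x ** transpose (\<sigma> t x))"
    and K\<^sub>y: "\<And>t x y\<^sub>1 y\<^sub>2 z. t \<in> {0..T} \<Longrightarrow>
        \<bar>f t x y\<^sub>1 z - f t x y\<^sub>2 z\<bar>\<^sup>2 \<le> K\<^sub>y * \<bar>y\<^sub>1 - y\<^sub>2\<bar>\<^sup>2"
      "6 * T\<^sup>2 * K\<^sub>y < 1"
    and pde: "classical_solution T b \<sigma> f g u"
    and L: "\<And>t. t \<in> {0..T} \<Longrightarrow> lipschitz_on L UNIV (\<lambda>x. grad_x u t x v* \<sigma> t x)"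
  shows "\<exists>C>0. \<exists>h\<^sub>0>0. \<forall>(n::nat) (h::real).
    1 \<le> n \<longrightarrow> h = T / real n \<longrightarrow> h \<le> h\<^sub>0 \<longrightarrow>
    (\<forall>(Z :: nat \<Rightarrow> 'a \<Rightarrow> real^'d) (X :: nat \<Rightarrow> 'a \<Rightarrow> real^'d) (Y :: nat \<Rightarrow> 'a \<Rightarrow> real).
      (\<forall>i<n. Z i \<in> borel_measurable (augmented_filtration M W (real i * h))) \<longrightarrow>
      euler_scheme M W b \<sigma> x\<^sub>0 n h X \<longrightarrow>
      backward_scheme M W f g n h X Z Y \<longrightarrow>
      extended_variance M (Y 0) \<le>
        ennreal C * (ennreal h +
          (\<Sum>i<n. (\<integral>\<^sup>+\<omega>. ennreal ((norm (grad_x u (real i * h) (X i \<omega>) v* \<sigma> (real i * h) (X i \<omega>)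
                                     - Z i \<omega>))\<^sup>2) \<partial>M) * ennreal h)))"
proof -
  have g: "lipschitz_on K UNIV g" by fact
  interpret brownian_motion M T W by fact
  interpret parabolic_problem T K \<delta> L b \<sigma> f g u
    by unfold_locales (fact assms)+
  \<comment> \<open>All constants are fixed here, before the number of steps and the
    \<open>Z\<close> are introduced, which is what makes them uniform.\<close>
  obtain C\<^sub>N where C\<^sub>N: "C\<^sub>N \<ge> 0" "\<And>t r x z. t \<in> {0..T} \<Longrightarrow> r \<in> {0..sqrt T} \<Longrightarrow> t + r\<^sup>2 \<le> T \<Longrightarrow>
      integrable gaussian (noise t r x z) \<and> (\<integral>y. noise t r x z y \<partial>gaussian) = 0 \<and>
      integrable gaussian (\<lambda>y. (noise t r x z y)\<^sup>2) \<and>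
      (\<integral>y. (noise t r x z y)\<^sup>2 \<partial>gaussian) \<le> C\<^sub>N * (r ^ 4 * (1 + (norm x)\<^sup>2) ^ 3 + r\<^sup>2 * (norm (w t x - z))\<^sup>2)"
    using noise_moments by metis
  obtain C\<^sub>E where C\<^sub>E: "C\<^sub>E \<ge> 0" "\<And>t r x. t \<ge> 0 \<Longrightarrow> r \<ge> 0 \<Longrightarrow> t + r\<^sup>2 \<le> T \<Longrightarrow>
      \<bar>mean_step t r x - u t x + r\<^sup>2 * f t x (u t x) (w t x)\<bar> \<le> C\<^sub>E * r ^ 3 * (1 + norm x) ^ 4"
    using weak_error unfolding mean_step_def by metis
  obtain C\<^sub>U where C\<^sub>U: "C\<^sub>U \<ge> 0" "\<And>t r x. t \<in> {0..T} \<Longrightarrow> r \<in> {0..sqrt T} \<Longrightarrow> t + r\<^sup>2 \<le> T \<Longrightarrow>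
      integrable gaussian (\<lambda>y. (u (t + r\<^sup>2) (step t x r y) - u t x)\<^sup>2) \<and>
      (\<integral>y. (u (t + r\<^sup>2) (step t x r y) - u t x)\<^sup>2 \<partial>gaussian) \<le> C\<^sub>U * r\<^sup>2 * (1 + (norm x)\<^sup>2) ^ 3"
    using u_step_increment_moment by metis
  obtain A\<^sub>3 where A\<^sub>3: "A\<^sub>3 \<ge> 0" "\<And>t r x. t \<in> {0..T} \<Longrightarrow> r \<in> {0..sqrt T} \<Longrightarrow>
      integrable gaussian (\<lambda>y. (1 + (norm (step t x r y))\<^sup>2) ^ 3) \<and>
      (\<integral>y. (1 + (norm (step t x r y))\<^sup>2) ^ 3 \<partial>gaussian) \<le> (1 + A\<^sub>3 * r\<^sup>2) * (1 + (norm x)\<^sup>2) ^ 3"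
    using step_moment[of 3] by metis
  obtain A\<^sub>4 where A\<^sub>4: "A\<^sub>4 \<ge> 0" "\<And>t r x. t \<in> {0..T} \<Longrightarrow> r \<in> {0..sqrt T} \<Longrightarrow>
      integrable gaussian (\<lambda>y. (1 + (norm (step t x r y))\<^sup>2) ^ 4) \<and>
      (\<integral>y. (1 + (norm (step t x r y))\<^sup>2) ^ 4 \<partial>gaussian) \<le> (1 + A\<^sub>4 * r\<^sup>2) * (1 + (norm x)\<^sup>2) ^ 4"
    using step_moment[of 4] by metis
  \<comment> \<open>Exponent 3 serves the squares of the cubic Taylor and increment bounds on
    \<open>u\<close>, exponent 4 the square of the weak error of degree 4.\<close>
  define M\<^sub>3 where "M\<^sub>3 = exp (A\<^sub>3 * T) * (1 + (norm x\<^sub>0)\<^sup>2) ^ 3"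
  define M\<^sub>4 where "M\<^sub>4 = exp (A\<^sub>4 * T) * (1 + (norm x\<^sub>0)\<^sup>2) ^ 4"
  define C where "C = (2 * C\<^sub>N * (T * M\<^sub>3 + 1) + 128 * C\<^sub>E\<^sup>2 * M\<^sub>4 * T\<^sup>2 + 8 * T\<^sup>2 * K\<^sup>2 * C\<^sub>U * M\<^sub>3 + 8 * T * K\<^sup>2)
     * exp (8 * T\<^sup>2 * K\<^sup>2)"
  have C: "C \<ge> 0" using C\<^sub>N(1) C\<^sub>U(1) T_pos by (simp add: C_def M\<^sub>3_def M\<^sub>4_def)
  \<comment> \<open>Passing from \<open>C\<close> to \<open>C + 1\<close> makes the constant
    strictly positive; this also keeps the product infinite when the error in \<open>Z\<close>
    is.\<close>
  have main: "extended_variance M (Y 0) \<le>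
        ennreal (C + 1) * (ennreal h +
          (\<Sum>i<n. (\<integral>\<^sup>+\<omega>. ennreal ((norm (w (real i * h) (X i \<omega>) - Z i \<omega>))\<^sup>2) \<partial>M) * ennreal h))"
    if n: "1 \<le> n" and h: "h = T / real n"
      and Z: "\<forall>i<n. Z i \<in> borel_measurable (augmented_filtration M W (real i * h))"
      and X: "euler_scheme M W b \<sigma> x\<^sub>0 n h X" and Y: "backward_scheme M W f g n h X Z Y"
    for n :: nat and h :: real and Z X :: "nat \<Rightarrow> 'a \<Rightarrow> real^'d" and Y :: "nat \<Rightarrow> 'a \<Rightarrow> real"
  proof -
    interpret S: bsde_scheme M T W K \<delta> L b \<sigma> f g u n h x\<^sub>0 X Z Y
      by unfold_locales (use n h Z X Y g in auto)
    let ?I = "\<lambda>i. \<integral>\<^sup>+\<omega>. ennreal ((norm (w (real i * h) (X i \<omega>) - Z i \<omega>))\<^sup>2) \<partial>M"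
    show ?thesis
    proof (cases "\<forall>i<n. ?I i < \<infinity>")
      case False
      \<comment> \<open>One infinite error term makes the right-hand side infinite, since
        \<open>h\<close> is positive, and the estimate is trivial. In the other case every error is
        square-integrable and the nonnegative integrals are real numbers.\<close>
      then obtain i where i: "i < n" "?I i = \<infinity>" by (auto simp: less_top[symmetric])
      have inf: "(\<Sum>i<n. ?I i * ennreal h) = \<infinity>"
      proof -
        have "?I i * ennreal h = \<infinity>" using i(2) S.h_pos by (simp add: ennreal_top_mult)
        then show ?thesis using i(1) member_le_sum[of i "{..<n}" "\<lambda>i. ?I i * ennreal h"] by (simp add: top_unique)
      qed
      have "ennreal D * (ennreal h + \<infinity>) = \<infinity>" if "D > 0" for D
        using that by (simp add: ennreal_mult_top)
      then show ?thesis unfolding inf using C by (metis add_nonneg_pos infinity_ennreal_def top_greatest zero_less_one)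
    next
      case True
      have int: "integrable M (\<lambda>\<omega>. (norm (w (real i * h) (X i \<omega>) - Z i \<omega>))\<^sup>2)" if "i < n" for i
        using True that S.Z_error_measurable[OF that] by (intro integrableI_nonneg) auto
      interpret B: bsde_scheme_bounds M T W K \<delta> L b \<sigma> f g u n h x\<^sub>0 X Z Y C\<^sub>N C\<^sub>E C\<^sub>U M\<^sub>3 M\<^sub>4
      proof unfold_locales
        show "integrable M (\<lambda>\<omega>. (norm (w (real i * h) (X i \<omega>) - Z i \<omega>))\<^sup>2)" if "i < n" for i
          by (rule int[OF that])
        show "integrable M (\<lambda>\<omega>. (1 + (norm (X i \<omega>))\<^sup>2) ^ 3)" "(\<integral>\<omega>. (1 + (norm (X i \<omega>))\<^sup>2) ^ 3 \<partial>M) \<le> M\<^sub>3"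
          if "i \<le> n" for i
          unfolding M\<^sub>3_def using S.X_moment[OF A\<^sub>3 that] by blast+
        show "integrable M (\<lambda>\<omega>. (1 + (norm (X i \<omega>))\<^sup>2) ^ 4)" "(\<integral>\<omega>. (1 + (norm (X i \<omega>))\<^sup>2) ^ 4 \<partial>M) \<le> M\<^sub>4"
          if "i \<le> n" for i
          unfolding M\<^sub>4_def using S.X_moment[OF A\<^sub>4 that] by blast+
      qed (fact C\<^sub>N C\<^sub>E C\<^sub>U)+
      have \<kappa>: "?I i = ennreal (S.\<kappa> i)" if "i < n" for i
        unfolding S.\<kappa>_def by (rule nn_integral_eq_integral[OF int[OF that]]) simp
      have \<kappa>0: "S.\<kappa> i \<ge> 0" for i unfolding S.\<kappa>_def by simp
      have "(\<Sum>i<n. ?I i * ennreal h) = (\<Sum>i<n. ennreal (S.\<kappa> i * h))"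
        using \<kappa> \<kappa>0 S.h_pos by (intro sum.cong refl) (simp add: ennreal_mult)
      also have "\<dots> = ennreal (\<Sum>i<n. S.\<kappa> i * h)"
        using \<kappa>0 S.h_pos by (intro sum_ennreal) simp
      finally have sum: "(\<Sum>i<n. ?I i * ennreal h) = ennreal (\<Sum>i<n. S.\<kappa> i * h)" .
      have nonneg: "(\<Sum>i<n. S.\<kappa> i * h) \<ge> 0" using \<kappa>0 S.h_pos by (intro sum_nonneg) simp
      have "extended_variance M (Y 0) \<le> ennreal (B.err_moment 0)"
        by (rule B.extended_variance_Y_0_le)
      also have "\<dots> \<le> ennreal ((C + 1) * (h + (\<Sum>i<n. S.\<kappa> i * h)))"
      proof (rule ennreal_leI)
        have "B.err_moment 0 \<le> C * (h + (\<Sum>i<n. S.\<kappa> i * h))"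
          unfolding C_def by (rule B.err_moment_0_le)
        also have "\<dots> \<le> (C + 1) * (h + (\<Sum>i<n. S.\<kappa> i * h))"
          using nonneg S.h_pos by (intro mult_right_mono) auto
        finally show "B.err_moment 0 \<le> (C + 1) * (h + (\<Sum>i<n. S.\<kappa> i * h))" .
      qed
      also have "\<dots> = ennreal (C + 1) * (ennreal h + (\<Sum>i<n. ?I i * ennreal h))"
        unfolding sum using C nonneg S.h_pos by (simp add: ennreal_mult ennreal_plus)
      finally show ?thesis .
    qed
  qed
  show ?thesis
    using C main by (intro exI[of _ "C + 1"] conjI exI[of _ "1::real"]) auto
qed

end
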